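(* Fix an integer $n\ge3$ and real numbers $\nu>0$, $K>1$. Let $\rho_{\epsilon,n}=(1-\delta_\epsilon)|\psi_{\epsilon,n}\rangle\langle\psi_{\epsilon,n}|+\delta_\epsilon\tau_\nu$ be the Wigner-positive states (for small $\epsilon>0$) defined in the context. Then, for all sufficiently small $\epsilon>0$, the Wigner function $W_{\rho_{\epsilon,n}}$ and the vacuum Wigner function $W_0$ are incomparable under continuous majorization: $$W_{\rho_{\epsilon,n}}\nprec_{\mathrm{cont}}W_0\qquad\text{and}\qquad W_0\nprec_{\mathrm{cont}}W_{\rho_{\epsilon,n}}.$$
   Context: Units $\hbar=1$. $|k\rangle$ ($k\ge0$) are the harmonic-oscillator Fock states (normalized Hermite functions) in $L^2(\mathbb R)$. The Wigner function of a state $\rho$ is $W_\rho(q,p)=\frac1\pi\int_{-\infty}^\infty e^{2ipy}\langle q-y|\rho|q+y\rangle\,dy$; the vacuum has $W_0(\boldsymbol r)=\pi^{-1}e^{-|\boldsymbol r|^2}$. For $0<\epsilon<1$ let $|\psi_{\epsilon,n}\rangle=\sqrt{1-\epsilon^2}\,|0\rangle+\epsilon|n\rangle$, and let $\tau_\nu=\sum_{k\ge0}\frac{\nu^k}{(\nu+1)^{k+1}}|k\rangle\langle k|$. Let $P_n(x)=(-1)^nL_n(2x)$ ($L_n$ the Laguerre polynomial), $M_n=\max\{0,-\min_{x\ge0}P_n(x)\}$, $\beta_n=2^{n/2}/\sqrt{n!}$, $s_\nu=2\nu+1$, $c=1-s_\nu^{-1}$. For $\epsilon>0$ with $(1+M_n)\epsilon^2<1$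 put $$x_-(\epsilon)=\left[\frac{1-(1+M_n)\epsilon^2}{2\epsilon\beta_n}\right]^{2/n},\qquad \delta_\epsilon=K\cdot 2\epsilon\beta_n s_\nu\,x_-(\epsilon)^{n/2}e^{-c\,x_-(\epsilon)}.$$ For sufficiently small $\epsilon$ one has $0<\delta_\epsilon<1$ and $W_{\rho_{\epsilon,n}}\ge0$ everywhere. Continuous majorization: for non-negative functions $W,V$ on $\mathbb R^2$ with $\int W=\int V=1$, $W\prec_{\mathrm{cont}}V$ means $\sup_{|A|=m}\int_A W\le\sup_{|A|=m}\int_A V$ for every $m>0$ (suprema over measurable sets of Lebesgue measure $m$); equivalently $\int (W-t)_+\le\int (V-t)_+$ for every $t\ge0$, where $(y)_+=\max\{y,0\}$. *)

theory Defs
  imports "HOL-Analysis.Analysis" "HOL-Real_Asymp.Real_Asymp"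
begin

section \<open>Fock states\<close>

text \<open>Physicists' Hermite polynomials.\<close>

fun hermite_poly :: "nat \<Rightarrow> real \<Rightarrow> real" where
  "hermite_poly 0 x = 1"
| "hermite_poly (Suc 0) x = 2 * x"
| "hermite_poly (Suc (Suc k)) x =
     2 * x * hermite_poly (Suc k) x - 2 * real (Suc k) * hermite_poly k x"

definition fock :: "nat \<Rightarrow> real \<Rightarrow> complex" where
  "fock k x =
     complex_of_real (hermite_poly k x * exp (- x\<^sup>2 / 2) / sqrt (2 ^ k * fact k * sqrt pi))"

section \<open>States and Wigner functions\<close>

text \<open>
  A state \<open>\<rho>\<close> is represented by its position kernel \<open>\<rho> x y = \<langle>x|\<rho>|y\<rangle>\<close>.
\<close>

type_synonym kernel = "real \<Rightarrow> real \<Rightarrow> complex"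

definition pure_state :: "(real \<Rightarrow> complex) \<Rightarrow> kernel" where
  "pure_state \<phi> x y = \<phi> x * cnj (\<phi> y)"

definition thermal_state :: "real \<Rightarrow> kernel" where
  "thermal_state \<nu> x y =
     (\<Sum>k. complex_of_real (\<nu> ^ k / (\<nu> + 1) ^ (k + 1)) * pure_state (fock k) x y)"

definition wigner_complex :: "kernel \<Rightarrow> real \<times> real \<Rightarrow> complex" where
  "wigner_complex \<rho> = (\<lambda>(q, p).
     (1 / complex_of_real pi) *
     (LINT y|lborel. exp (2 * \<i> * complex_of_real p * complex_of_real y) * \<rho> (q - y) (q + y)))"

text \<open>
  For a Hermitian kernel the integral is real, so taking the real part only changes the type;
  see \<open>wigner_complex_hermitian\<close> below.
\<close>

definition wigner :: "kernel \<Rightarrow> real \<times> real \<Rightarrow> real" where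
  "wigner \<rho> r = Re (wigner_complex \<rho> r)"

definition vacuum_wigner :: "real \<times> real \<Rightarrow> real" where
  "vacuum_wigner = wigner (pure_state (fock 0))"

section \<open>The family of states\<close>

definition psi :: "nat \<Rightarrow> real \<Rightarrow> real \<Rightarrow> complex" where
  "psi n \<epsilon> x = complex_of_real (sqrt (1 - \<epsilon>\<^sup>2)) * fock 0 x + complex_of_real \<epsilon> * fock n x"

definition laguerre :: "nat \<Rightarrow> real \<Rightarrow> real" where
  "laguerre n x = (\<Sum>k\<le>n. (-1) ^ k * real (n choose k) / fact k * x ^ k)"

definition P_poly :: "nat \<Rightarrow> real \<Rightarrow> real" where
  "P_poly n x = (-1) ^ n * laguerre n (2 * x)"

text \<open>
  The leading coefficient \<open>2 ^ n / fact n\<close> of \<open>P_poly n\<close> is positive, so the infimum over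
  \<open>x \<ge> 0\<close> is a minimum.
\<close>

definition M_const :: "nat \<Rightarrow> real" where
  "M_const n = max 0 (- (INF x\<in>{0..}. P_poly n x))"

definition beta_coeff :: "nat \<Rightarrow> real" where
  "beta_coeff n = 2 powr (real n / 2) / sqrt (fact n)"

definition s_par :: "real \<Rightarrow> real" where
  "s_par \<nu> = 2 * \<nu> + 1"

definition c_par :: "real \<Rightarrow> real" where
  "c_par \<nu> = 1 - 1 / s_par \<nu>"

definition x_minus :: "nat \<Rightarrow> real \<Rightarrow> real" where
  "x_minus n \<epsilon> = ((1 - (1 + M_const n) * \<epsilon>\<^sup>2) / (2 * \<epsilon> * beta_coeff n)) powr (2 / real n)"

definition delta :: "nat \<Rightarrow> real \<Rightarrow> real \<Rightarrow> real \<Rightarrow> real" where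
  "delta n \<nu> K \<epsilon> =
     K * (2 * \<epsilon> * beta_coeff n * s_par \<nu> * x_minus n \<epsilon> powr (real n / 2) * exp (- c_par \<nu> * x_minus n \<epsilon>))"

definition rho :: "nat \<Rightarrow> real \<Rightarrow> real \<Rightarrow> real \<Rightarrow> kernel" where
  "rho n \<nu> K \<epsilon> x y =
     complex_of_real (1 - delta n \<nu> K \<epsilon>) * pure_state (psi n \<epsilon>) x y +
     complex_of_real (delta n \<nu> K \<epsilon>) * thermal_state \<nu> x y"

section \<open>Continuous majorization\<close>

text \<open>The domain of the majorization relation.\<close>

definition phase_space_density :: "(real \<times> real \<Rightarrow> real) \<Rightarrow> bool" where
  "phase_space_density W \<longleftrightarrow>
     (\<forall>r. 0 \<le> W r) \<and> integrable lebesgue W \<and> (LINT r|lebesgue. W r) = 1"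

text \<open>
  For integrable \<open>W\<close> the set of values below is nonempty and bounded above, so the real
  supremum is the genuine one.
\<close>

definition max_mass :: "(real \<times> real \<Rightarrow> real) \<Rightarrow> real \<Rightarrow> real" where
  "max_mass W m =
     (SUP A\<in>{A \<in> sets lebesgue. emeasure lebesgue A = ennreal m}. LINT r:A|lebesgue. W r)"

definition cont_majorized_by :: "(real \<times> real \<Rightarrow> real) \<Rightarrow> (real \<times> real \<Rightarrow> real) \<Rightarrow> bool"
    (infix "\<prec>\<^sub>c" 50) where
  "W \<prec>\<^sub>c V \<longleftrightarrow> (\<forall>m>0. max_mass W m \<le> max_mass V m)"

section \<open>Wigner functions are real\<close>

definition hermitian_kernel :: "kernel \<Rightarrow> bool" where
  "hermitian_kernel \<rho> \<longleftrightarrow> (\<forall>x y. cnj (\<rho> x y) = \<rho> y x)"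

lemma hermitian_pure_state: "hermitian_kernel (pure_state \<phi>)"
  by (simp add: hermitian_kernel_def pure_state_def)

lemma cnj_fock [simp]: "cnj (fock k x) = fock k x"
  by (simp add: fock_def)

text \<open>The kernel series of the thermal state converges absolutely at every point.\<close>

lemma fock_step:
  "norm (fock (Suc (Suc k)) x)
     \<le> 2 * \<bar>x\<bar> / sqrt (2 * (real k + 2)) * norm (fock (Suc k) x) + norm (fock k x)"
proof -
  define g where "g = exp (- x\<^sup>2 / 2)"
  define N where "N j = sqrt (2 ^ j * fact j * sqrt pi)" for j :: nat
  define a where "a j = hermite_poly j x * g / N j" for j
  have Np: "N j > 0" for j by (simp add: N_def)
  have NS: "N (Suc j) = sqrt (2 * (real j + 1)) * N j" for j
    by (simp add: N_def algebra_simps flip: real_sqrt_mult)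
  define u where "u = sqrt (2 * (real k + 2))"
  define v where "v = sqrt (2 * (real k + 1))"
  have uv: "u > 0" "v > 0" "v \<le> u" "v * v = 2 * (real k + 1)"
    by (auto simp: u_def v_def)
  have N2: "N (Suc (Suc k)) = u * N (Suc k)" "N (Suc k) = v * N k"
    using NS[of "Suc k"] NS[of k] by (simp_all add: u_def v_def add.commute)
  have "a (Suc (Suc k)) = (2 * x * hermite_poly (Suc k) x - v * v * hermite_poly k x) * g / (u * N (Suc k))"
    by (simp add: a_def N2(1) uv(4) add.commute)
  also have "\<dots> = 2 * x / u * a (Suc k) - v * v * hermite_poly k x * g / (u * N (Suc k))"
    by (simp add: a_def algebra_simps diff_divide_distrib)
  also have "v * v * hermite_poly k x * g / (u * N (Suc k)) = v / u * a k"
    using uv(2) by (simp add: a_def N2(2))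
  finally have "\<bar>a (Suc (Suc k))\<bar> \<le> \<bar>2 * x / u * a (Suc k)\<bar> + \<bar>v / u * a k\<bar>"
    by (simp only: abs_triangle_ineq4)
  also have "\<dots> = 2 * \<bar>x\<bar> / u * \<bar>a (Suc k)\<bar> + v / u * \<bar>a k\<bar>"
    using uv by (simp add: abs_mult)
  also have "v / u * \<bar>a k\<bar> \<le> 1 * \<bar>a k\<bar>"
    using uv by (intro mult_right_mono) auto
  finally have "\<bar>a (Suc (Suc k))\<bar> \<le> 2 * \<bar>x\<bar> / u * \<bar>a (Suc k)\<bar> + \<bar>a k\<bar>" by simp
  moreover have "norm (fock j x) = \<bar>a j\<bar>" for j
    by (simp only: fock_def a_def g_def N_def norm_of_real)
  ultimately show ?thesis by (simp add: u_def)
qed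

lemma fock_subexponential:
  assumes "\<theta> > 1"
  shows "\<exists>C\<ge>0. \<forall>k. norm (fock k x) \<le> C * \<theta> ^ k"
proof -
  define e where "e k = 2 * \<bar>x\<bar> / sqrt (2 * (real k + 2))" for k :: nat
  have "e \<longlonglongrightarrow> 0" unfolding e_def by real_asymp
  moreover have "(\<theta>\<^sup>2 - 1) / \<theta> > 0" using assms by simp
  ultimately have "\<forall>\<^sub>F k in sequentially. e k < (\<theta>\<^sup>2 - 1) / \<theta>"
    by (rule order_tendstoD)
  then obtain N where N: "e k < (\<theta>\<^sup>2 - 1) / \<theta>" if "k \<ge> N" for k
    by (auto simp: eventually_sequentially)
  have e0: "e k \<ge> 0" for k by (simp add: e_def)
  define C where "C = (\<Sum>k\<le>Suc N. norm (fock k x))"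
  have C0: "C \<ge> 0" by (simp add: C_def sum_nonneg)
  have "norm (fock k x) \<le> C * \<theta> ^ k" for k
  proof (induction k rule: less_induct)
    case (less k)
    show ?case
    proof (cases "k \<le> Suc N")
      case True
      then have "norm (fock k x) \<le> C" unfolding C_def
        by (intro member_le_sum) auto
      also have "C * 1 \<le> C * \<theta> ^ k"
        using assms C0 by (intro mult_left_mono) auto
      finally show ?thesis by simp
    next
      case False
      then obtain j where j: "k = Suc (Suc j)" "j \<ge> N"
        by (metis Suc_le_D not_less_eq_eq Suc_le_mono)
      have "norm (fock k x) \<le> e j * norm (fock (Suc j) x) + norm (fock j x)"
        using fock_step[of j x] by (simp add: j e_def)
      also have "\<dots> \<le> e j * (C * \<theta> ^ Suc j) + C * \<theta> ^ j"
        using less[of "Suc j"] less[of j] j e0[of j] by (intro add_mono mult_left_mono) auto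
      also have "\<dots> = (e j * \<theta> + 1) * (C * \<theta> ^ j)" by (simp add: algebra_simps)
      also have "\<dots> \<le> \<theta>\<^sup>2 * (C * \<theta> ^ j)"
        using N[OF j(2)] assms C0 by (intro mult_right_mono) (auto simp: field_simps)
      also have "\<dots> = C * \<theta> ^ k" by (simp add: j power2_eq_square)
      finally show ?thesis .
    qed
  qed
  with C0 show ?thesis by blast
qed

lemma summable_thermal_state:
  assumes "\<nu> > 0"
  shows "summable (\<lambda>k. norm (complex_of_real (\<nu> ^ k / (\<nu> + 1) ^ (k + 1)) * pure_state (fock k) x y))"
proof -
  define r where "r = \<nu> / (\<nu> + 1)"
  have r: "0 < r" "r < 1" using assms by (auto simp: r_def)
  define \<theta> where "\<theta> = sqrt (sqrt (1 / r))"
  have \<theta>1: "\<theta> > 1" using r by (simp add: \<theta>_def)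
  have \<theta>2: "\<theta> * \<theta> = sqrt (1 / r)" using r by (simp add: \<theta>_def)
  have q: "r * (\<theta> * \<theta>) < 1"
  proof -
    have "r * (\<theta> * \<theta>) = sqrt r"
      using r by (simp add: \<theta>2 real_sqrt_divide real_div_sqrt)
    then show ?thesis using r by simp
  qed
  obtain A where A: "A \<ge> 0" "norm (fock k x) \<le> A * \<theta> ^ k" for k
    using fock_subexponential[OF \<theta>1] by blast
  obtain B where B: "B \<ge> 0" "norm (fock k y) \<le> B * \<theta> ^ k" for k
    using fock_subexponential[OF \<theta>1] by blast
  have "summable (\<lambda>k. (A * B / (\<nu> + 1)) * (r * (\<theta> * \<theta>)) ^ k)"
    using r \<theta>1 q by (intro summable_mult summable_geometric) simp
  then show ?thesis
  proof (rule summable_comparison_test[rotated], intro exI[of _ 0] allI impI)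
    fix k
    have eq: "\<nu> ^ k / (\<nu> + 1) ^ (k + 1) = r ^ k / (\<nu> + 1)"
      by (simp add: r_def power_divide)
    have "norm (complex_of_real (\<nu> ^ k / (\<nu> + 1) ^ (k + 1)) * pure_state (fock k) x y)
        = r ^ k / (\<nu> + 1) * (norm (fock k x) * norm (fock k y))"
      unfolding eq pure_state_def norm_mult complex_mod_cnj norm_of_real using r assms by simp
    also have "\<dots> \<le> r ^ k / (\<nu> + 1) * ((A * \<theta> ^ k) * (B * \<theta> ^ k))"
      using A B r assms \<theta>1 by (intro mult_left_mono mult_mono) auto
    also have "\<dots> = (A * B / (\<nu> + 1)) * (r * (\<theta> * \<theta>)) ^ k"
      by (simp add: power_mult_distrib)
    finally show "norm (norm (complex_of_real (\<nu> ^ k / (\<nu> + 1) ^ (k + 1)) * pure_state (fock k) x y))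
        \<le> (A * B / (\<nu> + 1)) * (r * (\<theta> * \<theta>)) ^ k" by simp
  qed
qed

lemma hermitian_thermal_state:
  assumes "\<nu> > 0"
  shows "hermitian_kernel (thermal_state \<nu>)"
  unfolding hermitian_kernel_def
proof (intro allI)
  fix x y
  let ?f = "\<lambda>x y k. complex_of_real (\<nu> ^ k / (\<nu> + 1) ^ (k + 1)) * pure_state (fock k) x y"
  have "?f x y sums thermal_state \<nu> x y"
    unfolding thermal_state_def
    using summable_norm_cancel[OF summable_thermal_state[OF assms]] by (rule summable_sums)
  then have "(\<lambda>k. cnj (?f x y k)) sums cnj (thermal_state \<nu> x y)"
    by (simp only: sums_cnj)
  moreover have "cnj (?f x y k) = ?f y x k" for k
    by (simp add: pure_state_def mult.commute)
  ultimately have "?f y x sums cnj (thermal_state \<nu> x y)" by (simp only:)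
  then show "cnj (thermal_state \<nu> x y) = thermal_state \<nu> y x"
    unfolding thermal_state_def by (simp add: sums_iff)
qed

lemma hermitian_rho:
  assumes "\<nu> > 0"
  shows "hermitian_kernel (rho n \<nu> K \<epsilon>)"
  using hermitian_pure_state hermitian_thermal_state[OF assms]
  by (simp add: hermitian_kernel_def rho_def)

lemma wigner_complex_hermitian:
  assumes "hermitian_kernel \<rho>"
  shows "wigner_complex \<rho> r = complex_of_real (wigner \<rho> r)"
proof (cases r)
  case (Pair q p)
  define f where
    "f y = exp (2 * \<i> * complex_of_real p * complex_of_real y) * \<rho> (q - y) (q + y)" for y
  have "cnj (f y) = f (- y)" for y
    using assms by (simp add: f_def hermitian_kernel_def exp_cnj)
  then have "cnj (LINT y|lborel. f y) = (LINT y|lborel. f (- y))"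
    using Bochner_Integration.integral_cnj[of lborel f] by simp
  also have "\<dots> = (LINT y|lborel. f y)"
    using lborel_integral_real_affine[of "-1" f 0] by simp
  finally have "cnj (wigner_complex \<rho> r) = wigner_complex \<rho> r"
    by (simp add: wigner_complex_def Pair f_def)
  then show ?thesis
    by (simp add: wigner_def complex_eq_iff)
qed

end

theory Submission
  imports Defs "HOL-Probability.Probability"
begin

text \<open>
  With \<open>x = q\<^sup>2 + p\<^sup>2\<close> and \<open>z = q + \<i>p\<close>, the Wigner function of the state is
  \<open>\<pi>\<inverse> e\<^sup>-\<^sup>x ((1 - \<delta>) (1 - \<epsilon>\<^sup>2 + \<epsilon>\<^sup>2 P\<^sub>n(x) + 2\<epsilon> \<surd>(1 - \<epsilon>\<^sup>2) \<beta>\<^sub>n Re z\<^sup>n) + (\<delta>/s) e\<^sup>c\<^sup>x)\<close>.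
  For \<open>x \<ge> x\<^sub>-\<close> the thermal term dominates the negative part and leaves a tail of order
  \<open>e\<close> to the power \<open>-x/s\<close>, heavier than that of the vacuum; hence the vacuum is not majorized.

  For the other direction, test with the convex function \<open>\<Phi>\<close> with \<open>\<Phi>' y = min y T\<close>, where
  \<open>\<pi>T\<close> is the exponential of \<open>-Y\<close>. The angular average kills the first-order term in \<open>\<epsilon>\<close>. The
  second-order one consists of the curvature contribution of \<open>(Re z\<^sup>n)\<^sup>2\<close> over \<open>x > Y\<close> and of
  \<open>\<integral> \<Phi>'(W\<^sub>0) (W\<^sub>n - W\<^sub>0)\<close>; an integration by parts turns their sum into the integral of
  a positive weight against a polynomial with leading term
  \<open>(n - 2) 2\<^sup>n\<^sup>-\<^sup>1 / (n - 1)!\<close> times \<open>x\<^sup>n\<^sup>-\<^sup>1\<close>, positive for large \<open>Y\<close> exactly because \<open>n \<ge> 3\<close>.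
  The admixture \<open>\<delta>\<close> is exponentially small in a negative power of \<open>\<epsilon>\<close> and does not matter.
\<close>

section \<open>Wigner transforms of Hermite functions\<close>

text \<open>The obstacle in the second direction is that \<open>trunc_square T\<close> is not twice
  differentiable at \<open>T\<close>, and that the vacuum takes the value \<open>T\<close> on the
  circle \<open>x = Y\<close>, where the first-order interference pushes the state to either side.
  No expansion is attempted there. The tangent inequality of a convex function holds everywhere; its
  quadratic improvement is claimed only for \<open>x > Z\<close>, with \<open>Z\<close> slightly
  above \<open>Y\<close>. There the vacuum stays below \<open>T\<close> by a fixed gap, so for small
  \<epsilon> the state is below \<open>T\<close> too. Moving the cutoff from \<open>Y\<close> to
  \<open>Z\<close> costs little because \<open>J_tail\<close> is Lipschitz in it. The remaining
  error is cubic in \<epsilon>.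

  In the first direction the form of \<open>delta\<close> matters. The radial part is at least
  \<open>1 - (1 + M_const n) * \<epsilon>^2\<close>, and \<open>x_minus\<close> is the
  \<open>x\<close> at which the worst case
  \<open>2 * \<epsilon> * beta_coeff n * x powr (n / 2)\<close> of the interference reaches this
  bound. Balancing the interference by the thermal term at that point requires \<open>delta\<close>
  with \<open>K = 1\<close>; since \<open>x powr (n / 2) * exp (- c * x)\<close> decreases from
  there on, the balance persists outward, and \<open>K > 1\<close> leaves the fraction
  \<open>1 - 1 / K\<close> of the thermal term over.\<close>

lemma hermite_poly_Suc:
  "hermite_poly (Suc k) x = 2 * x * hermite_poly k x - 2 * real k * hermite_poly (k - 1) x"
  by (cases k) auto

lemma hermite_poly_deriv:
  "(hermite_poly k has_real_derivative 2 * real k * hermite_poly (k - 1) x) (at x)"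
proof (induction k arbitrary: x rule: less_induct)
  case (less k)
  consider "k = 0" | "k = 1" | j where "k = Suc (Suc j)" by (metis One_nat_def not0_implies_Suc)
  then show ?case
  proof cases
    case 1
    then have "hermite_poly k = (\<lambda>_. 1)" by auto
    then show ?thesis using 1 by simp
  next
    case 2
    then have "hermite_poly k = (\<lambda>x. 2 * x)" by auto
    then show ?thesis using 2 by (auto intro!: derivative_eq_intros)
  next
    case 3
    have e: "hermite_poly k = (\<lambda>x. 2 * x * hermite_poly (Suc j) x - 2 * real (Suc j) * hermite_poly j x)"
      using 3 by auto
    have d1: "(hermite_poly (Suc j) has_real_derivative 2 * real (Suc j) * hermite_poly j x) (at x)"
      using less[of "Suc j"] 3 by simp
    have d2: "(hermite_poly j has_real_derivative 2 * real j * hermite_poly (j - 1) x) (at x)"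
      using less[of j] 3 by simp
    have "(hermite_poly k has_real_derivative
        2 * hermite_poly (Suc j) x + 2 * x * (2 * real (Suc j) * hermite_poly j x)
          - 2 * real (Suc j) * (2 * real j * hermite_poly (j - 1) x)) (at x)"
      unfolding e by (auto intro!: derivative_eq_intros d1 d2)
    also have "2 * hermite_poly (Suc j) x + 2 * x * (2 * real (Suc j) * hermite_poly j x)
          - 2 * real (Suc j) * (2 * real j * hermite_poly (j - 1) x) = 2 * real k * hermite_poly (k - 1) x"
      unfolding 3 by (simp add: hermite_poly_Suc[of j] algebra_simps del: hermite_poly.simps)
    finally show ?thesis .
  qed
qed

lemma hermite_poly_uminus: "hermite_poly k (- x) = (-1) ^ k * hermite_poly k x"
  by (induction k x rule: hermite_poly.induct) (auto simp: algebra_simps)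

text \<open>The exponent is arbitrary for the sake of the induction: the factor \<open>x\<close> of
  the recurrence is absorbed by one half of \<open>\<theta>\<close>, and the hypothesis for the
  previous index is used with the other half.\<close>

lemma hermite_poly_le_exp_square:
  assumes "\<theta> > 0"
  shows "\<exists>C\<ge>0. \<forall>x. \<bar>hermite_poly k x\<bar> \<le> C * exp (\<theta> * x\<^sup>2)"
  using assms
proof (induction k arbitrary: \<theta> rule: less_induct)
  case (less k)
  show ?case
  proof (cases k)
    case 0
    then show ?thesis using less.prems by (intro exI[of _ 1]) auto
  next
    case (Suc j)
    from less.IH[of j "\<theta> / 2"] Suc less.prems obtain A where
      A: "A \<ge> 0" "\<And>x. \<bar>hermite_poly j x\<bar> \<le> A * exp (\<theta> / 2 * x\<^sup>2)" by auto
    from less.IH[of "j - 1" \<theta>] Suc less.prems obtain B where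
      B: "B \<ge> 0" "\<And>x. \<bar>hermite_poly (j - 1) x\<bar> \<le> B * exp (\<theta> * x\<^sup>2)" by (auto simp: less_Suc_eq_le)
    define D where "D = 2 / \<theta> + 1"
    have lin: "\<bar>x\<bar> \<le> D * exp (\<theta> / 2 * x\<^sup>2)" for x :: real
    proof -
      have "\<bar>x\<bar> \<le> 1 + x\<^sup>2" using zero_le_power2[of "\<bar>x\<bar> - 1"] by (auto simp: power2_diff)
      also have "\<dots> = 1 + 2 / \<theta> * (\<theta> / 2 * x\<^sup>2)" using less.prems by simp
      also have "\<dots> \<le> exp (\<theta> / 2 * x\<^sup>2) + 2 / \<theta> * exp (\<theta> / 2 * x\<^sup>2)"
      proof (intro add_mono mult_left_mono)
        show "\<theta> / 2 * x\<^sup>2 \<le> exp (\<theta> / 2 * x\<^sup>2)"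
          using exp_ge_add_one_self[of "\<theta> / 2 * x\<^sup>2"] by linarith
      qed (use less.prems in auto)
      finally show ?thesis by (simp add: D_def algebra_simps)
    qed
    have "\<bar>hermite_poly k x\<bar> \<le> (2 * D * A + 2 * real j * B) * exp (\<theta> * x\<^sup>2)" for x
    proof -
      have "\<bar>hermite_poly k x\<bar> \<le> 2 * (\<bar>x\<bar> * \<bar>hermite_poly j x\<bar>) + 2 * real j * \<bar>hermite_poly (j - 1) x\<bar>"
        unfolding Suc hermite_poly_Suc by (rule order_trans[OF abs_triangle_ineq4]) (simp add: abs_mult)
      also have "\<dots> \<le> 2 * ((D * exp (\<theta> / 2 * x\<^sup>2)) * (A * exp (\<theta> / 2 * x\<^sup>2))) + 2 * real j * (B * exp (\<theta> * x\<^sup>2))"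
        using A B lin[of x] by (intro add_mono mult_left_mono mult_mono) auto
      also have "\<dots> = 2 * D * A * (exp (\<theta> / 2 * x\<^sup>2) * exp (\<theta> / 2 * x\<^sup>2)) + 2 * real j * B * exp (\<theta> * x\<^sup>2)"
        by (simp add: algebra_simps)
      also have "exp (\<theta> / 2 * x\<^sup>2) * exp (\<theta> / 2 * x\<^sup>2) = exp (\<theta> * x\<^sup>2)"
        by (simp flip: exp_add)
      finally show ?thesis by (simp add: algebra_simps)
    qed
    moreover have "2 * D * A + 2 * real j * B \<ge> 0" using less.prems A B by (simp add: D_def)
    ultimately show ?thesis by blast
  qed
qed

text \<open>Left unnormalized so that the recurrence and the derivative formula have integer
  coefficients; the norms enter only with \<open>fock_norm\<close>.\<close>

definition hermite_fun :: "nat \<Rightarrow> real \<Rightarrow> real" where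
  "hermite_fun k x = hermite_poly k x * exp (- x\<^sup>2 / 2)"

lemma hermite_fun_Suc:
  "hermite_fun (Suc k) x = 2 * x * hermite_fun k x - 2 * real k * hermite_fun (k - 1) x"
  by (simp add: hermite_fun_def hermite_poly_Suc algebra_simps)

lemma hermite_fun_uminus: "hermite_fun k (- x) = (-1) ^ k * hermite_fun k x"
  by (simp add: hermite_fun_def hermite_poly_uminus)

lemma hermite_fun_deriv:
  "(hermite_fun k has_real_derivative 2 * real k * hermite_fun (k - 1) x - x * hermite_fun k x) (at x)"
  unfolding hermite_fun_def [abs_def]
  by (auto intro!: derivative_eq_intros hermite_poly_deriv simp: algebra_simps)

lemma continuous_on_hermite_fun [continuous_intros]:
  "continuous_on S f \<Longrightarrow> continuous_on S (\<lambda>x. hermite_fun k (f x))"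
  by (rule continuous_on_compose2[of UNIV "hermite_fun k"])
     (auto intro: DERIV_continuous_on[OF hermite_fun_deriv])

lemma measurable_hermite_fun [measurable]: "hermite_fun k \<in> borel_measurable borel"
  by (intro borel_measurable_continuous_onI continuous_intros)

lemma hermite_fun_le_gauss:
  obtains C where "C \<ge> 0" "\<And>x. \<bar>hermite_fun k x\<bar> \<le> C * exp (- x\<^sup>2 / 4)"
proof -
  obtain C where C: "C \<ge> 0" "\<And>x. \<bar>hermite_poly k x\<bar> \<le> C * exp (1 / 4 * x\<^sup>2)"
    using hermite_poly_le_exp_square[of "1 / 4" k] by auto
  have "\<bar>hermite_fun k x\<bar> \<le> C * exp (- x\<^sup>2 / 4)" for x
  proof -
    have "\<bar>hermite_fun k x\<bar> \<le> C * exp (1 / 4 * x\<^sup>2) * exp (- x\<^sup>2 / 2)"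
      using C(2)[of x] by (simp add: hermite_fun_def abs_mult)
    also have "\<dots> = C * exp (- x\<^sup>2 / 4)"
      by (simp add: mult.assoc flip: exp_add)
    finally show ?thesis .
  qed
  with C(1) show ?thesis by (rule that)
qed

lemma integrable_gauss: "integrable lborel (\<lambda>y::real. exp (- y\<^sup>2 / 2))"
proof -
  have "integrable lborel (\<lambda>y. sqrt (2 * pi) * std_normal_density y)"
    by (intro integrable_mult_right integrable_normal_density) auto
  then show ?thesis by (simp add: std_normal_density_def)
qed

definition hermite_wigner_integrand :: "nat \<Rightarrow> nat \<Rightarrow> real \<Rightarrow> real \<Rightarrow> real \<Rightarrow> complex" where
  "hermite_wigner_integrand j k q p y =
     exp (2 * \<i> * complex_of_real p * complex_of_real y) *
       complex_of_real (hermite_fun j (q - y) * hermite_fun k (q + y))"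

definition hermite_wigner :: "nat \<Rightarrow> nat \<Rightarrow> real \<Rightarrow> real \<Rightarrow> complex" where
  "hermite_wigner j k q p = (LINT y|lborel. hermite_wigner_integrand j k q p y)"

lemma norm_exp_2_i [simp]: "norm (exp (2 * \<i> * complex_of_real p * complex_of_real y)) = 1"
  by (simp add: norm_exp_eq_Re)

lemma measurable_hermite_wigner_integrand [measurable]:
  "hermite_wigner_integrand j k q p \<in> borel_measurable borel"
  unfolding hermite_wigner_integrand_def [abs_def]
  by (intro borel_measurable_continuous_onI continuous_intros)

text \<open>By the parallelogram identity the Gaussian bounds at \<open>q - y\<close> and
  \<open>q + y\<close> multiply to a Gaussian in \<open>y\<close> times a factor in \<open>q\<close>
  that is at most 1. The bound serves both integrability and decay at infinity.\<close>

lemma hermite_wigner_integrand_bound: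
  obtains C where "C \<ge> 0" "\<And>p y. norm (hermite_wigner_integrand j k q p y) \<le> C * exp (- y\<^sup>2 / 2)"
proof -
  obtain A where A: "A \<ge> 0" "\<And>x. \<bar>hermite_fun j x\<bar> \<le> A * exp (- x\<^sup>2 / 4)"
    using hermite_fun_le_gauss[of j] by blast
  obtain B where B: "B \<ge> 0" "\<And>x. \<bar>hermite_fun k x\<bar> \<le> B * exp (- x\<^sup>2 / 4)"
    using hermite_fun_le_gauss[of k] by blast
  have "norm (hermite_wigner_integrand j k q p y) \<le> A * B * exp (- y\<^sup>2 / 2)" for p y
  proof -
    have "norm (hermite_wigner_integrand j k q p y) = \<bar>hermite_fun j (q - y)\<bar> * \<bar>hermite_fun k (q + y)\<bar>"
      by (simp add: hermite_wigner_integrand_def norm_mult abs_mult)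
    also have "\<dots> \<le> (A * exp (- (q - y)\<^sup>2 / 4)) * (B * exp (- (q + y)\<^sup>2 / 4))"
      using A B by (intro mult_mono) auto
    also have "\<dots> = A * B * exp (- (q - y)\<^sup>2 / 4 + - (q + y)\<^sup>2 / 4)"
      unfolding exp_add by simp
    also have "- (q - y)\<^sup>2 / 4 + - (q + y)\<^sup>2 / 4 = - y\<^sup>2 / 2 - q\<^sup>2 / 2"
      by (simp add: power2_eq_square field_simps)
    also have "A * B * exp (- y\<^sup>2 / 2 - q\<^sup>2 / 2) \<le> A * B * exp (- y\<^sup>2 / 2)"
      using A B by (intro mult_left_mono) auto
    finally show ?thesis .
  qed
  moreover have "A * B \<ge> 0" using A B by simp
  ultimately show ?thesis using that by blast
qed

lemma integrable_hermite_wigner_integrand: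
  "integrable lborel (hermite_wigner_integrand j k q p)"
proof -
  obtain C where C: "C \<ge> 0" "\<And>p y. norm (hermite_wigner_integrand j k q p y) \<le> C * exp (- y\<^sup>2 / 2)"
    using hermite_wigner_integrand_bound by blast
  show ?thesis
    by (rule Bochner_Integration.integrable_bound[OF integrable_mult_right[OF integrable_gauss, of C]])
       (use C in \<open>auto simp: measurable_hermite_wigner_integrand\<close>)
qed

lemma hermite_wigner_integrand_limits:
  "(hermite_wigner_integrand j k q p \<longlongrightarrow> 0) at_top"
  "(hermite_wigner_integrand j k q p \<longlongrightarrow> 0) at_bot"
proof -
  obtain C where C: "C \<ge> 0" "\<And>p y. norm (hermite_wigner_integrand j k q p y) \<le> C * exp (- y\<^sup>2 / 2)"
    using hermite_wigner_integrand_bound by blast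
  have "((\<lambda>y::real. C * exp (- y\<^sup>2 / 2)) \<longlongrightarrow> 0) at_top" by real_asymp
  then show "(hermite_wigner_integrand j k q p \<longlongrightarrow> 0) at_top"
    by (rule Lim_null_comparison[rotated]) (use C in auto)
  have "((\<lambda>y::real. C * exp (- y\<^sup>2 / 2)) \<longlongrightarrow> 0) at_bot" by real_asymp
  then show "(hermite_wigner_integrand j k q p \<longlongrightarrow> 0) at_bot"
    by (rule Lim_null_comparison[rotated]) (use C in auto)
qed

lemma integral_deriv_eq_0:
  fixes F :: "real \<Rightarrow> complex"
  assumes "\<And>x. (F has_vector_derivative f x) (at x)" "continuous_on UNIV f" "integrable lborel f"
    and "(F \<longlongrightarrow> 0) at_top" "(F \<longlongrightarrow> 0) at_bot"
  shows "(LINT x|lborel. f x) = 0"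
proof -
  have "(LBINT x=-\<infinity>..\<infinity>. f x) = 0 - 0"
  proof (rule interval_integral_FTC_integrable[where F = F])
    show "set_integrable lborel (einterval (- \<infinity>) \<infinity>) f"
      using assms(3) by (simp add: set_integrable_def)
    show "((F \<circ> real_of_ereal) \<longlongrightarrow> 0) (at_right (- \<infinity>))" "((F \<circ> real_of_ereal) \<longlongrightarrow> 0) (at_left \<infinity>)"
      using assms(4,5) by (simp_all add: ereal_tendsto_simps)
    show "isCont f x" for x using assms(2) by (simp add: continuous_on_eq_continuous_at)
  qed (use assms(1) in auto)
  then show ?thesis by (simp add: interval_lebesgue_integral_def set_lebesgue_integral_def)
qed


text \<open>Differentiation lowers both indices; the term with \<open>k - 1\<close> is then traded
  for one with \<open>Suc k\<close> by the Hermite recurrence. After this the contributions linear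
  in \<open>y\<close> from the two Gaussians cancel, and only the constant factor
  \<open>2 * (q + \<i> * p)\<close> is left.\<close>

lemma hermite_wigner_integrand_deriv:
  "(hermite_wigner_integrand j k q p has_vector_derivative
     2 * (complex_of_real q + \<i> * complex_of_real p) * hermite_wigner_integrand j k q p y
     - 2 * of_nat j * hermite_wigner_integrand (j - 1) k q p y
     - hermite_wigner_integrand j (Suc k) q p y) (at y)"
proof -
  let ?e = "exp (2 * \<i> * complex_of_real p * complex_of_real y)"
  let ?a = "hermite_fun j (q - y)" and ?b = "hermite_fun k (q + y)"
  let ?a' = "2 * real j * hermite_fun (j - 1) (q - y) - (q - y) * ?a"
  let ?b' = "2 * real k * hermite_fun (k - 1) (q + y) - (q + y) * ?b"
  have "((\<lambda>y. hermite_fun j (q - y)) has_real_derivative ?a' * (-1)) (at y)"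
    by (rule DERIV_chain2[OF hermite_fun_deriv]) (auto intro!: derivative_eq_intros)
  moreover have "((\<lambda>y. hermite_fun k (q + y)) has_real_derivative ?b' * 1) (at y)"
    by (rule DERIV_chain2[OF hermite_fun_deriv]) (auto intro!: derivative_eq_intros)
  ultimately have "((\<lambda>y. hermite_fun j (q - y) * hermite_fun k (q + y)) has_real_derivative
      (?a' * (-1)) * ?b + (?b' * 1) * ?a) (at y)"
    by (rule DERIV_mult)
  then have 1: "((\<lambda>y. complex_of_real (hermite_fun j (q - y) * hermite_fun k (q + y)))
      has_vector_derivative complex_of_real ((?a' * (-1)) * ?b + (?b' * 1) * ?a)) (at y)"
    by (intro has_vector_derivative_of_real)
       (simp add: has_real_derivative_iff_has_vector_derivative)
  have 2: "((\<lambda>y. exp (2 * \<i> * complex_of_real p * complex_of_real y)) has_vector_derivative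
      2 * \<i> * complex_of_real p * ?e) (at y)"
    by (rule has_vector_derivative_eq_rhs[OF has_vector_derivative_real_field
          [where f = "\<lambda>y. exp (2 * \<i> * complex_of_real p * y)"]])
       (auto intro!: derivative_eq_intros)
  have "(hermite_wigner_integrand j k q p has_vector_derivative
      ?e * complex_of_real ((?a' * (-1)) * ?b + (?b' * 1) * ?a)
        + 2 * \<i> * complex_of_real p * ?e * complex_of_real (?a * ?b)) (at y)"
    unfolding hermite_wigner_integrand_def [abs_def]
    by (rule has_vector_derivative_mult[OF 2 1])
  moreover have "?e * complex_of_real ((?a' * (-1)) * ?b + (?b' * 1) * ?a)
        + 2 * \<i> * complex_of_real p * ?e * complex_of_real (?a * ?b) =
     2 * (complex_of_real q + \<i> * complex_of_real p) * hermite_wigner_integrand j k q p y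
     - 2 * of_nat j * hermite_wigner_integrand (j - 1) k q p y
     - hermite_wigner_integrand j (Suc k) q p y"
    unfolding hermite_wigner_integrand_def hermite_fun_Suc
    by (simp add: algebra_simps)
  ultimately show ?thesis by simp
qed

text \<open>The integral of a total derivative vanishes, so the derivative formula becomes a
  recurrence between the transforms. For \<open>j = 0\<close> the second term has coefficient zero,
  and the row consists of powers of \<open>2 * (q + \<i> * p)\<close>.\<close>

lemma hermite_wigner_Suc_right:
  "hermite_wigner j (Suc k) q p =
     2 * (complex_of_real q + \<i> * complex_of_real p) * hermite_wigner j k q p
     - 2 * of_nat j * hermite_wigner (j - 1) k q p"
proof -
  note int = integrable_hermite_wigner_integrand
  let ?z = "complex_of_real q + \<i> * complex_of_real p"
  have i1: "integrable lborel (\<lambda>y. 2 * ?z * hermite_wigner_integrand j k q p y)"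
    and i2: "integrable lborel (\<lambda>y. 2 * of_nat j * hermite_wigner_integrand (j - 1) k q p y)"
    by (intro integrable_mult_right int)+
  have cont: "continuous_on UNIV (hermite_wigner_integrand a b q p)" for a b
    unfolding hermite_wigner_integrand_def [abs_def] by (intro continuous_intros)
  have "(LINT y|lborel. 2 * ?z * hermite_wigner_integrand j k q p y
     - 2 * of_nat j * hermite_wigner_integrand (j - 1) k q p y
     - hermite_wigner_integrand j (Suc k) q p y) = 0"
    by (rule integral_deriv_eq_0[OF hermite_wigner_integrand_deriv _ _
          hermite_wigner_integrand_limits])
       (intro continuous_intros cont Bochner_Integration.integrable_diff i1 i2 int)+
  then show ?thesis
    unfolding Bochner_Integration.integral_diff[OF Bochner_Integration.integrable_diff[OF i1 i2] int]
      Bochner_Integration.integral_diff[OF i1 i2]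
    by (simp add: hermite_wigner_def)
qed

lemma hermite_wigner_swap: "hermite_wigner k j q p = cnj (hermite_wigner j k q p)"
proof -
  have "hermite_wigner k j q p = (LINT y|lborel. hermite_wigner_integrand k j q p (- y))"
    unfolding hermite_wigner_def
    using lborel_integral_real_affine[of "-1" "hermite_wigner_integrand k j q p" 0] by simp
  also have "\<dots> = (LINT y|lborel. cnj (hermite_wigner_integrand j k q p y))"
    by (simp add: hermite_wigner_integrand_def exp_cnj mult.commute)
  also have "\<dots> = cnj (hermite_wigner j k q p)"
    by (simp add: hermite_wigner_def)
  finally show ?thesis .
qed

text \<open>A Gaussian Fourier integral, read off from the characteristic function of the standard
  normal distribution at \<open>sqrt 2 * p\<close> after the substitution
  \<open>x = sqrt 2 * y\<close>.\<close>

lemma hermite_wigner_0_0: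
  "hermite_wigner 0 0 q p = complex_of_real (sqrt pi * exp (- (q\<^sup>2 + p\<^sup>2)))"
proof -
  have "complex_of_real (exp (- p\<^sup>2)) = char std_normal_distribution (sqrt 2 * p)"
    by (simp add: char_std_normal_distribution power_mult_distrib)
  also have "\<dots> = (LINT x|lborel. std_normal_density x *\<^sub>R iexp (sqrt 2 * p * x))"
    unfolding char_def by (subst integral_density) (auto simp: normal_density_nonneg)
  also have "\<dots> = sqrt 2 *\<^sub>R (LINT y|lborel. std_normal_density (sqrt 2 * y) *\<^sub>R iexp (sqrt 2 * p * (sqrt 2 * y)))"
    using lborel_integral_real_affine[of "sqrt 2" "\<lambda>x. std_normal_density x *\<^sub>R iexp (sqrt 2 * p * x)" 0]
    by simp
  also have "\<dots> = sqrt 2 *\<^sub>R (LINT y|lborel. (1 / sqrt (2 * pi) * exp (q\<^sup>2)) *\<^sub>R hermite_wigner_integrand 0 0 q p y)"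
  proof (intro arg_cong[where f = "\<lambda>x. sqrt 2 *\<^sub>R x"] Bochner_Integration.integral_cong refl)
    fix y
    have "exp (- y\<^sup>2) = exp (q\<^sup>2) * (exp (- (q - y)\<^sup>2 / 2) * exp (- (q + y)\<^sup>2 / 2))"
      unfolding exp_add[symmetric] by (rule arg_cong[where f = exp]) (simp add: power2_eq_square field_simps)
    moreover have "iexp (sqrt 2 * p * (sqrt 2 * y)) = exp (2 * \<i> * complex_of_real p * complex_of_real y)"
      by (rule arg_cong[where f = exp]) (simp add: mult_ac)
    ultimately show "std_normal_density (sqrt 2 * y) *\<^sub>R iexp (sqrt 2 * p * (sqrt 2 * y)) =
        (1 / sqrt (2 * pi) * exp (q\<^sup>2)) *\<^sub>R hermite_wigner_integrand 0 0 q p y"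
      by (simp add: hermite_wigner_integrand_def hermite_fun_def std_normal_density_def
          power_mult_distrib scaleR_conv_of_real)
  qed
  also have "\<dots> = (exp (q\<^sup>2) / sqrt pi) *\<^sub>R hermite_wigner 0 0 q p"
    unfolding integral_scaleR_right by (simp add: hermite_wigner_def real_sqrt_mult)
  finally have "(sqrt pi / exp (q\<^sup>2)) *\<^sub>R complex_of_real (exp (- p\<^sup>2)) = hermite_wigner 0 0 q p"
    by simp
  then show ?thesis by (simp add: scaleR_conv_of_real exp_minus exp_diff field_simps)
qed

lemma hermite_wigner_0_left:
  "hermite_wigner 0 k q p =
     (2 * (complex_of_real q + \<i> * complex_of_real p)) ^ k * hermite_wigner 0 0 q p"
  by (induction k) (auto simp: hermite_wigner_Suc_right)

text \<open>Induction on \<open>k\<close> for all \<open>j\<close> at once, because the recurrence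
  lowers \<open>j\<close>; the case \<open>k = 0\<close> comes from the row \<open>j = 0\<close> by
  conjugation. Terms with \<open>m > j\<close> vanish through \<open>j choose m\<close>, so the
  truncated exponent \<open>j - m\<close> does no harm.\<close>

lemma hermite_wigner_eq:
  fixes q p :: real
  defines "z \<equiv> complex_of_real q + \<i> * complex_of_real p"
  shows "hermite_wigner j k q p = (\<Sum>m\<le>k. of_nat (j choose m) * of_nat (k choose m) * (-2) ^ m * fact m *
           (2 * z) ^ (k - m) * (2 * cnj z) ^ (j - m)) * hermite_wigner 0 0 q p"
proof (induction k arbitrary: j)
  case 0
  have "hermite_wigner j 0 q p = cnj (hermite_wigner 0 j q p)" by (rule hermite_wigner_swap)
  also have "\<dots> = (2 * cnj z) ^ j * hermite_wigner 0 0 q p"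
    unfolding hermite_wigner_0_left[of j] z_def by (simp add: hermite_wigner_0_0)
  finally show ?case by simp
next
  case (Suc k)
  let ?I = "hermite_wigner 0 0 q p"
  let ?t = "\<lambda>j k m. of_nat (j choose m) * of_nat (k choose m) * (-2) ^ m * fact m *
           (2 * z) ^ (k - m) * (2 * cnj z) ^ (j - m) :: complex"
  \<comment> \<open>Pascal's rule for \<open>Suc k choose Suc m\<close> splits the summand into
    \<open>?u (Suc m)\<close> and \<open>?v m\<close>. The first family sums to the multiple by
    \<open>2 * z\<close>, the second to the term with \<open>j - 1\<close>.\<close>
  let ?u = "\<lambda>m. of_nat (j choose m) * of_nat (k choose m) * (-2) ^ m * fact m *
           (2 * z) ^ (Suc k - m) * (2 * cnj z) ^ (j - m) :: complex"
  let ?v = "\<lambda>m. of_nat (j choose Suc m) * of_nat (k choose m) * (-2) ^ Suc m * fact (Suc m) *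
           (2 * z) ^ (k - m) * (2 * cnj z) ^ (j - Suc m) :: complex"
  have v: "?v m = - 2 * of_nat j * ?t (j - 1) k m" for m
  proof (cases j)
    case (Suc i)
    have "Suc m * (Suc i choose Suc m) = Suc i * (i choose m)" using Suc_times_binomial_eq[of i m] by (simp only: mult.commute)
    then have "(of_nat (Suc m) * of_nat (Suc i choose Suc m) :: complex) = of_nat (Suc i) * of_nat (i choose m)"
      by (metis of_nat_mult)
    then have *: "of_nat (Suc i choose Suc m) * (fact (Suc m) :: complex) = of_nat (Suc i) * of_nat (i choose m) * fact m"
      by (simp only: fact_Suc mult.assoc[symmetric] mult.commute[of _ "of_nat (Suc m)"])
    have "?v m = (of_nat (Suc i choose Suc m) * fact (Suc m)) * of_nat (k choose m) * (-2) ^ Suc m *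
           (2 * z) ^ (k - m) * (2 * cnj z) ^ (i - m)"
      using Suc by (simp only: mult_ac diff_Suc_Suc)
    also have "\<dots> = - 2 * of_nat j * ?t (j - 1) k m"
      unfolding * using Suc by (simp add: algebra_simps)
    finally show ?thesis .
  qed auto
  have "(\<Sum>m\<le>Suc k. ?t j (Suc k) m) = ?u 0 + (\<Sum>m\<le>k. ?t j (Suc k) (Suc m))"
    by (subst sum.atMost_Suc_shift) simp
  also have "(\<Sum>m\<le>k. ?t j (Suc k) (Suc m)) = (\<Sum>m\<le>k. ?u (Suc m) + ?v m)"
    by (intro sum.cong refl) (simp add: algebra_simps)
  also have "?u 0 + (\<Sum>m\<le>k. ?u (Suc m) + ?v m) = (\<Sum>m\<le>Suc k. ?u m) + (\<Sum>m\<le>k. ?v m)"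
    by (simp only: sum.distrib sum.atMost_Suc_shift[of ?u] add.assoc)
  also have "(\<Sum>m\<le>Suc k. ?u m) = (\<Sum>m\<le>k. ?u m)" by simp
  also have "\<dots> = 2 * z * (\<Sum>m\<le>k. ?t j k m)"
    unfolding sum_distrib_left by (intro sum.cong refl) (simp add: Suc_diff_le mult_ac)
  also have "(\<Sum>m\<le>k. ?v m) = - 2 * of_nat j * (\<Sum>m\<le>k. ?t (j - 1) k m)"
    unfolding v sum_distrib_left ..
  finally have S: "(\<Sum>m\<le>Suc k. ?t j (Suc k) m) = 2 * z * (\<Sum>m\<le>k. ?t j k m) - 2 * of_nat j * (\<Sum>m\<le>k. ?t (j - 1) k m)"
    by simp
  show ?case
    unfolding hermite_wigner_Suc_right[of j k] Suc.IH[of j] Suc.IH[of "j - 1"] S z_def [symmetric]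
    by (simp only: left_diff_distrib mult.assoc)
qed

section \<open>Wigner functions of the states\<close>

definition fock_norm :: "nat \<Rightarrow> real" where
  "fock_norm k = sqrt (2 ^ k * fact k * sqrt pi)"

lemma fock_norm_pos [simp]: "fock_norm k > 0"
  by (simp add: fock_norm_def)

lemma fock_eq: "fock k x = complex_of_real (hermite_fun k x / fock_norm k)"
  by (simp add: fock_def hermite_fun_def fock_norm_def)

definition fock_wigner_integrand :: "nat \<Rightarrow> nat \<Rightarrow> real \<Rightarrow> real \<Rightarrow> real \<Rightarrow> complex" where
  "fock_wigner_integrand j k q p y =
     exp (2 * \<i> * complex_of_real p * complex_of_real y) * (fock j (q - y) * cnj (fock k (q + y)))"

lemma fock_wigner_integrand_eq:
  "fock_wigner_integrand j k q p y =
     complex_of_real (1 / (fock_norm j * fock_norm k)) * hermite_wigner_integrand j k q p y"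
  by (simp add: fock_wigner_integrand_def hermite_wigner_integrand_def fock_eq)

lemma integrable_fock_wigner_integrand: "integrable lborel (fock_wigner_integrand j k q p)"
  unfolding fock_wigner_integrand_eq [abs_def]
  by (intro integrable_mult_right integrable_hermite_wigner_integrand)

lemma integral_fock_wigner_integrand:
  "(LINT y|lborel. fock_wigner_integrand j k q p y) =
     hermite_wigner j k q p / complex_of_real (fock_norm j * fock_norm k)"
  unfolding fock_wigner_integrand_eq integral_mult_right_zero hermite_wigner_def by simp

text \<open>On the diagonal \<open>z\<close> and \<open>cnj z\<close> occur with equal powers, so
  only \<open>z * cnj z\<close> matters. Reversing the sum by \<open>m\<close> to
  \<open>k - m\<close> turns it into the Laguerre polynomial at twice the squared radius, with the
  sign that \<open>P_poly\<close> includes.\<close>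

lemma hermite_wigner_diag:
  "hermite_wigner k k q p =
     complex_of_real ((fock_norm k)\<^sup>2 * P_poly k (q\<^sup>2 + p\<^sup>2) * exp (- (q\<^sup>2 + p\<^sup>2)))"
proof -
  define z where "z = complex_of_real q + \<i> * complex_of_real p"
  define x where "x = q\<^sup>2 + p\<^sup>2"
  have zz: "z * cnj z = complex_of_real x"
    by (simp add: z_def x_def power2_eq_square algebra_simps)
  have summand: "of_nat (k choose m) * of_nat (k choose m) * (-2) ^ m * fact m * (2 * z) ^ (k - m) * (2 * cnj z) ^ (k - m)
      = complex_of_real (2 ^ k * fact k * (-1) ^ k * ((-1) ^ (k - m) * real (k choose (k - m)) / fact (k - m) * (2 * x) ^ (k - m)))"
    if "m \<le> k" for m
  proof -
    have c: "real (k choose m) * fact m = fact k / fact (k - m)"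
      using that by (simp add: binomial_fact)
    have z2: "(2 * z) ^ (k - m) * (2 * cnj z) ^ (k - m) = complex_of_real (2 ^ (k - m) * (2 * x) ^ (k - m))"
    proof -
      have "(2 * z) * (2 * cnj z) = 4 * (z * cnj z)" by simp
      then show ?thesis unfolding power_mult_distrib[symmetric] zz by simp
    qed
    have pm: "(-2 :: real) ^ m * 2 ^ (k - m) = 2 ^ k * (-1) ^ k * (-1) ^ (k - m)"
    proof -
      have "(-2 :: real) ^ m * 2 ^ (k - m) = (-1) ^ m * (2 ^ m * 2 ^ (k - m))"
        by (simp add: power_minus[of 2])
      also have "(2 :: real) ^ m * 2 ^ (k - m) = 2 ^ k"
        using that by (simp flip: power_add)
      also have "(-1 :: real) ^ m = (-1) ^ k * (-1) ^ (k - m)"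
        using that by (auto simp flip: power_add simp: minus_one_power_iff)
      finally show ?thesis by simp
    qed
    have "of_nat (k choose m) * of_nat (k choose m) * (-2) ^ m * fact m * ((2 * z) ^ (k - m) * (2 * cnj z) ^ (k - m))
        = complex_of_real (real (k choose m) * (real (k choose m) * fact m) * ((-2) ^ m * 2 ^ (k - m)) * (2 * x) ^ (k - m))"
      unfolding z2 by (simp add: mult_ac)
    also have "real (k choose m) * (real (k choose m) * fact m) * ((-2) ^ m * 2 ^ (k - m)) * (2 * x) ^ (k - m)
       = 2 ^ k * fact k * (-1) ^ k * ((-1) ^ (k - m) * real (k choose (k - m)) / fact (k - m) * (2 * x) ^ (k - m))"
      unfolding c pm using binomial_symmetric[OF that] by simp
    finally show ?thesis by (simp only: mult.assoc)
  qed
  have "hermite_wigner k k q p = complex_of_real (\<Sum>m\<le>k. 2 ^ k * fact k * (-1) ^ k *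
      ((-1) ^ (k - m) * real (k choose (k - m)) / fact (k - m) * (2 * x) ^ (k - m))) * hermite_wigner 0 0 q p"
    unfolding hermite_wigner_eq[of k k] z_def[symmetric] of_real_sum
    by (intro arg_cong2[where f = times] sum.cong refl summand) auto
  also have "(\<Sum>m\<le>k. 2 ^ k * fact k * (-1) ^ k *
      ((-1) ^ (k - m) * real (k choose (k - m)) / fact (k - m) * (2 * x) ^ (k - m))) = 2 ^ k * fact k * P_poly k x"
    unfolding sum_distrib_left[symmetric] P_poly_def laguerre_def
    using sum.atLeastAtMost_rev[of "\<lambda>m. (-1) ^ m * real (k choose m) / fact m * (2 * x) ^ m" 0 k]
    by (simp add: atMost_atLeast0)
  finally show ?thesis
    by (simp add: hermite_wigner_0_0 x_def fock_norm_def mult_ac)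
qed

text \<open>The origin of \<open>beta_coeff\<close>: the factor \<open>2 ^ n\<close> of the
  \<open>n\<close> recurrence steps divided by the Hermite norms.\<close>

lemma fock_wigner_0_left:
  "(LINT y|lborel. fock_wigner_integrand 0 n q p y) =
     complex_of_real (beta_coeff n * exp (- (q\<^sup>2 + p\<^sup>2))) * (complex_of_real q + \<i> * complex_of_real p) ^ n"
proof -
  have f: "fock_norm 0 * fock_norm n = sqrt pi * sqrt (2 ^ n * fact n)"
    by (simp add: fock_norm_def real_sqrt_mult)
  have b: "beta_coeff n = 2 ^ n / sqrt (2 ^ n * fact n)"
  proof -
    have "2 powr (real n / 2) = sqrt (2 ^ n)"
      by (simp add: powr_half_sqrt[symmetric] powr_powr flip: powr_realpow)
    also have "\<dots> = 2 ^ n / sqrt (2 ^ n)" by (simp add: real_div_sqrt)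
    finally show ?thesis by (simp add: beta_coeff_def real_sqrt_mult)
  qed
  show ?thesis
    unfolding integral_fock_wigner_integrand hermite_wigner_0_left[of n] f b hermite_wigner_0_0 power_mult_distrib
    by simp
qed

lemma fock_wigner_swap:
  "(LINT y|lborel. fock_wigner_integrand k j q p y) = cnj (LINT y|lborel. fock_wigner_integrand j k q p y)"
  unfolding integral_fock_wigner_integrand hermite_wigner_swap[of k j] by (simp add: mult.commute)

lemma fock_wigner_diag:
  "(LINT y|lborel. fock_wigner_integrand k k q p y) =
     complex_of_real (P_poly k (q\<^sup>2 + p\<^sup>2) * exp (- (q\<^sup>2 + p\<^sup>2)))"
  unfolding integral_fock_wigner_integrand hermite_wigner_diag
  using less_imp_neq[OF fock_norm_pos[of k]] by (simp add: power2_eq_square)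

lemma laguerre_0 [simp]: "laguerre k 0 = 1"
  by (simp add: laguerre_def power_0_left if_distrib[where f = "\<lambda>x. _ * x"] sum.delta cong: if_cong)

lemma P_poly_0 [simp]: "P_poly k 0 = (-1) ^ k"
  by (simp add: P_poly_def)

lemma norm_fock_square: "(norm (fock k x))\<^sup>2 = (hermite_fun k x / fock_norm k)\<^sup>2"
  unfolding fock_eq norm_of_real by (rule power2_abs)

text \<open>The norm is read off at the origin of phase space: by parity the diagonal Wigner
  integral there is \<open>(-1) ^ k\<close> times the squared norm, while the explicit formula gives
  \<open>P_poly k 0 = (-1) ^ k\<close>.\<close>

lemma fock_normalized:
  "integrable lborel (\<lambda>y. (norm (fock k (q + y)))\<^sup>2)"
  "(LINT y|lborel. (norm (fock k (q + y)))\<^sup>2) = 1"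
proof -
  have e: "fock_wigner_integrand k k 0 0 y = complex_of_real ((-1) ^ k * (norm (fock k y))\<^sup>2)" for y
    unfolding norm_fock_square
    by (simp add: fock_wigner_integrand_def fock_eq hermite_fun_uminus power2_eq_square)
  have i: "integrable lborel (\<lambda>y. complex_of_real ((-1) ^ k * (norm (fock k y))\<^sup>2))"
    using integrable_fock_wigner_integrand[of k k 0 0] unfolding e [abs_def] .
  then have i0: "integrable lborel (\<lambda>y. (norm (fock k y))\<^sup>2)"
    unfolding complex_of_real_integrable_eq by simp
  have "complex_of_real ((-1) ^ k * (LINT y|lborel. (norm (fock k y))\<^sup>2))
      = (LINT y|lborel. fock_wigner_integrand k k 0 0 y)"
    unfolding e by (simp only: integral_complex_of_real integral_mult_right_zero of_real_mult)
  also have "\<dots> = complex_of_real ((-1) ^ k)"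
    unfolding fock_wigner_diag by simp
  finally have "(-1) ^ k * (LINT y|lborel. (norm (fock k y))\<^sup>2) = (-1) ^ k * 1"
    by (simp only: of_real_eq_iff)
  then have j0: "(LINT y|lborel. (norm (fock k y))\<^sup>2) = 1" by simp
  show "integrable lborel (\<lambda>y. (norm (fock k (q + y)))\<^sup>2)"
    using lborel_integrable_real_affine[OF i0, of 1 q] by simp
  show "(LINT y|lborel. (norm (fock k (q + y)))\<^sup>2) = 1"
    using lborel_integral_real_affine[of 1 "\<lambda>y. (norm (fock k y))\<^sup>2" q] j0 by simp
qed

text \<open>The arithmetic-geometric mean inequality and normalization. Uniformity in
  \<open>k\<close> is the point: it makes the geometric weights of the thermal series dominate when
  sum and integral are interchanged.\<close>

lemma integral_norm_fock_wigner_integrand_le: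
  "(LINT y|lborel. norm (fock_wigner_integrand k k q p y)) \<le> 1"
proof -
  have i1: "integrable lborel (\<lambda>y. (norm (fock k (q + y)))\<^sup>2)"
    and j1: "(LINT y|lborel. (norm (fock k (q + y)))\<^sup>2) = 1"
    by (rule fock_normalized)+
  have i2: "integrable lborel (\<lambda>y. (norm (fock k (q - y)))\<^sup>2)"
    using lborel_integrable_real_affine[OF i1, of "-1" 0] by simp
  have j2: "(LINT y|lborel. (norm (fock k (q - y)))\<^sup>2) = 1"
    using lborel_integral_real_affine[of "-1" "\<lambda>y. (norm (fock k (q + y)))\<^sup>2" 0] j1 by simp
  have "(LINT y|lborel. norm (fock_wigner_integrand k k q p y))
     \<le> (LINT y|lborel. ((norm (fock k (q - y)))\<^sup>2 + (norm (fock k (q + y)))\<^sup>2) / 2)"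
  proof (intro integral_mono integrable_norm integrable_fock_wigner_integrand integrable_divide
      Bochner_Integration.integrable_add i1 i2)
    fix y
    show "norm (fock_wigner_integrand k k q p y) \<le> ((norm (fock k (q - y)))\<^sup>2 + (norm (fock k (q + y)))\<^sup>2) / 2"
      using sum_squares_bound[of "norm (fock k (q - y))" "norm (fock k (q + y))"]
      by (simp add: fock_wigner_integrand_def norm_mult)
  qed
  also have "\<dots> = 1"
    unfolding integral_divide_zero Bochner_Integration.integral_add[OF i2 i1] j1 j2 by simp
  finally show ?thesis .
qed

section \<open>The Laguerre generating function and the thermal state\<close>

lemma sums_binomial_power:
  fixes t :: real
  assumes "\<bar>t\<bar> < 1"
  shows "(\<lambda>k. real (k choose j) * t ^ k) sums (t ^ j / (1 - t) ^ Suc j)"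
proof -
  have "(\<lambda>k. real ((k + j) choose j) * t ^ k) sums (1 / (1 - t) ^ Suc j)"
  proof -
    have "(\<lambda>k. (- real (Suc j) gchoose k) * (- t) ^ k) sums ((1 + (- t)) powr (- real (Suc j)))"
      using assms by (intro gen_binomial_real) auto
    moreover have "(- real (Suc j) gchoose k) * (- t) ^ k = real ((k + j) choose j) * t ^ k" for k
    proof -
      have "(- real (Suc j) gchoose k) = (-1) ^ k * (real (k + j) gchoose k)"
        by (subst gbinomial_negated_upper) (simp add: algebra_simps)
      also have "real (k + j) gchoose k = real ((k + j) choose j)"
        using binomial_symmetric[of k "k + j"] by (simp add: binomial_gbinomial[symmetric] del: of_nat_add)
      finally show ?thesis by (simp add: power_mult_distrib[symmetric] mult_ac)
    qed
    moreover have "(1 + (- t)) powr (- real (Suc j)) = 1 / (1 - t) ^ Suc j"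
      using assms by (simp add: powr_minus powr_realpow divide_inverse del: of_nat_Suc power_Suc)
    ultimately show ?thesis by (simp only:)
  qed
  from sums_mult[OF this, of "t ^ j"]
  have "(\<lambda>k. real ((k + j) choose j) * t ^ (k + j)) sums (t ^ j / (1 - t) ^ Suc j)"
    by (simp add: power_add mult_ac)
  then show ?thesis
    using sums_iff_shift'[of "\<lambda>k. real (k choose j) * t ^ k" j "t ^ j / (1 - t) ^ Suc j"]
    by (simp add: sum.neutral)
qed


text \<open>Writing out \<open>laguerre\<close> gives a double series: a negative binomial series in
  \<open>k\<close> and then an exponential series in \<open>j\<close>. The sum over \<open>k\<close>
  is treated as an integral over \<open>count_space\<close>, so that the exchange is one of integral
  and series; the absolute values form the same kind of series at \<open>\<bar>t\<bar>\<close> and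
  \<open>\<bar>y\<bar>\<close>, which converges.\<close>

lemma laguerre_generating_function:
  fixes t y :: real
  assumes "\<bar>t\<bar> < 1"
  shows "(\<lambda>k. t ^ k * laguerre k y) sums (exp (- t * y / (1 - t)) / (1 - t))"
proof -
  define f where "f j k = ((- y) ^ j / fact j) * (real (k choose j) * t ^ k)" for j k
  have fs: "f j sums ((- y) ^ j / fact j * (t ^ j / (1 - t) ^ Suc j))" for j
    unfolding f_def by (intro sums_mult sums_binomial_power assms)
  have afs: "(\<lambda>k. norm (f j k)) sums (\<bar>y\<bar> ^ j / fact j * (\<bar>t\<bar> ^ j / (1 - \<bar>t\<bar>) ^ Suc j))" for j
    using sums_mult[OF sums_binomial_power[of "\<bar>t\<bar>" j], of "\<bar>y\<bar> ^ j / fact j"] assms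
    by (simp add: f_def abs_mult power_abs)
  have int: "integrable (count_space UNIV) (f j)" for j
    using afs[of j] by (simp add: integrable_count_space_nat_iff sums_iff)
  have fin: "(\<lambda>j. f j k) sums (t ^ k * laguerre k y)" for k
  proof -
    have "(\<lambda>j. f j k) sums (\<Sum>j\<le>k. f j k)"
      by (rule sums_finite) (auto simp: f_def)
    also have "(\<Sum>j\<le>k. f j k) = t ^ k * laguerre k y"
      unfolding laguerre_def sum_distrib_left
      by (intro sum.cong refl) (simp add: f_def power_minus[of y])
    finally show ?thesis .
  qed
  have sa: "summable (\<lambda>j. norm (f j k))" for k
    by (rule summable_finite[of "{..k}"]) (auto simp: f_def)
  have expo: "(\<lambda>j. a ^ j / fact j * (b ^ j / c ^ Suc j)) sums (exp (a * b / c) / c)" for a b c :: real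
  proof -
    have "(\<lambda>j. (a * b / c) ^ j /\<^sub>R fact j / c) sums (exp (a * b / c) / c)"
      by (intro sums_divide exp_converges)
    then show ?thesis by (simp add: power_mult_distrib power_divide field_simps)
  qed
  have sb: "summable (\<lambda>j. LINT k|count_space UNIV. norm (f j k))"
  proof -
    have "(LINT k|count_space UNIV. norm (f j k)) = \<bar>y\<bar> ^ j / fact j * (\<bar>t\<bar> ^ j / (1 - \<bar>t\<bar>) ^ Suc j)" for j
      using integral_count_space_nat[OF integrable_norm[OF int[of j]]] afs[of j] by (simp add: sums_iff)
    then show ?thesis using expo[of "\<bar>y\<bar>" "\<bar>t\<bar>" "1 - \<bar>t\<bar>"] by (simp add: sums_iff)
  qed
  have "integrable (count_space UNIV) (\<lambda>k. \<Sum>j. f j k)"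
    by (rule integrable_suminf[OF int AE_I2[OF sa] sb])
  then have I: "integrable (count_space UNIV) (\<lambda>k. t ^ k * laguerre k y)"
    using fin by (simp add: sums_iff)
  have "(LINT k|count_space UNIV. t ^ k * laguerre k y) = (\<Sum>j. LINT k|count_space UNIV. f j k)"
    using integral_suminf[OF int AE_I2[OF sa] sb] fin by (simp add: sums_iff)
  also have "\<dots> = (\<Sum>j. (- y) ^ j / fact j * (t ^ j / (1 - t) ^ Suc j))"
    using fs int by (simp add: integral_count_space_nat sums_iff)
  also have "\<dots> = exp (- t * y / (1 - t)) / (1 - t)"
    using expo[of "- y" t "1 - t"] by (simp add: sums_iff mult.commute)
  finally have "(LINT k|count_space UNIV. t ^ k * laguerre k y) = exp (- t * y / (1 - t)) / (1 - t)" .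
  moreover have "(\<lambda>k. t ^ k * laguerre k y) sums (LINT k|count_space UNIV. t ^ k * laguerre k y)"
    using I integral_count_space_nat[OF I]
    by (simp add: integrable_count_space_nat_iff summable_norm_cancel summable_sums)
  ultimately show ?thesis by simp
qed

definition wigner_integrand :: "kernel \<Rightarrow> real \<Rightarrow> real \<Rightarrow> real \<Rightarrow> complex" where
  "wigner_integrand \<rho> q p y = exp (2 * \<i> * complex_of_real p * complex_of_real y) * \<rho> (q - y) (q + y)"

lemma wigner_eq: "wigner \<rho> (q, p) = Re (LINT y|lborel. wigner_integrand \<rho> q p y) / pi"
  unfolding wigner_def wigner_complex_def wigner_integrand_def
  by (simp add: Re_divide_of_real flip: of_real_divide of_real_inverse)

text \<open>Termwise integration of the Fock expansion reduces the thermal state to the Laguerre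
  generating function.\<close>

lemma thermal_wigner:
  assumes "\<nu> > 0"
  shows "integrable lborel (wigner_integrand (thermal_state \<nu>) q p)"
    and "(LINT y|lborel. wigner_integrand (thermal_state \<nu>) q p y) =
           complex_of_real (exp (- (q\<^sup>2 + p\<^sup>2) / s_par \<nu>) / s_par \<nu>)"
proof -
  define w where "w k = \<nu> ^ k / (\<nu> + 1) ^ (k + 1)" for k
  define r where "r = \<nu> / (\<nu> + 1)"
  have r: "0 < r" "r < 1" using assms by (auto simp: r_def)
  have w: "w k = r ^ k / (\<nu> + 1)" for k by (simp add: w_def r_def power_divide)
  have w0: "w k \<ge> 0" for k using assms by (simp add: w_def)
  define F where "F k y = complex_of_real (w k) * fock_wigner_integrand k k q p y" for k y
  have int: "integrable lborel (F k)" for k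
    unfolding F_def by (intro integrable_mult_right integrable_fock_wigner_integrand)
  have Fe: "F k y = exp (2 * \<i> * complex_of_real p * complex_of_real y) *
      (complex_of_real (\<nu> ^ k / (\<nu> + 1) ^ (k + 1)) * pure_state (fock k) (q - y) (q + y))" for k y
    by (simp add: F_def w_def fock_wigner_integrand_def pure_state_def mult_ac)
  have sn: "summable (\<lambda>k. norm (F k y))" for y
    using summable_thermal_state[OF assms, of "q - y" "q + y"]
    unfolding Fe norm_mult norm_exp_2_i mult_1 .
  have eq: "wigner_integrand (thermal_state \<nu>) q p y = (\<Sum>k. F k y)" for y
    unfolding Fe wigner_integrand_def thermal_state_def
    by (rule suminf_mult[symmetric]) (rule summable_norm_cancel[OF summable_thermal_state[OF assms]])
  have sb: "summable (\<lambda>k. LINT y|lborel. norm (F k y))"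
  proof (rule summable_comparison_test[OF _ summable_mult[OF summable_geometric[of r], of "1 / (\<nu> + 1)"]],
      intro exI allI impI)
    fix k
    have "(LINT y|lborel. norm (F k y)) = w k * (LINT y|lborel. norm (fock_wigner_integrand k k q p y))"
      using w0 by (simp add: F_def norm_mult)
    also have "\<dots> \<le> w k * 1"
      by (intro mult_left_mono integral_norm_fock_wigner_integrand_le w0)
    finally show "norm (LINT y|lborel. norm (F k y)) \<le> 1 / (\<nu> + 1) * r ^ k"
      by (simp add: w)
  qed (use r in auto)
  show "integrable lborel (wigner_integrand (thermal_state \<nu>) q p)"
    unfolding eq [abs_def] by (rule integrable_suminf[OF int AE_I2[OF sn] sb])
  define x where "x = q\<^sup>2 + p\<^sup>2"
  have "(\<lambda>k. LINT y|lborel. F k y) sums (LINT y|lborel. wigner_integrand (thermal_state \<nu>) q p y)"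
    unfolding eq by (rule sums_integral[OF int AE_I2[OF sn] sb])
  moreover have "(LINT y|lborel. F k y) = complex_of_real (((- r) ^ k * laguerre k (2 * x)) * (exp (- x) / (\<nu> + 1)))" for k
  proof -
    have "(LINT y|lborel. F k y) = complex_of_real (w k * (P_poly k x * exp (- x)))"
      unfolding F_def integral_mult_right_zero fock_wigner_diag x_def by simp
    then show ?thesis by (simp add: w P_poly_def power_minus[of r] mult_ac)
  qed
  \<comment> \<open>The sign \<open>(-1) ^ k\<close> inside \<open>P_poly\<close> is absorbed by
    evaluating the generating function at \<open>- r\<close>.\<close>
  moreover have "(\<lambda>k. complex_of_real (((- r) ^ k * laguerre k (2 * x)) * (exp (- x) / (\<nu> + 1)))) sums
      complex_of_real (exp (- (- r) * (2 * x) / (1 - (- r))) / (1 - (- r)) * (exp (- x) / (\<nu> + 1)))"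
    using r by (intro sums_of_real sums_mult2 laguerre_generating_function) auto
  ultimately have "(LINT y|lborel. wigner_integrand (thermal_state \<nu>) q p y) =
      complex_of_real (exp (- (- r) * (2 * x) / (1 - (- r))) / (1 - (- r)) * (exp (- x) / (\<nu> + 1)))"
    by (metis (no_types, lifting) sums_cong sums_unique2)
  also have "exp (- (- r) * (2 * x) / (1 - (- r))) / (1 - (- r)) * (exp (- x) / (\<nu> + 1))
     = exp (2 * r * x / (1 + r) + - x) / ((1 + r) * (\<nu> + 1))"
    unfolding exp_add by simp
  also have "(1 + r) * (\<nu> + 1) = s_par \<nu>"
    using assms by (simp add: r_def s_par_def field_simps)
  also have "2 * r * x / (1 + r) + - x = - x / s_par \<nu>"
  proof -
    have "2 * r / (1 + r) = 2 * \<nu> / s_par \<nu>"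
    proof -
      have "1 + r = s_par \<nu> / (\<nu> + 1)"
        using assms by (simp add: r_def s_par_def field_simps)
      then show ?thesis using assms by (simp add: r_def)
    qed
    then have "2 * r * x / (1 + r) = 2 * \<nu> / s_par \<nu> * x" by (metis times_divide_eq_left)
    then show ?thesis using assms by (simp add: s_par_def field_simps)
  qed
  finally show "(LINT y|lborel. wigner_integrand (thermal_state \<nu>) q p y) =
           complex_of_real (exp (- (q\<^sup>2 + p\<^sup>2) / s_par \<nu>) / s_par \<nu>)"
    by (simp add: x_def)
qed

lemma vacuum_wigner_eq: "vacuum_wigner (q, p) = exp (- (q\<^sup>2 + p\<^sup>2)) / pi"
proof -
  have "wigner_integrand (pure_state (fock 0)) q p = fock_wigner_integrand 0 0 q p"
    by (simp add: fun_eq_iff wigner_integrand_def fock_wigner_integrand_def pure_state_def)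
  then show ?thesis
    using fock_wigner_diag[of 0 q p]
    by (simp add: vacuum_wigner_def wigner_eq P_poly_def laguerre_def)
qed

definition psi_wigner :: "nat \<Rightarrow> real \<Rightarrow> real \<Rightarrow> real \<Rightarrow> real" where
  "psi_wigner n \<epsilon> q p =
     (1 - \<epsilon>\<^sup>2) + \<epsilon>\<^sup>2 * P_poly n (q\<^sup>2 + p\<^sup>2)
       + 2 * \<epsilon> * sqrt (1 - \<epsilon>\<^sup>2) * beta_coeff n * Re (Complex q p ^ n)"

lemma wigner_rho_eq:
  assumes "\<nu> > 0" "\<bar>\<epsilon>\<bar> \<le> 1"
  shows "wigner (rho n \<nu> K \<epsilon>) (q, p) =
    ((1 - delta n \<nu> K \<epsilon>) * psi_wigner n \<epsilon> q p * exp (- (q\<^sup>2 + p\<^sup>2))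
      + delta n \<nu> K \<epsilon> / s_par \<nu> * exp (- (q\<^sup>2 + p\<^sup>2) / s_par \<nu>)) / pi"
proof -
  define x where "x = q\<^sup>2 + p\<^sup>2"
  define u where "u = sqrt (1 - \<epsilon>\<^sup>2)"
  have u2: "u * u = 1 - \<epsilon>\<^sup>2" using assms by (simp add: u_def abs_square_le_1)
  define \<delta> where "\<delta> = delta n \<nu> K \<epsilon>"
  note i = integrable_fock_wigner_integrand[of _ _ q p]
  have i1: "integrable lborel (\<lambda>y. complex_of_real ((1 - \<delta>) * (1 - \<epsilon>\<^sup>2)) * fock_wigner_integrand 0 0 q p y)"
    "integrable lborel (\<lambda>y. complex_of_real ((1 - \<delta>) * u * \<epsilon>) * fock_wigner_integrand 0 n q p y)"
    "integrable lborel (\<lambda>y. complex_of_real ((1 - \<delta>) * u * \<epsilon>) * fock_wigner_integrand n 0 q p y)"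
    "integrable lborel (\<lambda>y. complex_of_real ((1 - \<delta>) * \<epsilon>\<^sup>2) * fock_wigner_integrand n n q p y)"
    "integrable lborel (\<lambda>y. complex_of_real \<delta> * wigner_integrand (thermal_state \<nu>) q p y)"
    by (intro integrable_mult_right i thermal_wigner(1) assms)+
  have u2c: "complex_of_real u * complex_of_real u = complex_of_real (1 - \<epsilon>\<^sup>2)"
    unfolding u2[symmetric] by simp
  have "wigner_integrand (rho n \<nu> K \<epsilon>) q p y =
      complex_of_real ((1 - \<delta>) * (1 - \<epsilon>\<^sup>2)) * fock_wigner_integrand 0 0 q p y
    + complex_of_real ((1 - \<delta>) * u * \<epsilon>) * fock_wigner_integrand 0 n q p y
    + complex_of_real ((1 - \<delta>) * u * \<epsilon>) * fock_wigner_integrand n 0 q p y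
    + complex_of_real ((1 - \<delta>) * \<epsilon>\<^sup>2) * fock_wigner_integrand n n q p y
    + complex_of_real \<delta> * wigner_integrand (thermal_state \<nu>) q p y" for y
    unfolding of_real_mult[of "1 - \<delta>" "1 - \<epsilon>\<^sup>2"] u2c[symmetric]
    unfolding rho_def psi_def wigner_integrand_def fock_wigner_integrand_def pure_state_def
      u_def[symmetric] \<delta>_def[symmetric] complex_cnj_add complex_cnj_mult complex_cnj_complex_of_real
    by (simp add: algebra_simps power2_eq_square)
  then have "(LINT y|lborel. wigner_integrand (rho n \<nu> K \<epsilon>) q p y) =
      complex_of_real ((1 - \<delta>) * (1 - \<epsilon>\<^sup>2)) * (LINT y|lborel. fock_wigner_integrand 0 0 q p y)
    + complex_of_real ((1 - \<delta>) * u * \<epsilon>) * (LINT y|lborel. fock_wigner_integrand 0 n q p y)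
    + complex_of_real ((1 - \<delta>) * u * \<epsilon>) * (LINT y|lborel. fock_wigner_integrand n 0 q p y)
    + complex_of_real ((1 - \<delta>) * \<epsilon>\<^sup>2) * (LINT y|lborel. fock_wigner_integrand n n q p y)
    + complex_of_real \<delta> * (LINT y|lborel. wigner_integrand (thermal_state \<nu>) q p y)"
    by (simp add: i1 Bochner_Integration.integral_add Bochner_Integration.integrable_add
        del: of_real_mult of_real_diff)
  then have "Re (LINT y|lborel. wigner_integrand (rho n \<nu> K \<epsilon>) q p y) =
      (1 - \<delta>) * (1 - \<epsilon>\<^sup>2) * exp (- x)
    + (1 - \<delta>) * u * \<epsilon> * (beta_coeff n * exp (- x) * Re (Complex q p ^ n))
    + (1 - \<delta>) * u * \<epsilon> * (beta_coeff n * exp (- x) * Re (Complex q p ^ n))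
    + (1 - \<delta>) * \<epsilon>\<^sup>2 * (P_poly n x * exp (- x))
    + \<delta> * (exp (- x / s_par \<nu>) / s_par \<nu>)"
    unfolding fock_wigner_diag fock_wigner_swap[of n 0] thermal_wigner(2)[OF assms(1)]
      fock_wigner_0_left complex_eq[symmetric] plus_complex.sel Re_complex_of_real x_def[symmetric]
      complex_cnj_mult complex_cnj_complex_of_real complex_cnj_power of_real_mult[symmetric]
    by (simp add: P_poly_def laguerre_def Complex_eq[symmetric] complex_cnj_power[symmetric] del: of_real_mult complex_cnj_power complex_cnj)
  then show ?thesis
    unfolding wigner_eq psi_wigner_def x_def[symmetric] u_def[symmetric] \<delta>_def[symmetric]
    by (simp add: algebra_simps)
qed

section \<open>Radial integrals and rotations in the plane\<close>

text \<open>A disc of squared radius \<open>a\<close> has area \<open>pi * a\<close>, so the squared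
  norm is distributed with constant density \<open>pi\<close>. The minus sign turns discs into upper
  rays: it makes the measure of every \<open>{x<..}\<close> finite, which the uniqueness criterion
  for measures demands.\<close>

lemma distr_norm_square_plane:
  "distr lborel borel (\<lambda>r :: real \<times> real. - (norm r)\<^sup>2) = density lborel (\<lambda>x. ennreal pi * indicator {..0} x)"
proof (rule measure_eqI_lessThan)
  fix x :: real
  have "emeasure (distr lborel borel (\<lambda>r :: real \<times> real. - (norm r)\<^sup>2)) {x<..}
      = emeasure lborel {r :: real \<times> real. x < - (norm r)\<^sup>2}"
    by (subst emeasure_distr) (auto simp: vimage_def)
  also have "{r :: real \<times> real. x < - (norm r)\<^sup>2} = ball 0 (sqrt (- x))"
  proof -
    have "x < - (norm r)\<^sup>2 \<longleftrightarrow> norm r < sqrt (- x)" for r :: "real \<times> real"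
      using real_sqrt_less_iff[of "(norm r)\<^sup>2" "- x"] by simp linarith
    then show ?thesis by auto
  qed
  also have "emeasure lborel \<dots> = ennreal (pi * max 0 (- x))"
  proof (cases "x < 0")
    case True
    then show ?thesis by (simp add: emeasure_ball unit_ball_vol_2 numeral_2_eq_2[symmetric])
  next
    case False
    then have "sqrt (- x) \<le> 0" by simp
    then have "ball (0 :: real \<times> real) (sqrt (- x)) = {}" by (simp add: ball_eq_empty)
    then show ?thesis unfolding \<open>ball 0 (sqrt (- x)) = {}\<close> using False by simp
  qed
  finally have 1: "emeasure (distr lborel borel (\<lambda>r :: real \<times> real. - (norm r)\<^sup>2)) {x<..} = ennreal (pi * max 0 (- x))" .
  then show "emeasure (distr lborel borel (\<lambda>r :: real \<times> real. - (norm r)\<^sup>2)) {x<..} < \<infinity>" by simp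
  have "emeasure (density lborel (\<lambda>x. ennreal pi * indicator {..0} x)) {x<..}
      = (\<integral>\<^sup>+ y. ennreal pi * indicator {x<..0} y \<partial>lborel)"
    by (subst emeasure_density) (auto intro!: nn_integral_cong split: split_indicator)
  also have "\<dots> = ennreal pi * emeasure lborel {x<..0}"
    by (subst nn_integral_cmult_indicator) auto
  also have "\<dots> = ennreal (pi * max 0 (- x))"
    by (cases "x \<le> 0") (auto simp: ennreal_mult'[symmetric])
  finally show "emeasure (distr lborel borel (\<lambda>r :: real \<times> real. - (norm r)\<^sup>2)) {x<..} =
      emeasure (density lborel (\<lambda>x. ennreal pi * indicator {..0} x)) {x<..}"
    using 1 by simp
qed auto

lemma norm_square_plane: "(norm (r :: real \<times> real))\<^sup>2 = (fst r)\<^sup>2 + (snd r)\<^sup>2"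
  by (cases r) (simp add: norm_Pair)

lemma radial_integral_plane:
  fixes f :: "real \<Rightarrow> real"
  assumes [measurable]: "f \<in> borel_measurable borel"
  shows "integrable lborel (\<lambda>r :: real \<times> real. f ((norm r)\<^sup>2)) \<longleftrightarrow> integrable lborel (\<lambda>x. indicator {0..} x * f x)"
    and "(LINT r|lborel. f ((norm (r :: real \<times> real))\<^sup>2)) = pi * (LINT x|lborel. indicator {0..} x * f x)"
proof -
  have d: "density lborel (\<lambda>x :: real. ennreal pi * indicator {..0} x) = density lborel (\<lambda>x. ennreal (pi * indicator {..0} x))"
    by (intro density_cong) (auto simp: ennreal_mult split: split_indicator)
  have "integrable lborel (\<lambda>r :: real \<times> real. f ((norm r)\<^sup>2))
      \<longleftrightarrow> integrable (distr lborel borel (\<lambda>r :: real \<times> real. - (norm r)\<^sup>2)) (\<lambda>x. f (- x))"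
    by (subst integrable_distr_eq) auto
  also have "\<dots> \<longleftrightarrow> integrable lborel (\<lambda>x. (pi * indicator {..0} x) *\<^sub>R f (- x))"
    unfolding distr_norm_square_plane d by (subst integrable_density) auto
  also have "\<dots> \<longleftrightarrow> integrable lborel (\<lambda>x. pi * (indicator {0..} x * f x))"
    using lborel_integrable_real_affine_iff[of "-1" "\<lambda>x. pi * (indicator {0..} x * f x)" 0]
    by (simp add: indicator_def mult_ac)
  also have "\<dots> \<longleftrightarrow> integrable lborel (\<lambda>x. indicator {0..} x * f x)" by simp
  finally show "integrable lborel (\<lambda>r :: real \<times> real. f ((norm r)\<^sup>2)) \<longleftrightarrow> integrable lborel (\<lambda>x. indicator {0..} x * f x)" .
  have "(LINT r|lborel. f ((norm (r :: real \<times> real))\<^sup>2))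
      = (LINT x|distr lborel borel (\<lambda>r :: real \<times> real. - (norm r)\<^sup>2). f (- x))"
    by (subst integral_distr) auto
  also have "\<dots> = (LINT x|lborel. (pi * indicator {..0} x) *\<^sub>R f (- x))"
    unfolding distr_norm_square_plane d by (subst integral_density) auto
  also have "\<dots> = (LINT x|lborel. pi * (indicator {0..} x * f x))"
    using lborel_integral_real_affine[of "-1" "\<lambda>x. pi * (indicator {0..} x * f x)" 0]
    by (simp add: indicator_def mult_ac)
  finally show "(LINT r|lborel. f ((norm (r :: real \<times> real))\<^sup>2)) = pi * (LINT x|lborel. indicator {0..} x * f x)"
    by simp
qed

lemma distr_eqI_nn_integral:
  assumes [measurable]: "T \<in> borel_measurable borel"
    and "\<And>f :: 'a :: euclidean_space \<Rightarrow> ennreal. f \<in> borel_measurable borel \<Longrightarrow>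
      (\<integral>\<^sup>+ r. f (T r) \<partial>lborel) = (\<integral>\<^sup>+ r. f r \<partial>lborel)"
  shows "distr lborel borel T = (lborel :: 'a measure)"
proof (rule measure_eqI)
  fix A :: "'a set" assume "A \<in> sets (distr lborel borel T)"
  then have [measurable]: "A \<in> sets borel" by simp
  have "emeasure (distr lborel borel T) A = (\<integral>\<^sup>+ r. indicator A r \<partial>distr lborel borel T)"
    by simp
  also have "\<dots> = (\<integral>\<^sup>+ r. indicator A (T r) \<partial>lborel)"
    by (subst nn_integral_distr) auto
  also have "\<dots> = emeasure lborel A"
    by (subst assms(2)) auto
  finally show "emeasure (distr lborel borel T) A = emeasure lborel A" .
qed simp

text \<open>By Fubini a shear is a translation on each line parallel to an axis.\<close>

lemma distr_shear_plane:
  fixes a :: real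
  shows "distr lborel borel (\<lambda>r. (fst r + a * snd r, snd r)) = (lborel :: (real \<times> real) measure)"
    and "distr lborel borel (\<lambda>r. (fst r, snd r + a * fst r)) = (lborel :: (real \<times> real) measure)"
proof -
  show "distr lborel borel (\<lambda>r. (fst r + a * snd r, snd r)) = (lborel :: (real \<times> real) measure)"
  proof (rule distr_eqI_nn_integral)
    show "(\<lambda>r. (fst r + a * snd r, snd r)) \<in> borel \<rightarrow>\<^sub>M (borel :: (real \<times> real) measure)"
      by (intro borel_measurable_continuous_onI continuous_intros)
    fix f :: "real \<times> real \<Rightarrow> ennreal" assume f: "f \<in> borel_measurable borel"
    then have [measurable]: "f \<in> borel_measurable (borel \<Otimes>\<^sub>M borel)" by (simp add: borel_prod)
    have "(\<integral>\<^sup>+ r. f (fst r + a * snd r, snd r) \<partial>(lborel \<Otimes>\<^sub>M lborel))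
        = (\<integral>\<^sup>+ p. \<integral>\<^sup>+ q. f (q + a * p, p) \<partial>lborel \<partial>lborel)"
      by (subst lborel_pair.nn_integral_snd[symmetric]) auto
    also have "\<dots> = (\<integral>\<^sup>+ p. \<integral>\<^sup>+ q. f (q, p) \<partial>lborel \<partial>lborel)"
    proof (rule nn_integral_cong)
      fix p :: real
      have "(\<lambda>q. f (q, p)) \<in> borel_measurable borel" by measurable
      from nn_integral_real_affine[OF this, of 1 "a * p"]
      show "(\<integral>\<^sup>+ q. f (q + a * p, p) \<partial>lborel) = (\<integral>\<^sup>+ q. f (q, p) \<partial>lborel)"
        by (simp add: add.commute)
    qed
    also have "\<dots> = (\<integral>\<^sup>+ r. f r \<partial>(lborel \<Otimes>\<^sub>M lborel))"
      by (subst lborel_pair.nn_integral_snd[symmetric]) auto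
    finally show "(\<integral>\<^sup>+ r. f (fst r + a * snd r, snd r) \<partial>lborel) = (\<integral>\<^sup>+ r. f r \<partial>lborel)"
      by (simp add: lborel_prod)
  qed
  show "distr lborel borel (\<lambda>r. (fst r, snd r + a * fst r)) = (lborel :: (real \<times> real) measure)"
  proof (rule distr_eqI_nn_integral)
    show "(\<lambda>r. (fst r, snd r + a * fst r)) \<in> borel \<rightarrow>\<^sub>M (borel :: (real \<times> real) measure)"
      by (intro borel_measurable_continuous_onI continuous_intros)
    fix f :: "real \<times> real \<Rightarrow> ennreal" assume f: "f \<in> borel_measurable borel"
    then have [measurable]: "f \<in> borel_measurable (borel \<Otimes>\<^sub>M borel)" by (simp add: borel_prod)
    have "(\<integral>\<^sup>+ r. f (fst r, snd r + a * fst r) \<partial>(lborel \<Otimes>\<^sub>M lborel))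
        = (\<integral>\<^sup>+ q. \<integral>\<^sup>+ p. f (q, p + a * q) \<partial>lborel \<partial>lborel)"
      by (subst lborel.nn_integral_fst[symmetric]) auto
    also have "\<dots> = (\<integral>\<^sup>+ q. \<integral>\<^sup>+ p. f (q, p) \<partial>lborel \<partial>lborel)"
    proof (rule nn_integral_cong)
      fix q :: real
      have "(\<lambda>p. f (q, p)) \<in> borel_measurable borel" by measurable
      from nn_integral_real_affine[OF this, of 1 "a * q"]
      show "(\<integral>\<^sup>+ p. f (q, p + a * q) \<partial>lborel) = (\<integral>\<^sup>+ p. f (q, p) \<partial>lborel)"
        by (simp add: add.commute)
    qed
    also have "\<dots> = (\<integral>\<^sup>+ r. f r \<partial>(lborel \<Otimes>\<^sub>M lborel))"
      by (subst lborel.nn_integral_fst[symmetric]) auto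
    finally show "(\<integral>\<^sup>+ r. f (fst r, snd r + a * fst r) \<partial>lborel) = (\<integral>\<^sup>+ r. f r \<partial>lborel)"
      by (simp add: lborel_prod)
  qed
qed

text \<open>A rotation that is not a half turn or the identity is a product of three shears.\<close>

lemma distr_rotation_plane:
  fixes \<theta> :: real
  assumes "sin \<theta> \<noteq> 0"
  shows "distr lborel borel (\<lambda>r. (cos \<theta> * fst r - sin \<theta> * snd r, sin \<theta> * fst r + cos \<theta> * snd r))
    = (lborel :: (real \<times> real) measure)"
proof -
  \<comment> \<open>This is \<open>- tan (\<theta> / 2)\<close>; the two outer shears use it and the
    middle one uses \<open>sin \<theta>\<close>.\<close>
  define a where "a = (cos \<theta> - 1) / sin \<theta>"
  define S where "S = (\<lambda>r :: real \<times> real. (fst r + a * snd r, snd r))"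
  define T where "T = (\<lambda>r :: real \<times> real. (fst r, snd r + sin \<theta> * fst r))"
  have [measurable]: "S \<in> borel \<rightarrow>\<^sub>M borel" "T \<in> borel \<rightarrow>\<^sub>M borel"
    unfolding S_def T_def by (intro borel_measurable_continuous_onI continuous_intros)+
  have as: "a * sin \<theta> = cos \<theta> - 1" using assms by (simp add: a_def)
  have ac: "a * (1 + cos \<theta>) = - sin \<theta>"
  proof -
    have "(cos \<theta> - 1) * (1 + cos \<theta>) = - (sin \<theta>)\<^sup>2"
      using sin_cos_squared_add[of \<theta>] by (simp add: algebra_simps power2_eq_square)
    then show ?thesis using assms by (simp add: a_def power2_eq_square)
  qed
  have "(\<lambda>r. (cos \<theta> * fst r - sin \<theta> * snd r, sin \<theta> * fst r + cos \<theta> * snd r)) = S \<circ> (T \<circ> S)"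
  proof (rule ext)
    fix r :: "real \<times> real"
    obtain q p where r: "r = (q, p)" by (cases r)
    have y: "p + sin \<theta> * (q + a * p) = sin \<theta> * q + cos \<theta> * p"
    proof -
      have "p + sin \<theta> * (q + a * p) = sin \<theta> * q + (1 + a * sin \<theta>) * p" by (simp add: algebra_simps)
      then show ?thesis unfolding as by simp
    qed
    have "q + a * p + a * (sin \<theta> * q + cos \<theta> * p) = q * (1 + a * sin \<theta>) + p * (a * (1 + cos \<theta>))"
      by (simp add: algebra_simps)
    also have "\<dots> = cos \<theta> * q - sin \<theta> * p" unfolding as ac by (simp add: algebra_simps)
    finally show "(cos \<theta> * fst r - sin \<theta> * snd r, sin \<theta> * fst r + cos \<theta> * snd r) = (S \<circ> (T \<circ> S)) r"
      using y by (simp add: r S_def T_def)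
  qed
  moreover have "distr lborel borel (S \<circ> (T \<circ> S)) = (lborel :: (real \<times> real) measure)"
  proof -
    have "distr lborel borel (S \<circ> (T \<circ> S)) = distr (distr (distr lborel borel S) borel T) borel S"
      by (simp add: distr_distr)
    then show ?thesis
      using distr_shear_plane(1)[of a] distr_shear_plane(2)[of "sin \<theta>"]
      by (simp add: S_def[symmetric] T_def[symmetric])
  qed
  ultimately show ?thesis by simp
qed

lemma integral_rotation_plane:
  fixes f :: "real \<times> real \<Rightarrow> real"
  assumes "sin \<theta> \<noteq> 0" and [measurable]: "f \<in> borel_measurable borel"
  shows "(LINT r|lborel. f (cos \<theta> * fst r - sin \<theta> * snd r, sin \<theta> * fst r + cos \<theta> * snd r)) = (LINT r|lborel. f r)"
proof -
  have "(LINT r|lborel. f r) = (LINT r|distr lborel borel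
      (\<lambda>r. (cos \<theta> * fst r - sin \<theta> * snd r, sin \<theta> * fst r + cos \<theta> * snd r)). f r)"
    by (simp add: distr_rotation_plane[OF assms(1)])
  also have "\<dots> = (LINT r|lborel. f (cos \<theta> * fst r - sin \<theta> * snd r, sin \<theta> * fst r + cos \<theta> * snd r))"
    by (subst integral_distr) (auto intro!: borel_measurable_continuous_onI continuous_intros)
  finally show ?thesis ..
qed

section \<open>Angular averages of powers of \<open>z\<close>\<close>

definition plane_complex :: "real \<times> real \<Rightarrow> complex" where
  "plane_complex r = Complex (fst r) (snd r)"

lemma norm_plane_complex [simp]: "norm (plane_complex r) = norm r"
  by (cases r) (simp add: plane_complex_def norm_Pair cmod_def)

lemma plane_complex_rotation:
  "plane_complex (cos \<theta> * fst r - sin \<theta> * snd r, sin \<theta> * fst r + cos \<theta> * snd r) = cis \<theta> * plane_complex r"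
  by (simp add: plane_complex_def complex_eq_iff)

lemma norm_rotation_plane:
  "norm (cos \<theta> * fst r - sin \<theta> * snd r, sin \<theta> * fst r + cos \<theta> * snd r) = norm (r :: real \<times> real)"
  unfolding norm_plane_complex[symmetric] plane_complex_rotation norm_mult by simp

lemma measurable_plane_complex_power [measurable]:
  "(\<lambda>r. Re (plane_complex r ^ n)) \<in> borel_measurable borel"
  "(\<lambda>r. Im (plane_complex r ^ n)) \<in> borel_measurable borel"
  unfolding plane_complex_def Complex_eq
  by (intro borel_measurable_continuous_onI continuous_intros)+

text \<open>The rotation by \<open>pi / n\<close> fixes the radial factor and changes the sign of
  the \<open>n\<close>-th power, so the integral equals its own negative. For
  \<open>n \<ge> 2\<close> this angle lies strictly between 0 and \<open>pi\<close>, as the rotation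
  lemma requires.\<close>

lemma integral_radial_Re_power:
  fixes G :: "real \<Rightarrow> real"
  assumes [measurable]: "G \<in> borel_measurable borel" and n: "n \<ge> 2"
  shows "(LINT r|lborel. G ((norm r)\<^sup>2) * Re (plane_complex r ^ n)) = 0"
proof -
  define \<theta> where "\<theta> = pi / real n"
  have "sin \<theta> \<noteq> 0" using n by (intro less_imp_neq[symmetric] sin_gt_zero) (auto simp: \<theta>_def field_simps)
  from integral_rotation_plane[OF this, of "\<lambda>r. G ((norm r)\<^sup>2) * Re (plane_complex r ^ n)"]
  have "(LINT r|lborel. G ((norm r)\<^sup>2) * Re ((cis \<theta> * plane_complex r) ^ n))
      = (LINT r|lborel. G ((norm r)\<^sup>2) * Re (plane_complex r ^ n))"
    by (simp add: norm_rotation_plane plane_complex_rotation)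
  moreover have "cis \<theta> ^ n = - 1"
  proof -
    have "real n * \<theta> = pi" using n by (simp add: \<theta>_def)
    show ?thesis by (simp only: Complex.DeMoivre \<open>real n * \<theta> = _\<close> cis_pi cis_pi_half)
  qed
  ultimately show ?thesis by (simp add: power_mult_distrib)
qed

text \<open>The rotation by \<open>pi / (2 * n)\<close> multiplies the \<open>n\<close>-th power by
  \<open>\<i>\<close> and so exchanges the squares of its real and imaginary parts. The two
  integrals agree, and their sum is that of the squared modulus.\<close>

lemma integral_radial_Re_power_square:
  fixes G :: "real \<Rightarrow> real"
  assumes [measurable]: "G \<in> borel_measurable borel" and n: "n \<ge> 1"
    and int: "integrable lborel (\<lambda>r :: real \<times> real. G ((norm r)\<^sup>2) * ((norm r)\<^sup>2) ^ n)"
  shows "integrable lborel (\<lambda>r. G ((norm r)\<^sup>2) * (Re (plane_complex r ^ n))\<^sup>2)"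
    and "(LINT r|lborel. G ((norm r)\<^sup>2) * (Re (plane_complex r ^ n))\<^sup>2)
      = (LINT r|lborel. G ((norm (r :: real \<times> real))\<^sup>2) * ((norm r)\<^sup>2) ^ n) / 2"
proof -
  have sq: "(Re (plane_complex r ^ n))\<^sup>2 + (Im (plane_complex r ^ n))\<^sup>2 = ((norm r)\<^sup>2) ^ n" for r
    using cmod_power2[of "plane_complex r ^ n"] by (simp add: norm_power power_even_eq[symmetric] power_mult[symmetric] mult.commute)
  show iR: "integrable lborel (\<lambda>r. G ((norm r)\<^sup>2) * (Re (plane_complex r ^ n))\<^sup>2)"
    by (rule Bochner_Integration.integrable_bound[OF int])
       (auto simp: abs_mult sq[symmetric] intro!: mult_left_mono AE_I2)
  have iI: "integrable lborel (\<lambda>r. G ((norm r)\<^sup>2) * (Im (plane_complex r ^ n))\<^sup>2)"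
    by (rule Bochner_Integration.integrable_bound[OF int])
       (auto simp: abs_mult sq[symmetric] intro!: mult_left_mono AE_I2)
  define \<theta> where "\<theta> = (pi / 2) / real n"
  have "sin \<theta> \<noteq> 0" using n by (intro less_imp_neq[symmetric] sin_gt_zero) (auto simp: \<theta>_def field_simps)
  from integral_rotation_plane[OF this, of "\<lambda>r. G ((norm r)\<^sup>2) * (Re (plane_complex r ^ n))\<^sup>2"]
  have "(LINT r|lborel. G ((norm r)\<^sup>2) * (Re ((cis \<theta> * plane_complex r) ^ n))\<^sup>2)
      = (LINT r|lborel. G ((norm r)\<^sup>2) * (Re (plane_complex r ^ n))\<^sup>2)"
    by (simp add: norm_rotation_plane plane_complex_rotation)
  moreover have "cis \<theta> ^ n = \<i>"
  proof -
    have "real n * \<theta> = pi / 2" using n by (simp add: \<theta>_def)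
    show ?thesis by (simp only: Complex.DeMoivre \<open>real n * \<theta> = _\<close> cis_pi cis_pi_half)
  qed
  ultimately have "(LINT r|lborel. G ((norm r)\<^sup>2) * (Im (plane_complex r ^ n))\<^sup>2)
      = (LINT r|lborel. G ((norm r)\<^sup>2) * (Re (plane_complex r ^ n))\<^sup>2)"
    by (simp add: power_mult_distrib)
  moreover have "(LINT r|lborel. G ((norm (r :: real \<times> real))\<^sup>2) * ((norm r)\<^sup>2) ^ n) =
      (LINT r|lborel. G ((norm r)\<^sup>2) * (Re (plane_complex r ^ n))\<^sup>2)
      + (LINT r|lborel. G ((norm r)\<^sup>2) * (Im (plane_complex r ^ n))\<^sup>2)"
    unfolding sq[symmetric] distrib_left by (rule Bochner_Integration.integral_add[OF iR iI])
  ultimately show "(LINT r|lborel. G ((norm r)\<^sup>2) * (Re (plane_complex r ^ n))\<^sup>2)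
      = (LINT r|lborel. G ((norm (r :: real \<times> real))\<^sup>2) * ((norm r)\<^sup>2) ^ n) / 2"
    by simp
qed

section \<open>From majorization to integrals of the excess over a level\<close>

lemma phase_space_densityI:
  assumes "W \<in> borel_measurable borel" "\<And>r. 0 \<le> W r" "integrable lborel W" "(LINT r|lborel. W r) = 1"
  shows "phase_space_density W"
  using assms by (simp add: phase_space_density_def integrable_completion integral_completion)

text \<open>For \<open>W\<close> the superlevel set \<open>A\<close> at \<open>t\<close> turns the
  excess integral into a mass minus \<open>t * m\<close>; for \<open>V\<close> every competitor of
  the same measure has mass at most its excess integral plus \<open>t * m\<close>. Majorization is
  used at \<open>m\<close>, the measure of \<open>A\<close>, which is finite because
  \<open>W\<close> is integrable.\<close>

lemma cont_majorized_by_imp_integral_excess_le: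
  assumes W: "phase_space_density W" and V: "phase_space_density V" and maj: "W \<prec>\<^sub>c V" and t: "t > 0"
  shows "(LINT r|lebesgue. max 0 (W r - t)) \<le> (LINT r|lebesgue. max 0 (V r - t))"
proof -
  have W0: "\<And>r. 0 \<le> W r" and Wi: "integrable lebesgue W" and W1: "(LINT r|lebesgue. W r) = 1"
    and V0: "\<And>r. 0 \<le> V r" and Vi: "integrable lebesgue V"
    using W V by (auto simp: phase_space_density_def)
  note [measurable] = borel_measurable_integrable[OF Wi] borel_measurable_integrable[OF Vi]
  have excess_int: "integrable lebesgue (\<lambda>r. max 0 (U r - t))"
    if "integrable lebesgue U" "\<And>r. 0 \<le> U r" for U :: "real \<times> real \<Rightarrow> real"
    by (rule Bochner_Integration.integrable_bound[OF that(1)])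
       (use that t borel_measurable_integrable[OF that(1)] in \<open>auto intro!: AE_I2 simp: abs_if max_def\<close>)
  define A where "A = {r \<in> space lebesgue. t < W r}"
  have A [measurable]: "A \<in> sets lebesgue" unfolding A_def by measurable
  have iA: "integrable lebesgue (indicator A :: _ \<Rightarrow> real)"
    by (rule Bochner_Integration.integrable_bound[OF integrable_mult_right[OF Wi, of "1 / t"]])
       (use t W0 in \<open>auto intro!: AE_I2 simp: A_def field_simps split: split_indicator\<close>)
  then have fin: "emeasure lebesgue A < \<infinity>"
    by (simp add: integrable_indicator_iff)
  define m where "m = measure lebesgue A"
  have m: "emeasure lebesgue A = ennreal m"
    using fin by (simp add: m_def emeasure_eq_ennreal_measure)
  have excess_nonneg: "0 \<le> (LINT r|lebesgue. max 0 (V r - t))"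
    by (intro integral_nonneg_AE) auto
  \<comment> \<open>Majorization speaks of positive \<open>m\<close> only; for \<open>m = 0\<close>
    the left side is zero.\<close>
  show ?thesis
  proof (cases "m > 0")
    case False
    then have "m = 0" using measure_nonneg[of lebesgue A] by (simp add: m_def)
    then have "A \<in> null_sets lebesgue" using m by (simp add: null_sets_def)
    then have "AE r in lebesgue. r \<notin> A" by (rule AE_not_in)
    then have "AE r in lebesgue. max 0 (W r - t) = 0" by eventually_elim (auto simp: A_def)
    then have "(LINT r|lebesgue. max 0 (W r - t)) = 0" by (rule integral_eq_zero_AE)
    then show ?thesis using excess_nonneg by simp
  next
    case True
    have iWA: "integrable lebesgue (\<lambda>r. indicator B r * U r)"
      if "B \<in> sets lebesgue" "integrable lebesgue U" for B and U :: "real \<times> real \<Rightarrow> real"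
      using integrable_mult_indicator[OF that] by simp
    have "(LINT r|lebesgue. max 0 (W r - t)) = (LINT r|lebesgue. indicator A r * W r - t * indicator A r)"
      by (intro Bochner_Integration.integral_cong refl) (auto simp: A_def split: split_indicator)
    also have "\<dots> = (LINT r:A|lebesgue. W r) - t * m"
      using iWA[OF A Wi] iA by (simp add: set_lebesgue_integral_def m_def)
    also have "(LINT r:A|lebesgue. W r) \<le> max_mass W m"
      unfolding max_mass_def
    proof (rule cSUP_upper)
      show "A \<in> {A \<in> sets lebesgue. emeasure lebesgue A = ennreal m}" using m by simp
      have "(LINT r:B|lebesgue. W r) \<le> 1" if "B \<in> sets lebesgue" for B
        unfolding W1[symmetric] set_lebesgue_integral_def real_scaleR_def
        by (intro integral_mono iWA that Wi) (use W0 in \<open>auto split: split_indicator\<close>)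
      then show "bdd_above ((\<lambda>A. LINT r:A|lebesgue. W r) ` {A \<in> sets lebesgue. emeasure lebesgue A = ennreal m})"
        by (intro bdd_aboveI[of _ 1]) auto
    qed
    also have "max_mass W m \<le> max_mass V m"
      using maj True by (simp add: cont_majorized_by_def)
    also have "max_mass V m \<le> (LINT r|lebesgue. max 0 (V r - t)) + t * m"
      unfolding max_mass_def
    proof (rule cSUP_least)
      show "{A \<in> sets (lebesgue :: (real \<times> real) measure). emeasure lebesgue A = ennreal m} \<noteq> {}"
        using m A by blast
      fix B assume "B \<in> {A \<in> sets (lebesgue :: (real \<times> real) measure). emeasure lebesgue A = ennreal m}"
      then have B [measurable]: "B \<in> sets lebesgue" and mB: "emeasure lebesgue B = ennreal m" by auto
      have iB: "integrable lebesgue (indicator B :: _ \<Rightarrow> real)"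
        using mB by (simp add: integrable_indicator_iff)
      have "(LINT r:B|lebesgue. V r) \<le> (LINT r|lebesgue. max 0 (V r - t) + t * indicator B r)"
        unfolding set_lebesgue_integral_def real_scaleR_def
      proof (intro integral_mono Bochner_Integration.integrable_add integrable_mult_right iWA B Vi iB excess_int V0)
        show "indicator B r * V r \<le> max 0 (V r - t) + t * indicator B r" for r
          by (cases "r \<in> B") auto
      qed
      also have "\<dots> = (LINT r|lebesgue. max 0 (V r - t)) + t * measure lebesgue B"
        using excess_int[OF Vi V0] iB by simp
      also have "measure lebesgue B = m"
        unfolding measure_def mB using True by simp
      finally show "(LINT r:B|lebesgue. V r) \<le> (LINT r|lebesgue. max 0 (V r - t)) + t * m" .
    qed
    finally show ?thesis by simp
  qed
qed

section \<open>The second-order coefficient\<close>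

lemma eventually_polynomial_pos:
  fixes a :: "nat \<Rightarrow> real"
  assumes "a d > 0"
  obtains Y where "Y \<ge> 1" "\<And>x. x \<ge> Y \<Longrightarrow> (\<Sum>k\<le>d. a k * x ^ k) > 0"
proof
  define S where "S = (\<Sum>k<d. \<bar>a k\<bar>)"
  show "max 1 (S / a d + 1) \<ge> 1" by simp
  fix x assume x: "x \<ge> max 1 (S / a d + 1)"
  then have x1: "x \<ge> 1" and "x > S / a d" by auto
  then have xS: "a d * x > S" using assms by (simp add: field_simps)
  \<comment> \<open>The extra factor \<open>x\<close> lifts each lower power to at most
    \<open>x ^ d\<close>, so the leading term wins as soon as \<open>a d * x\<close> exceeds
    \<open>S\<close>.\<close>
  have "\<bar>x * (\<Sum>k<d. a k * x ^ k)\<bar> \<le> (\<Sum>k<d. \<bar>x * (a k * x ^ k)\<bar>)"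
    unfolding sum_distrib_left by (rule sum_abs)
  also have "\<dots> \<le> (\<Sum>k<d. \<bar>a k\<bar> * x ^ d)"
  proof (rule sum_mono)
    fix k assume "k \<in> {..<d}"
    then have "x ^ Suc k \<le> x ^ d" using x1 by (intro power_increasing) auto
    then have "\<bar>a k\<bar> * x ^ Suc k \<le> \<bar>a k\<bar> * x ^ d" by (intro mult_left_mono) auto
    then show "\<bar>x * (a k * x ^ k)\<bar> \<le> \<bar>a k\<bar> * x ^ d"
      using x1 by (simp add: abs_mult mult_ac)
  qed
  also have "\<dots> = S * x ^ d" by (simp add: S_def sum_distrib_right)
  finally have "\<bar>x * (\<Sum>k<d. a k * x ^ k)\<bar> \<le> S * x ^ d" .
  moreover have "S * x ^ d < a d * x * x ^ d"
    using xS x1 by (intro mult_strict_right_mono) auto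
  ultimately have "0 < x * ((\<Sum>k<d. a k * x ^ k) + a d * x ^ d)"
    by (simp add: algebra_simps abs_le_iff)
  then have "0 < (\<Sum>k<d. a k * x ^ k) + a d * x ^ d"
    using x1 by (simp add: zero_less_mult_iff)
  also have "\<dots> = (\<Sum>k\<le>d. a k * x ^ k)"
    by (simp add: lessThan_Suc_atMost[symmetric])
  finally show "(\<Sum>k\<le>d. a k * x ^ k) > 0" .
qed

definition P_coeff :: "nat \<Rightarrow> nat \<Rightarrow> real" where
  "P_coeff n k = (-1) ^ n * (-1) ^ k * real (n choose k) / fact k * 2 ^ k"

lemma P_poly_eq: "P_poly n x = (\<Sum>k\<le>n. P_coeff n k * x ^ k)"
  unfolding P_poly_def laguerre_def sum_distrib_left P_coeff_def
  by (intro sum.cong refl) (simp add: power_mult_distrib)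

lemma measurable_P_poly [measurable]: "P_poly n \<in> borel_measurable borel"
  unfolding P_poly_eq [abs_def] by measurable

lemma continuous_on_P_poly: "continuous_on S (P_poly n)"
  unfolding P_poly_eq [abs_def] by (intro continuous_intros)

lemma beta_coeff_pos: "beta_coeff n > 0"
  by (simp add: beta_coeff_def)

lemma beta_coeff_square: "(beta_coeff n)\<^sup>2 = 2 ^ n / fact n"
proof -
  have "(2 powr (real n / 2))\<^sup>2 = 2 powr real n"
    by (simp add: power2_eq_square powr_add[symmetric])
  then show ?thesis by (simp add: beta_coeff_def power_divide powr_realpow)
qed

lemma P_coeff_n: "P_coeff n n = (beta_coeff n)\<^sup>2"
  by (simp add: P_coeff_def beta_coeff_square flip: power_add)

text \<open>The substance is boundedness from below, without which the real infimum would say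
  nothing: the leading coefficient controls large \<open>x\<close>, compactness the rest.\<close>

lemma M_const_ge:
  assumes "x \<ge> 0" "n \<ge> 1"
  shows "P_poly n x \<ge> - M_const n"
proof -
  have "P_coeff n n > 0" using beta_coeff_pos[of n] by (simp add: P_coeff_n)
  then obtain Y where Y: "Y \<ge> 1" "\<And>x. x \<ge> Y \<Longrightarrow> P_poly n x > 0"
    unfolding P_poly_eq using eventually_polynomial_pos[of "P_coeff n" n] by blast
  have "compact (P_poly n ` {0..Y})"
    by (intro compact_continuous_image continuous_on_P_poly) auto
  then have "bdd_below (P_poly n ` {0..Y})" by (intro bounded_imp_bdd_below compact_imp_bounded)
  then obtain B where B: "\<And>x. x \<in> {0..Y} \<Longrightarrow> B \<le> P_poly n x" by (fastforce simp: bdd_below_def)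
  have "bdd_below (P_poly n ` {0..})"
  proof (rule bdd_belowI2)
    fix x :: real assume "x \<in> {0..}"
    then show "min B 0 \<le> P_poly n x" using B[of x] Y(2)[of x] by (cases "x \<le> Y") auto
  qed
  then have "(INF x\<in>{0..}. P_poly n x) \<le> P_poly n x"
    using assms by (intro cINF_lower) auto
  then show ?thesis by (simp add: M_const_def)
qed

text \<open>For \<open>n \<ge> 3\<close> the coefficient of \<open>x ^ (n - 1)\<close> below is \<open>(n - 2) * 2 ^ (n - 1) / fact (n - 1)\<close>;
  for \<open>n \<le> 2\<close> it is not positive.\<close>

lemma P_poly_deficit_pos:
  assumes n: "n \<ge> 3"
  obtains Y where "Y \<ge> 1" "\<And>x. x \<ge> Y \<Longrightarrow>
    (beta_coeff n)\<^sup>2 * (x ^ n - real n * x ^ (n - 1)) - P_poly n x + 1 > 0"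
proof -
  obtain m where m: "n = Suc m" "m \<ge> 2" using n by (cases n) auto
  \<comment> \<open>The terms in \<open>x ^ n\<close> cancel because the leading coefficient of
    \<open>P_poly n\<close> is the square of \<open>beta_coeff n\<close>; hence the degree drops to
    \<open>m = n - 1\<close>, and these are the remaining coefficients.\<close>
  define a where "a k = (if k = m then - (beta_coeff n)\<^sup>2 * real n else 0) - P_coeff n k + (if k = 0 then 1 else 0)" for k
  have eq: "(beta_coeff n)\<^sup>2 * (x ^ n - real n * x ^ (n - 1)) - P_poly n x + 1 = (\<Sum>k\<le>m. a k * x ^ k)" for x
  proof -
    have "(\<Sum>k\<le>m. a k * x ^ k) = (\<Sum>k\<le>m. (if k = m then - (beta_coeff n)\<^sup>2 * real n * x ^ k else 0)
        - P_coeff n k * x ^ k + (if k = 0 then x ^ k else 0))"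
      by (intro sum.cong refl) (simp add: a_def algebra_simps)
    also have "\<dots> = - (beta_coeff n)\<^sup>2 * real n * x ^ m - (\<Sum>k\<le>m. P_coeff n k * x ^ k) + 1"
      by (simp add: sum.distrib sum_subtractf)
    also have "(\<Sum>k\<le>m. P_coeff n k * x ^ k) = P_poly n x - (beta_coeff n)\<^sup>2 * x ^ n"
      unfolding P_poly_eq using m by (simp add: P_coeff_n)
    finally show ?thesis using m by (simp add: algebra_simps)
  qed
  have "P_coeff n m = - (real n * 2 ^ m / fact m)"
    unfolding P_coeff_def using m by (simp add: field_simps flip: power_add)
  moreover have "(beta_coeff n)\<^sup>2 * real n = 2 * 2 ^ m / fact m"
    unfolding beta_coeff_square m by (simp add: field_simps del: of_nat_Suc)
  \<comment> \<open>The derivative of \<open>x ^ n\<close> contributes \<open>- 2\<close>, the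
    Laguerre coefficient \<open>+ n\<close>, each times \<open>2 ^ m / fact m\<close>. Since
    \<open>m > 0\<close>, the constant 1 does not interfere.\<close>
  ultimately have "a m = (real n - 2) * 2 ^ m / fact m"
    using m by (simp add: a_def field_simps)
  then have "a m > 0" using n by simp
  then show ?thesis
    using eventually_polynomial_pos[of a m] that unfolding eq by blast
qed

lemma has_bochner_integral_power_exp:
  "has_bochner_integral lborel (\<lambda>x. indicator {0..} x * (x ^ k * exp (- x)) :: real) (fact k)"
proof (rule has_bochner_integral_nn_integral)
  have "(\<integral>\<^sup>+ x. ennreal (indicator {0..} x * (x ^ k * exp (- x))) \<partial>lborel)
      = (\<integral>\<^sup>+ x. ennreal (x ^ k * exp (- x)) * indicator {0..} x \<partial>lborel)"
    by (intro nn_integral_cong) (simp split: split_indicator)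
  then show "(\<integral>\<^sup>+ x. ennreal (indicator {0..} x * (x ^ k * exp (- x))) \<partial>lborel) = ennreal (fact k)"
    using nn_intergal_power_times_exp_Ici[of k] by simp
qed (auto split: split_indicator)

lemma integrable_bounded_mult:
  fixes f g :: "'a \<Rightarrow> real"
  assumes f: "integrable M f" and [measurable]: "g \<in> borel_measurable M" and g: "\<And>x. x \<in> space M \<Longrightarrow> \<bar>g x\<bar> \<le> B"
  shows "integrable M (\<lambda>x. g x * f x)"
proof (rule Bochner_Integration.integrable_bound[OF integrable_mult_right[OF f, of B]])
  show "(\<lambda>x. g x * f x) \<in> borel_measurable M" using f by measurable
  show "AE x in M. norm (g x * f x) \<le> norm (B * f x)"
  proof (rule AE_I2)
    fix x assume "x \<in> space M"
    then have "\<bar>g x\<bar> * \<bar>f x\<bar> \<le> \<bar>B\<bar> * \<bar>f x\<bar>" using g[of x] by (intro mult_right_mono) auto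
    then show "norm (g x * f x) \<le> norm (B * f x)" by (simp add: abs_mult)
  qed
qed

text \<open>The moments \<open>fact k\<close> cancel the factorials in the coefficients, and the
  binomial theorem leaves \<open>(1 - 2) ^ n\<close> times the sign. It expresses the unit mass of
  the Fock state.\<close>

lemma has_bochner_integral_P_poly_exp:
  "has_bochner_integral lborel (\<lambda>x. indicator {0..} x * (P_poly n x * exp (- x))) 1"
proof -
  have "has_bochner_integral lborel (\<lambda>x. \<Sum>k\<le>n. P_coeff n k * (indicator {0..} x * (x ^ k * exp (- x))))
      (\<Sum>k\<le>n. P_coeff n k * fact k)"
    by (intro has_bochner_integral_sum has_bochner_integral_mult_right has_bochner_integral_power_exp)
  also have "(\<lambda>x. \<Sum>k\<le>n. P_coeff n k * (indicator {0..} x * (x ^ k * exp (- x))))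
      = (\<lambda>x. indicator {0..} x * (P_poly n x * exp (- x)))"
    unfolding P_poly_eq by (simp add: sum_distrib_left sum_distrib_right mult_ac)
  also have "(\<Sum>k\<le>n. P_coeff n k * fact k) = (-1) ^ n * (\<Sum>k\<le>n. real (n choose k) * (-2) ^ k * 1 ^ (n - k))"
    unfolding sum_distrib_left
    by (intro sum.cong refl) (simp add: P_coeff_def power_minus[of "2 :: real"])
  also have "(\<Sum>k\<le>n. real (n choose k) * (-2) ^ k * 1 ^ (n - k)) = (-2 + 1 :: real) ^ n"
    by (rule binomial_ring[symmetric])
  also have "(-1) ^ n * (-2 + 1 :: real) ^ n = 1"
    by (simp flip: power_mult_distrib)
  finally show ?thesis .
qed

lemma integral_Ioi_deriv:
  fixes F f :: "real \<Rightarrow> real"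
  assumes "\<And>x. (F has_real_derivative f x) (at x)" "continuous_on UNIV f"
    and "integrable lborel (\<lambda>x. indicator {a<..} x * f x)" "(F \<longlongrightarrow> 0) at_top"
  shows "(LINT x|lborel. indicator {a<..} x * f x) = - F a"
proof -
  have ei: "einterval (ereal a) \<infinity> = {a<..}" by (auto simp: einterval_def)
  have "(LBINT x=ereal a..\<infinity>. f x) = 0 - F a"
  proof (rule interval_integral_FTC_integrable[where F = F])
    show "(F has_vector_derivative f x) (at x)" for x
      using assms(1) by (simp add: has_real_derivative_iff_has_vector_derivative)
    show "set_integrable lborel (einterval (ereal a) \<infinity>) f"
      using assms(3) by (simp add: set_integrable_def ei)
    have "isCont F a" using assms(1) DERIV_isCont by blast
    then have "(F \<longlongrightarrow> F a) (at_right a)" by (simp add: isCont_def filterlim_at_split)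
    then show "((F \<circ> real_of_ereal) \<longlongrightarrow> F a) (at_right (ereal a))"
      by (simp add: ereal_tendsto_simps)
    show "((F \<circ> real_of_ereal) \<longlongrightarrow> 0) (at_left \<infinity>)"
      using assms(4) by (simp add: ereal_tendsto_simps)
    show "isCont f x" for x using assms(2) by (simp add: continuous_on_eq_continuous_at)
  qed auto
  then show ?thesis
    by (simp add: interval_lebesgue_integral_def set_lebesgue_integral_def ei)
qed

lemma integral_exp_Ioi:
  "integrable lborel (\<lambda>x. indicator {a<..} x * exp (- x :: real))"
  "(LINT x|lborel. indicator {a<..} x * exp (- x)) = exp (- a)"
proof -
  have "set_integrable lborel (einterval (ereal a) \<infinity>) (\<lambda>x. exp (- x))"
  proof (rule interval_integral_FTC_nonneg(1)[where F = "\<lambda>x. - exp (- x)" and A = "- exp (- a)" and B = 0])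
    show "(((\<lambda>x. - exp (- x)) \<circ> real_of_ereal) \<longlongrightarrow> - exp (- a)) (at_right (ereal a))"
      unfolding ereal_tendsto_simps by (intro tendsto_intros)
    show "(((\<lambda>x :: real. - exp (- x)) \<circ> real_of_ereal) \<longlongrightarrow> 0) (at_left \<infinity>)"
      unfolding ereal_tendsto_simps by real_asymp
  qed (auto intro!: derivative_eq_intros)
  moreover have "einterval (ereal a) \<infinity> = {a<..}" by (auto simp: einterval_def)
  ultimately show 1: "integrable lborel (\<lambda>x. indicator {a<..} x * exp (- x :: real))"
    by (simp add: set_integrable_def)
  have "((\<lambda>x :: real. - exp (- x)) \<longlongrightarrow> 0) at_top" by real_asymp
  then show "(LINT x|lborel. indicator {a<..} x * exp (- x)) = exp (- a)"
    by (subst integral_Ioi_deriv[where F = "\<lambda>x. - exp (- x)", OF _ _ 1])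
       (auto intro!: derivative_eq_intros continuous_intros)
qed

lemma power_exp_le_fact: "x \<ge> 0 \<Longrightarrow> x ^ k * exp (- x) \<le> (fact k :: real)"
proof -
  assume x: "x \<ge> 0"
  have "(\<lambda>j. x ^ j /\<^sub>R fact j) sums exp x" by (rule exp_converges)
  then have "x ^ k /\<^sub>R fact k \<le> exp x"
    using sum_le_suminf[of "\<lambda>j. x ^ j /\<^sub>R fact j" "{k}"] x by (simp add: sums_iff)
  then show ?thesis by (simp add: exp_minus field_simps)
qed

text \<open>The sum \<open>J_tail n Y + J_bulk n Y\<close> is \<open>\<pi>\<close> times the \<open>\<epsilon>\<^sup>2\<close>-coefficient of
  \<open>\<integral> \<Phi>(W\<^sub>\<rho>)\<close>. Integrating \<open>J_tail\<close> by parts brings in the polynomial of \<open>P_poly_deficit_pos\<close>.\<close>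

definition J_tail :: "nat \<Rightarrow> real \<Rightarrow> real" where
  "J_tail n Y = (beta_coeff n)\<^sup>2 * (LINT x|lborel. indicator {Y<..} x * (x ^ n * exp (- x) * exp (- x)))"

definition J_bulk :: "nat \<Rightarrow> real \<Rightarrow> real" where
  "J_bulk n Y = (LINT x|lborel. indicator {0..} x * (min (exp (- x)) (exp (- Y)) * ((P_poly n x - 1) * exp (- x))))"

lemma integrable_J_tail:
  assumes "Y \<ge> 0"
  shows "integrable lborel (\<lambda>x. indicator {Y<..} x * (x ^ n * exp (- x) * exp (- x)) :: real)"
proof -
  have "integrable lborel (\<lambda>x. (indicator {Y<..} x * exp (- x)) * (indicator {0..} x * (x ^ n * exp (- x))) :: real)"
    by (rule integrable_bounded_mult[where B = 1, OF has_bochner_integral_power_exp[THEN integrable.intros]])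
       (use assms in \<open>auto split: split_indicator\<close>)
  also have "(\<lambda>x. (indicator {Y<..} x * exp (- x)) * (indicator {0..} x * (x ^ n * exp (- x))) :: real)
     = (\<lambda>x. indicator {Y<..} x * (x ^ n * exp (- x) * exp (- x)))"
    using assms by (auto simp: fun_eq_iff split: split_indicator)
  finally show ?thesis .
qed

text \<open>Both contributions are brought to the same weight \<open>E x * exp (- x)\<close> on
  \<open>x > Y\<close>, after which positivity is a statement about one polynomial. Strictness
  follows because the integrand is positive on a whole interval.\<close>

lemma J_pos:
  assumes n: "n \<ge> 3"
  obtains Y where "Y \<ge> 1" "J_tail n Y + J_bulk n Y > 0"
proof -
  obtain Y where Y: "Y \<ge> 1" and pos: "\<And>x. x \<ge> Y \<Longrightarrow>
      (beta_coeff n)\<^sup>2 * (x ^ n - real n * x ^ (n - 1)) - P_poly n x + 1 > 0"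
    using P_poly_deficit_pos[OF n] by blast
  define b where "b = (beta_coeff n)\<^sup>2"
  \<comment> \<open>Chosen for three properties: \<open>E\<close> vanishes at \<open>Y\<close>, its
    derivative is \<open>exp (- x)\<close>, and the minimum in \<open>J_bulk\<close> equals
    \<open>exp (- Y)\<close> minus \<open>E\<close> on \<open>x > Y\<close>. The constant part drops
    out since \<open>Pe\<close> has integral zero.\<close>
  define E where "E x = exp (- Y) - exp (- x)" for x :: real
  define Pe where "Pe x = indicator {0..} x * ((P_poly n x - 1) * exp (- x))" for x
  have [measurable]: "E \<in> borel_measurable borel" unfolding E_def by measurable
  have hP: "has_bochner_integral lborel Pe (1 - 1)"
    using has_bochner_integral_diff[OF has_bochner_integral_P_poly_exp[of n] has_bochner_integral_power_exp[of 0]]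
    unfolding Pe_def by (simp add: algebra_simps)
  have iP: "integrable lborel Pe" using hP by (rule integrable.intros)
  have P0: "(LINT x|lborel. Pe x) = 0" using hP by (simp add: has_bochner_integral_integral_eq)
  have Eb: "\<bar>indicator {Y<..} x * E x\<bar> \<le> 1" for x
    using Y by (auto simp: E_def split: split_indicator intro: order_trans[of _ "exp (- Y)"])
  have iE: "integrable lborel (\<lambda>x. (indicator {Y<..} x * E x) * f x)" if "integrable lborel f" for f
    by (rule integrable_bounded_mult[where B = 1, OF that _ Eb]) measurable
  have iEp: "integrable lborel (\<lambda>x. indicator {Y<..} x * (E x * (x ^ k * exp (- x))))" for k
  proof -
    have "integrable lborel (\<lambda>x. (indicator {Y<..} x * E x) * (indicator {0..} x * (x ^ k * exp (- x))))"
      by (rule iE[OF has_bochner_integral_power_exp[THEN integrable.intros]])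
    also have "(\<lambda>x. (indicator {Y<..} x * E x) * (indicator {0..} x * (x ^ k * exp (- x))))
       = (\<lambda>x. indicator {Y<..} x * (E x * (x ^ k * exp (- x))))"
      using Y by (auto simp: fun_eq_iff split: split_indicator)
    finally show ?thesis .
  qed
  have bulk: "J_bulk n Y = - (LINT x|lborel. (indicator {Y<..} x * E x) * Pe x)"
  proof -
    have "J_bulk n Y = (LINT x|lborel. exp (- Y) * Pe x - (indicator {Y<..} x * E x) * Pe x)"
      unfolding J_bulk_def
      by (intro Bochner_Integration.integral_cong refl)
         (auto simp: Pe_def E_def min_def algebra_simps split: split_indicator)
    also have "\<dots> = exp (- Y) * (LINT x|lborel. Pe x) - (LINT x|lborel. (indicator {Y<..} x * E x) * Pe x)"
      using iP iE[OF iP] by simp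
    finally show ?thesis by (simp add: P0)
  qed
  \<comment> \<open>Integration by parts: in \<open>J_tail\<close> one of the two exponentials is
    the derivative of \<open>E\<close>. \<open>F\<close> vanishes at \<open>Y\<close> and at
    infinity, so there is no boundary term.\<close>
  define F where "F x = E x * (x ^ n * exp (- x))" for x
  define g where "g x = exp (- x) * (x ^ n * exp (- x))
      + E x * (real n * x ^ (n - 1) * exp (- x) - x ^ n * exp (- x))" for x
  have FD: "(F has_real_derivative g x) (at x)" for x
    unfolding F_def E_def g_def by (auto intro!: derivative_eq_intros simp: algebra_simps)
  have ig: "integrable lborel (\<lambda>x. indicator {Y<..} x * (x ^ n * exp (- x) * exp (- x))
      + (real n * (indicator {Y<..} x * (E x * (x ^ (n - 1) * exp (- x)))) - indicator {Y<..} x * (E x * (x ^ n * exp (- x)))))"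
    using Y by (intro Bochner_Integration.integrable_add Bochner_Integration.integrable_diff
        integrable_mult_right iEp integrable_J_tail) auto
  have ge: "indicator {Y<..} x * g x = indicator {Y<..} x * (x ^ n * exp (- x) * exp (- x))
      + (real n * (indicator {Y<..} x * (E x * (x ^ (n - 1) * exp (- x)))) - indicator {Y<..} x * (E x * (x ^ n * exp (- x))))" for x
    by (simp add: g_def algebra_simps)
  have "(F \<longlongrightarrow> 0) at_top" unfolding F_def E_def by real_asymp
  moreover have "continuous_on UNIV g"
    unfolding g_def E_def by (intro continuous_intros)
  ultimately have "(LINT x|lborel. indicator {Y<..} x * g x) = - F Y"
    using ig by (intro integral_Ioi_deriv FD) (simp_all only: ge)
  then have "(LINT x|lborel. indicator {Y<..} x * (x ^ n * exp (- x) * exp (- x)))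
      + (real n * (LINT x|lborel. indicator {Y<..} x * (E x * (x ^ (n - 1) * exp (- x))))
         - (LINT x|lborel. indicator {Y<..} x * (E x * (x ^ n * exp (- x))))) = 0"
    unfolding ge using Y integrable_J_tail[of Y n] iEp by (simp add: F_def E_def)
  then have tail: "J_tail n Y = b * ((LINT x|lborel. indicator {Y<..} x * (E x * (x ^ n * exp (- x))))
      - real n * (LINT x|lborel. indicator {Y<..} x * (E x * (x ^ (n - 1) * exp (- x)))))"
    unfolding J_tail_def b_def[symmetric] by (intro arg_cong[where f = "\<lambda>x. b * x"]) linarith
  define H where "H x = b * (indicator {Y<..} x * (E x * (x ^ n * exp (- x)))
      - real n * (indicator {Y<..} x * (E x * (x ^ (n - 1) * exp (- x)))))
      - (indicator {Y<..} x * E x) * Pe x" for x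
  have iH: "integrable lborel H"
    unfolding H_def by (intro Bochner_Integration.integrable_diff integrable_mult_right iEp iE iP)
  have JH: "J_tail n Y + J_bulk n Y = (LINT x|lborel. H x)"
    unfolding tail bulk H_def using iEp iE[OF iP] by simp
  have He: "H x = indicator {Y<..} x * (E x * exp (- x) *
      (b * (x ^ n - real n * x ^ (n - 1)) - P_poly n x + 1))" for x
    using Y by (auto simp: H_def Pe_def algebra_simps split: split_indicator)
  have Hpos: "H x > 0" if "x > Y" for x
    using that pos[of x] unfolding He b_def by (simp add: E_def)
  have H0: "H x \<ge> 0" for x
    using Hpos[of x] by (cases "x > Y") (auto simp: He)
  have "(LINT x|lborel. H x) \<noteq> 0"
  proof
    assume "(LINT x|lborel. H x) = 0"
    then have "AE x in lborel. H x = 0"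
      using integral_nonneg_eq_0_iff_AE[OF iH] H0 by simp
    then have "AE x in lborel. x \<notin> {Y<..<Y + 1}"
      by eventually_elim (use Hpos in force)
    then have "{Y<..<Y + 1} \<in> null_sets lborel"
      by (subst AE_iff_null_sets) auto
    then show False by (simp add: null_sets_def)
  qed
  moreover have "(LINT x|lborel. H x) \<ge> 0" using H0 by (intro integral_nonneg_AE) auto
  ultimately have "(LINT x|lborel. H x) > 0" by simp
  then show ?thesis using that[OF Y] by (simp add: JH)
qed

text \<open>The integrand is at most \<open>fact n\<close>, and \<open>fact n\<close> times the
  squared \<open>beta_coeff n\<close> is \<open>2 ^ n\<close>. This bounds the price of moving the
  cutoff away from the kink.\<close>

lemma J_tail_shift:
  assumes "Y \<ge> 0" "\<eta> > 0"
  shows "J_tail n Y \<le> J_tail n (Y + \<eta>) + 2 ^ n * \<eta>"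
proof -
  let ?f = "\<lambda>x. x ^ n * exp (- x) * exp (- x) :: real"
  have "(LINT x|lborel. indicator {Y<..} x * ?f x)
      \<le> (LINT x|lborel. indicator {Y + \<eta><..} x * ?f x + fact n * indicator {Y..Y + \<eta>} x)"
  proof (intro integral_mono integrable_J_tail Bochner_Integration.integrable_add integrable_mult_right)
    show "integrable lborel (indicat_real {Y..Y + \<eta>})" by (rule integrable_real_indicator) (use assms in auto)
    fix x
    have "?f x \<le> fact n" if "x > Y"
    proof -
      have "?f x \<le> x ^ n * exp (- x) * 1" using that assms by (intro mult_left_mono) auto
      also have "\<dots> \<le> fact n" using power_exp_le_fact[of x n] that assms by simp
      finally show ?thesis .
    qed
    then show "indicator {Y<..} x * ?f x \<le> indicator {Y + \<eta><..} x * ?f x + fact n * indicator {Y..Y + \<eta>} x"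
      using assms by (auto split: split_indicator)
  qed (use assms in auto)
  also have "\<dots> = (LINT x|lborel. indicator {Y + \<eta><..} x * ?f x) + fact n * \<eta>"
    using assms integrable_J_tail[of "Y + \<eta>" n] by simp
  finally have "J_tail n Y \<le> (beta_coeff n)\<^sup>2 * ((LINT x|lborel. indicator {Y + \<eta><..} x * ?f x) + fact n * \<eta>)"
    unfolding J_tail_def by (rule mult_left_mono) simp
  also have "\<dots> = J_tail n (Y + \<eta>) + 2 ^ n * \<eta>"
    unfolding J_tail_def by (simp add: beta_coeff_square distrib_left)
  finally show ?thesis .
qed

section \<open>Integrals of the Wigner functions\<close>

definition vac_fun :: "real \<times> real \<Rightarrow> real" where
  "vac_fun r = exp (- (norm r)\<^sup>2) / pi"

definition fock_fun :: "nat \<Rightarrow> real \<times> real \<Rightarrow> real" where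
  "fock_fun n r = P_poly n ((norm r)\<^sup>2) * exp (- (norm r)\<^sup>2) / pi"

text \<open>The real part of the Wigner transform of the coherence between \<open>fock 0\<close> and
  \<open>fock n\<close>; its conjugate doubles it in the state.\<close>

definition cross_fun :: "nat \<Rightarrow> real \<times> real \<Rightarrow> real" where
  "cross_fun n r = beta_coeff n * Re (plane_complex r ^ n) * exp (- (norm r)\<^sup>2) / pi"

definition thermal_fun :: "real \<Rightarrow> real \<times> real \<Rightarrow> real" where
  "thermal_fun \<nu> r = exp (- (norm r)\<^sup>2 / s_par \<nu>) / (s_par \<nu> * pi)"

lemma measurable_wigner_funs [measurable]:
  "vac_fun \<in> borel_measurable borel" "fock_fun n \<in> borel_measurable borel"
  "cross_fun n \<in> borel_measurable borel" "thermal_fun \<nu> \<in> borel_measurable borel"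
  unfolding vac_fun_def [abs_def] fock_fun_def [abs_def] cross_fun_def [abs_def] thermal_fun_def [abs_def]
  by measurable

lemma vacuum_wigner_eq_vac_fun: "vacuum_wigner = vac_fun"
proof
  fix r show "vacuum_wigner r = vac_fun r"
    by (cases r) (simp add: vacuum_wigner_eq vac_fun_def norm_square_plane)
qed

lemma wigner_rho_eq_funs:
  assumes "\<nu> > 0" "\<bar>\<epsilon>\<bar> \<le> 1"
  shows "wigner (rho n \<nu> K \<epsilon>) r =
    (1 - delta n \<nu> K \<epsilon>) * ((1 - \<epsilon>\<^sup>2) * vac_fun r + \<epsilon>\<^sup>2 * fock_fun n r
      + 2 * \<epsilon> * sqrt (1 - \<epsilon>\<^sup>2) * cross_fun n r) + delta n \<nu> K \<epsilon> * thermal_fun \<nu> r"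
proof (cases r)
  case (Pair q p)
  show ?thesis
    unfolding Pair wigner_rho_eq[OF assms] psi_wigner_def vac_fun_def fock_fun_def cross_fun_def
      thermal_fun_def norm_square_plane plane_complex_def fst_conv snd_conv
    by (simp add: field_simps)
qed

lemma has_bochner_integral_radial_plane:
  fixes f :: "real \<Rightarrow> real"
  assumes "f \<in> borel_measurable borel" "has_bochner_integral lborel (\<lambda>x. indicator {0..} x * f x) I"
  shows "has_bochner_integral lborel (\<lambda>r :: real \<times> real. f ((norm r)\<^sup>2)) (pi * I)"
  using radial_integral_plane[OF assms(1)] assms(2)
  by (simp add: has_bochner_integral_iff)

lemma has_bochner_integral_vac_fun: "has_bochner_integral lborel vac_fun 1"
proof -
  have "has_bochner_integral lborel (\<lambda>r :: real \<times> real. exp (- (norm r)\<^sup>2)) (pi * 1)"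
    using has_bochner_integral_radial_plane[of "\<lambda>x. exp (- x)" 1] has_bochner_integral_power_exp[of 0] by simp
  from has_bochner_integral_divide_zero[OF this, of pi] show ?thesis
    unfolding vac_fun_def [abs_def] by simp
qed

lemma has_bochner_integral_fock_fun: "has_bochner_integral lborel (fock_fun n) 1"
proof -
  have "has_bochner_integral lborel (\<lambda>r :: real \<times> real. P_poly n ((norm r)\<^sup>2) * exp (- (norm r)\<^sup>2)) (pi * 1)"
    using has_bochner_integral_radial_plane[of "\<lambda>x. P_poly n x * exp (- x)" 1] has_bochner_integral_P_poly_exp[of n] by simp
  from has_bochner_integral_divide_zero[OF this, of pi] show ?thesis
    unfolding fock_fun_def [abs_def] by simp
qed

lemma s_par_gt_1: "\<nu> > 0 \<Longrightarrow> s_par \<nu> > 1"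
  by (simp add: s_par_def)

lemma has_bochner_integral_thermal_fun:
  assumes "\<nu> > 0"
  shows "has_bochner_integral lborel (thermal_fun \<nu>) 1"
proof -
  let ?s = "s_par \<nu>"
  have s: "?s > 0" using s_par_gt_1[OF assms] by simp
  have "has_bochner_integral lborel (\<lambda>x. indicator {0..} x * exp (- x) :: real) 1"
    using has_bochner_integral_power_exp[of 0] by simp
  from lborel_has_bochner_integral_real_affine_iff[of "1 / ?s" _ 1 0, THEN iffD1, OF _ this]
  have "has_bochner_integral lborel (\<lambda>x. indicator {0..} x * exp (- x / ?s)) ?s"
    using s by (simp add: indicator_def zero_le_divide_iff)
  then have "has_bochner_integral lborel (\<lambda>r :: real \<times> real. exp (- (norm r)\<^sup>2 / ?s)) (pi * ?s)"
    using has_bochner_integral_radial_plane[of "\<lambda>x. exp (- x / ?s)" ?s] by simp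
  from has_bochner_integral_divide_zero[OF this, of "?s * pi"] show ?thesis
    unfolding thermal_fun_def [abs_def] using s by (simp add: mult.commute)
qed

lemma abs_Re_plane_complex_power: "\<bar>Re (plane_complex r ^ n)\<bar> \<le> norm r ^ n"
  using abs_Re_le_cmod[of "plane_complex r ^ n"] by (simp add: norm_power)

lemma power_le_1_add_square: "(t :: real) ^ n \<le> 1 + (t\<^sup>2) ^ n"
proof -
  have "0 \<le> (t ^ n - 1)\<^sup>2 + (t ^ n)\<^sup>2 + 1" by simp
  then have "2 * t ^ n \<le> 2 + 2 * (t ^ n)\<^sup>2" by (simp add: power2_eq_square algebra_simps)
  then show ?thesis by (simp add: power_mult[symmetric] mult.commute)
qed

text \<open>For odd \<open>n\<close> the modulus is a half-integer power of the squared norm;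
  bounding it by \<open>1 + x ^ n\<close> leaves only integer moments.\<close>

lemma abs_cross_fun_le:
  "\<bar>cross_fun n r\<bar> \<le> beta_coeff n * ((1 + ((norm r)\<^sup>2) ^ n) * exp (- (norm r)\<^sup>2))"
proof -
  have "\<bar>cross_fun n r\<bar> = beta_coeff n * (\<bar>Re (plane_complex r ^ n)\<bar> * exp (- (norm r)\<^sup>2)) * (1 / pi)"
    using beta_coeff_pos[of n] by (simp add: cross_fun_def abs_mult)
  also have "\<dots> \<le> beta_coeff n * ((1 + ((norm r)\<^sup>2) ^ n) * exp (- (norm r)\<^sup>2)) * 1"
    using beta_coeff_pos[of n] pi_ge_two
      order_trans[OF abs_Re_plane_complex_power power_le_1_add_square, of r n]
    by (intro mult_mono) (auto intro!: mult_nonneg_nonneg)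
  finally show ?thesis by simp
qed

text \<open>Uniformity in \<open>r\<close> makes the interference of order \<epsilon> everywhere,
  which keeps the state below the kink outside a fixed disc.\<close>

lemma cross_fun_bound: "\<bar>cross_fun n r\<bar> \<le> beta_coeff n * (1 + fact n)"
proof -
  have "(1 + ((norm r)\<^sup>2) ^ n) * exp (- (norm r)\<^sup>2) \<le> 1 + fact n"
    using power_exp_le_fact[of "(norm r)\<^sup>2" n] by (simp add: distrib_right add_mono)
  then show ?thesis
    using beta_coeff_pos[of n] by (intro order_trans[OF abs_cross_fun_le] mult_left_mono) auto
qed

lemma integrable_cross_fun: "integrable lborel (cross_fun n)"
proof -
  have "integrable lborel (\<lambda>r :: real \<times> real. (1 + ((norm r)\<^sup>2) ^ n) * exp (- (norm r)\<^sup>2))"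
    using has_bochner_integral_radial_plane[of "\<lambda>x. (1 + x ^ n) * exp (- x)" "fact 0 + fact n"]
      has_bochner_integral_add[OF has_bochner_integral_power_exp[of 0] has_bochner_integral_power_exp[of n]]
    by (simp add: algebra_simps has_bochner_integral_iff)
  from integrable_mult_right[OF this, of "beta_coeff n"] show ?thesis
    by (rule Bochner_Integration.integrable_bound)
       (auto intro!: AE_I2 order_trans[OF abs_cross_fun_le])
qed

lemma integral_radial_cross_fun:
  assumes [measurable]: "G \<in> borel_measurable borel" and n: "n \<ge> 2"
  shows "(LINT r|lborel. G ((norm r)\<^sup>2) * cross_fun n r) = 0"
proof -
  have "(LINT r|lborel. G ((norm r)\<^sup>2) * cross_fun n r)
     = (LINT r|lborel. (beta_coeff n / pi * G ((norm r)\<^sup>2) * exp (- (norm r)\<^sup>2)) * Re (plane_complex r ^ n))"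
    by (intro Bochner_Integration.integral_cong refl) (simp add: cross_fun_def)
  also have "\<dots> = 0"
    using n by (intro integral_radial_Re_power[of "\<lambda>x. beta_coeff n / pi * G x * exp (- x)"]) measurable
  finally show ?thesis .
qed

lemma integral_cross_fun_square:
  assumes Y: "Y \<ge> 0" and n: "n \<ge> 1"
  shows "integrable lborel (\<lambda>r. indicator {Y<..} ((norm r)\<^sup>2) * (cross_fun n r)\<^sup>2)"
    and "(LINT r|lborel. indicator {Y<..} ((norm r)\<^sup>2) * (cross_fun n r)\<^sup>2) = J_tail n Y / (2 * pi)"
proof -
  define G where "G x = indicator {Y<..} x * (exp (- x) * exp (- x))" for x :: real
  have [measurable]: "G \<in> borel_measurable borel" unfolding G_def by measurable
  have ind: "indicator {0..} x * (G x * x ^ n) = indicator {Y<..} x * (x ^ n * exp (- x) * exp (- x))" for x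
    using Y by (auto simp: G_def split: split_indicator)
  have int: "integrable lborel (\<lambda>r :: real \<times> real. G ((norm r)\<^sup>2) * ((norm r)\<^sup>2) ^ n)"
    using radial_integral_plane(1)[of "\<lambda>x. G x * x ^ n"] integrable_J_tail[OF Y, of n] unfolding ind by simp
  have e: "indicator {Y<..} ((norm r)\<^sup>2) * (cross_fun n r)\<^sup>2
      = (beta_coeff n)\<^sup>2 / pi\<^sup>2 * (G ((norm r)\<^sup>2) * (Re (plane_complex r ^ n))\<^sup>2)" for r
    by (simp add: cross_fun_def G_def power_mult_distrib power_divide power2_eq_square mult_ac)
  show "integrable lborel (\<lambda>r. indicator {Y<..} ((norm r)\<^sup>2) * (cross_fun n r)\<^sup>2)"
    unfolding e by (intro integrable_mult_right integral_radial_Re_power_square(1) n int) measurable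
  have "(LINT r|lborel. indicator {Y<..} ((norm r)\<^sup>2) * (cross_fun n r)\<^sup>2)
      = (beta_coeff n)\<^sup>2 / pi\<^sup>2 * ((LINT r|lborel. G ((norm (r :: real \<times> real))\<^sup>2) * ((norm r)\<^sup>2) ^ n) / 2)"
    unfolding e integral_mult_right_zero by (subst integral_radial_Re_power_square(2)[OF _ n int]) simp_all
  also have "(LINT r|lborel. G ((norm (r :: real \<times> real))\<^sup>2) * ((norm r)\<^sup>2) ^ n)
      = pi * (LINT x|lborel. indicator {Y<..} x * (x ^ n * exp (- x) * exp (- x)))"
    using radial_integral_plane(2)[of "\<lambda>x. G x * x ^ n"] unfolding ind by simp
  finally show "(LINT r|lborel. indicator {Y<..} ((norm r)\<^sup>2) * (cross_fun n r)\<^sup>2) = J_tail n Y / (2 * pi)"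
    by (simp add: J_tail_def power2_eq_square)
qed

lemma integral_min_vac_fun_fock_fun:
  "(LINT r|lborel. min (vac_fun r) (exp (- Y) / pi) * (fock_fun n r - vac_fun r)) = J_bulk n Y / pi"
proof -
  let ?f = "\<lambda>x. min (exp (- x)) (exp (- Y)) * ((P_poly n x - 1) * exp (- x))"
  have "(LINT r|lborel. min (vac_fun r) (exp (- Y) / pi) * (fock_fun n r - vac_fun r))
      = (LINT r|lborel. ?f ((norm (r :: real \<times> real))\<^sup>2) / pi\<^sup>2)"
  proof (intro Bochner_Integration.integral_cong refl)
    fix r :: "real \<times> real"
    have m: "min (vac_fun r) (exp (- Y) / pi) = min (exp (- (norm r)\<^sup>2)) (exp (- Y)) / pi"
      unfolding vac_fun_def by (simp add: min_def divide_le_cancel)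
    show "min (vac_fun r) (exp (- Y) / pi) * (fock_fun n r - vac_fun r) = ?f ((norm r)\<^sup>2) / pi\<^sup>2"
      unfolding m by (simp add: fock_fun_def vac_fun_def power2_eq_square field_simps)
  qed
  also have "\<dots> = pi * J_bulk n Y / pi\<^sup>2"
    using radial_integral_plane(2)[of ?f] by (simp add: J_bulk_def)
  finally show ?thesis by (simp add: power2_eq_square)
qed

lemma fock_fun_bound: "\<exists>B. \<forall>r. \<bar>fock_fun n r\<bar> \<le> B"
proof (intro exI allI)
  fix r :: "real \<times> real"
  let ?x = "(norm r)\<^sup>2"
  have "\<bar>fock_fun n r\<bar> = \<bar>\<Sum>k\<le>n. P_coeff n k * (?x ^ k * exp (- ?x))\<bar> * (1 / pi)"
    by (simp add: fock_fun_def P_poly_eq sum_distrib_right abs_divide mult.assoc)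
  also have "\<dots> \<le> (\<Sum>k\<le>n. \<bar>P_coeff n k\<bar> * fact k) * 1"
  proof (intro mult_mono)
    have "\<bar>\<Sum>k\<le>n. P_coeff n k * (?x ^ k * exp (- ?x))\<bar> \<le> (\<Sum>k\<le>n. \<bar>P_coeff n k * (?x ^ k * exp (- ?x))\<bar>)"
      by (rule sum_abs)
    also have "\<dots> \<le> (\<Sum>k\<le>n. \<bar>P_coeff n k\<bar> * fact k)"
      by (intro sum_mono) (simp add: abs_mult mult_left_mono power_exp_le_fact)
    finally show "\<bar>\<Sum>k\<le>n. P_coeff n k * (?x ^ k * exp (- ?x))\<bar> \<le> (\<Sum>k\<le>n. \<bar>P_coeff n k\<bar> * fact k)" .
  qed (use pi_ge_two in \<open>auto intro!: sum_nonneg\<close>)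
  finally show "\<bar>fock_fun n r\<bar> \<le> (\<Sum>k\<le>n. \<bar>P_coeff n k\<bar> * fact k)" by simp
qed

lemma vac_fun_bounds: "0 \<le> vac_fun r" "vac_fun r \<le> 1"
proof -
  show "0 \<le> vac_fun r" by (simp add: vac_fun_def)
  have "vac_fun r \<le> 1 / 1"
    unfolding vac_fun_def using pi_ge_two by (intro frac_le) auto
  then show "vac_fun r \<le> 1" by simp
qed

lemma thermal_fun_bounds:
  assumes "\<nu> > 0"
  shows "0 \<le> thermal_fun \<nu> r" "thermal_fun \<nu> r \<le> 1"
proof -
  have s: "s_par \<nu> > 1" by (rule s_par_gt_1[OF assms])
  then show "0 \<le> thermal_fun \<nu> r" by (simp add: thermal_fun_def)
  have "1 * 1 \<le> s_par \<nu> * pi" using s pi_ge_two by (intro mult_mono) auto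
  then have "thermal_fun \<nu> r \<le> 1 / 1"
    unfolding thermal_fun_def using s by (intro frac_le) (auto simp: divide_nonpos_pos)
  then show "thermal_fun \<nu> r \<le> 1" by simp
qed

lemma phase_space_density_vacuum: "phase_space_density vac_fun"
  using has_bochner_integral_vac_fun vac_fun_bounds
  by (intro phase_space_densityI) (auto simp: has_bochner_integral_iff)

lemma has_bochner_integral_wigner_rho:
  assumes "\<nu> > 0" "\<bar>\<epsilon>\<bar> \<le> 1" "n \<ge> 2"
  shows "has_bochner_integral lborel (wigner (rho n \<nu> K \<epsilon>)) 1"
proof -
  have "has_bochner_integral lborel (cross_fun n) 0"
    using integrable_cross_fun integral_radial_cross_fun[of "\<lambda>_. 1" n] assms
    by (simp add: has_bochner_integral_iff)
  then have "has_bochner_integral lborel (wigner (rho n \<nu> K \<epsilon>))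
     ((1 - delta n \<nu> K \<epsilon>) * ((1 - \<epsilon>\<^sup>2) * 1 + \<epsilon>\<^sup>2 * 1
      + 2 * \<epsilon> * sqrt (1 - \<epsilon>\<^sup>2) * 0) + delta n \<nu> K \<epsilon> * 1)"
    unfolding wigner_rho_eq_funs[OF assms(1,2), abs_def]
    by (intro has_bochner_integral_add has_bochner_integral_mult_right has_bochner_integral_vac_fun
        has_bochner_integral_fock_fun has_bochner_integral_thermal_fun assms)
  then show ?thesis by simp
qed

text \<open>\<open>trunc_square T y = (\<integral>t. max 0 (y - t))\<close> over \<open>0 < t < T\<close>, so it is convex and its integral
  is monotone under majorization; its derivative is \<open>min y T\<close>.\<close>

definition trunc_square :: "real \<Rightarrow> real \<Rightarrow> real" where
  "trunc_square T y = y * min y T - (min y T)\<^sup>2 / 2"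

lemma measurable_trunc_square [measurable]: "trunc_square T \<in> borel_measurable borel"
  unfolding trunc_square_def [abs_def] by measurable

lemma trunc_square_convex:
  "trunc_square T y \<ge> trunc_square T y0 + min y0 T * (y - y0)"
proof -
  consider "y \<le> T" "y0 \<le> T" | "y > T" "y0 > T" | "y \<le> T" "y0 > T" | "y > T" "y0 \<le> T" by linarith
  then show ?thesis
  proof cases
    case 1
    have "0 \<le> (y - y0)\<^sup>2" by simp
    then show ?thesis using 1 by (simp add: trunc_square_def power2_eq_square algebra_simps)
  next
    case 2
    then show ?thesis by (simp add: trunc_square_def power2_eq_square algebra_simps)
  next
    case 3
    have "0 \<le> (y - T)\<^sup>2" by simp
    then show ?thesis using 3 by (simp add: trunc_square_def power2_eq_square algebra_simps)
  next
    case 4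
    have "0 \<le> (T - y0) * (2 * (y - T) + (T - y0))" using 4 by (intro mult_nonneg_nonneg) auto
    then show ?thesis using 4 by (simp add: trunc_square_def power2_eq_square algebra_simps)
  qed
qed

text \<open>Up to \<open>T\<close> the function is half the square, so its second-order expansion is
  exact. This is the only source of the curvature gain.\<close>

lemma trunc_square_eq:
  assumes "y \<le> T" "y0 \<le> T"
  shows "trunc_square T y = trunc_square T y0 + min y0 T * (y - y0) + (y - y0)\<^sup>2 / 2"
  using assms by (simp add: trunc_square_def power2_eq_square field_simps)

lemma trunc_square_bounds:
  assumes "0 \<le> y" "0 \<le> T"
  shows "0 \<le> trunc_square T y" "trunc_square T y \<le> T * y"
proof -
  have "trunc_square T y = min y T * (y - min y T / 2)"
    by (simp add: trunc_square_def power2_eq_square algebra_simps)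
  moreover have "y - min y T / 2 \<ge> 0" "y - min y T / 2 \<le> y" "0 \<le> min y T" "min y T \<le> T"
    using assms by auto
  ultimately show "0 \<le> trunc_square T y" "trunc_square T y \<le> T * y"
    using assms mult_mono[of "min y T" T "y - min y T / 2" y] by auto
qed

lemma integrable_trunc_square:
  assumes U: "integrable M U" and "\<And>r. 0 \<le> U r" "0 \<le> T"
  shows "integrable M (\<lambda>r. trunc_square T (U r))"
proof (rule Bochner_Integration.integrable_bound[OF integrable_mult_right[OF U, of T]])
  show "(\<lambda>r. trunc_square T (U r)) \<in> borel_measurable M"
    using borel_measurable_integrable[OF U] by measurable
qed (use assms trunc_square_bounds[of _ T] in \<open>auto intro!: AE_I2\<close>)

lemma nn_integral_excess:
  assumes "0 \<le> y" "0 < T"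
  shows "(\<integral>\<^sup>+ t. ennreal (max 0 (y - t)) * indicator {0<..<T} t \<partial>lborel) = ennreal (trunc_square T y)"
proof -
  let ?m = "min y T"
  have "AE t in lborel. t \<noteq> (0 :: real) \<and> t \<noteq> T" using AE_lborel_singleton[of 0] AE_lborel_singleton[of T] by auto
  then have "AE t in lborel. ennreal (max 0 (y - t)) * indicator {0<..<T} t = ennreal (y - t) * indicator {0..?m} t"
  proof eventually_elim
    case (elim t)
    then show ?case by (cases "0 < t \<and> t < T"; cases "t \<le> y") (auto simp: ennreal_neg)
  qed
  then have "(\<integral>\<^sup>+ t. ennreal (max 0 (y - t)) * indicator {0<..<T} t \<partial>lborel)
     = (\<integral>\<^sup>+ t. ennreal (y - t) * indicator {0..?m} t \<partial>lborel)"
    by (rule nn_integral_cong_AE)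
  also have "\<dots> = ennreal ((y * ?m - ?m\<^sup>2 / 2) - (y * 0 - 0\<^sup>2 / 2))"
    using assms by (intro nn_integral_FTC_Icc) (auto intro!: derivative_eq_intros)
  finally show ?thesis by (simp add: trunc_square_def)
qed

text \<open>The excess inequality is integrated over \<open>0 < t < T\<close> and the integrals are
  exchanged by Tonelli. Nonnegative integrals make the comparison in \<open>t\<close> purely
  pointwise.\<close>

lemma cont_majorized_by_imp_integral_trunc_square_le:
  assumes W: "phase_space_density W" and V: "phase_space_density V" and maj: "W \<prec>\<^sub>c V" and T: "T > 0"
    and [measurable]: "W \<in> borel_measurable borel" "V \<in> borel_measurable borel"
  shows "(LINT r|lborel. trunc_square T (W r)) \<le> (LINT r|lborel. trunc_square T (V r))"
proof -
  have layer: "ennreal (LINT r|lborel. trunc_square T (U r))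
      = (\<integral>\<^sup>+ t. ennreal (LINT r|lborel. max 0 (U r - t)) * indicator {0<..<T} t \<partial>lborel)"
    if U: "phase_space_density U" and [measurable]: "U \<in> borel_measurable borel" for U
  proof -
    have U0: "\<And>r. 0 \<le> U r" and Ui: "integrable lborel U"
      using U by (auto simp: phase_space_density_def integrable_completion)
    have i1: "integrable lborel (\<lambda>r. trunc_square T (U r))"
      by (rule integrable_trunc_square[OF Ui U0 less_imp_le[OF T]])
    have i2: "integrable lborel (\<lambda>r. max 0 (U r - t))" if "t > 0" for t
      by (rule Bochner_Integration.integrable_bound[OF Ui])
         (use that U0 in \<open>auto intro!: AE_I2 simp: max_def\<close>)
    have "ennreal (LINT r|lborel. trunc_square T (U r)) = (\<integral>\<^sup>+ r. ennreal (trunc_square T (U r)) \<partial>lborel)"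
      by (rule nn_integral_eq_integral[symmetric, OF i1]) (use U0 T trunc_square_bounds in auto)
    also have "\<dots> = (\<integral>\<^sup>+ r. \<integral>\<^sup>+ t. ennreal (max 0 (U r - t)) * indicator {0<..<T} t \<partial>lborel \<partial>lborel)"
      by (intro nn_integral_cong) (simp only: nn_integral_excess[OF U0 T])
    also have "\<dots> = (\<integral>\<^sup>+ t. \<integral>\<^sup>+ r. ennreal (max 0 (U r - t)) * indicator {0<..<T} t \<partial>lborel \<partial>lborel)"
      by (rule lborel_pair.Fubini'[symmetric]) measurable
    also have "\<dots> = (\<integral>\<^sup>+ t. ennreal (LINT r|lborel. max 0 (U r - t)) * indicator {0<..<T} t \<partial>lborel)"
    proof (intro nn_integral_cong)
      fix t
      have "(\<integral>\<^sup>+ r. ennreal (max 0 (U r - t)) \<partial>lborel) = ennreal (LINT r|lborel. max 0 (U r - t))" if "t > 0"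
        by (rule nn_integral_eq_integral[OF i2[OF that]]) simp
      then show "(\<integral>\<^sup>+ r. ennreal (max 0 (U r - t)) * indicator {0<..<T} t \<partial>lborel)
          = ennreal (LINT r|lborel. max 0 (U r - t)) * indicator {0<..<T} t"
      proof (cases "t \<in> {0<..<T}")
        case False
        then have "indicator {0<..<T} t = (0 :: ennreal)" by simp
        then show ?thesis by (simp only: mult_zero_right nn_integral_const mult_zero_left)
      qed (simp only: indicator_simps mult_1_right greaterThanLessThan_iff)
    qed
    finally show ?thesis .
  qed
  have nn: "0 \<le> (LINT r|lborel. trunc_square T (V r))"
    using V T trunc_square_bounds by (intro integral_nonneg_AE AE_I2) (auto simp: phase_space_density_def)
  have "ennreal (LINT r|lborel. trunc_square T (W r)) \<le> ennreal (LINT r|lborel. trunc_square T (V r))"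
    unfolding layer[OF W \<open>W \<in> _\<close>] layer[OF V \<open>V \<in> _\<close>]
  proof (intro nn_integral_mono)
    fix t
    have "(LINT r|lborel. max 0 (W r - t)) \<le> (LINT r|lborel. max 0 (V r - t))" if "t > 0"
      using cont_majorized_by_imp_integral_excess_le[OF W V maj that] by (simp add: integral_completion)
    then show "ennreal (LINT r|lborel. max 0 (W r - t)) * indicator {0<..<T} t
        \<le> ennreal (LINT r|lborel. max 0 (V r - t)) * indicator {0<..<T} t"
      by (auto split: split_indicator intro: ennreal_leI)
  qed
  then show ?thesis using nn by (simp add: ennreal_le_iff)
qed

section \<open>The tail of the state\<close>

lemma x_minus_at_top:
  assumes "n \<ge> 1"
  shows "filterlim (x_minus n) at_top (at_right 0)"
proof -
  obtain b N M where e: "b = beta_coeff n" "N = real n" "M = 1 + M_const n" by blast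
  have "b > 0" "N > 0" using assms beta_coeff_pos[of n] e by auto
  then have "filterlim (\<lambda>\<epsilon>. ((1 - M * \<epsilon>\<^sup>2) / (2 * \<epsilon> * b)) powr (2 / N)) at_top (at_right 0)"
    by real_asymp
  then show ?thesis unfolding x_minus_def [abs_def] e by simp
qed

lemma eventually_amplitude_pos:
  "\<forall>\<^sub>F \<epsilon> in at_right 0. 0 < 1 - (1 + M_const n) * \<epsilon>\<^sup>2"
proof -
  have "((\<lambda>\<epsilon> :: real. 1 - M * \<epsilon>\<^sup>2) \<longlongrightarrow> 1) (at_right 0)" for M by real_asymp
  then show ?thesis by (rule order_tendstoD) simp
qed

text \<open>The equation that defines \<open>x_minus\<close>: the worst-case interference there
  equals the guaranteed radial part.\<close>

lemma x_minus_powr: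
  assumes "n \<ge> 1" "\<epsilon> > 0" "0 < 1 - (1 + M_const n) * \<epsilon>\<^sup>2"
  shows "2 * \<epsilon> * beta_coeff n * x_minus n \<epsilon> powr (real n / 2) = 1 - (1 + M_const n) * \<epsilon>\<^sup>2"
  using assms beta_coeff_pos[of n] by (simp add: x_minus_def powr_powr)

lemma delta_eq:
  assumes "n \<ge> 1" "\<epsilon> > 0" "0 < 1 - (1 + M_const n) * \<epsilon>\<^sup>2"
  shows "delta n \<nu> K \<epsilon> = K * s_par \<nu> * (1 - (1 + M_const n) * \<epsilon>\<^sup>2) * exp (- c_par \<nu> * x_minus n \<epsilon>)"
  using x_minus_powr[OF assms] by (simp add: delta_def mult_ac)

lemma c_par_pos: "\<nu> > 0 \<Longrightarrow> c_par \<nu> > 0"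
  by (simp add: c_par_def s_par_def)

lemma delta_over_square_tendsto_0:
  assumes "n \<ge> 1" "\<nu> > 0"
  shows "((\<lambda>\<epsilon>. delta n \<nu> K \<epsilon> / \<epsilon>\<^sup>2) \<longlongrightarrow> 0) (at_right 0)"
proof -
  obtain b N M c where e: "b = beta_coeff n" "N = real n" "M = 1 + M_const n" "c = c_par \<nu>" by blast
  have pos: "b > 0" "N > 0" "c > 0" using assms beta_coeff_pos[of n] c_par_pos e by auto
  have "((\<lambda>\<epsilon>. exp (- c * ((1 - M * \<epsilon>\<^sup>2) / (2 * \<epsilon> * b)) powr (2 / N)) / \<epsilon>\<^sup>2) \<longlongrightarrow> 0) (at_right 0)"
    using pos by real_asymp
  moreover have "((\<lambda>\<epsilon>. K * s_par \<nu> * (1 - M * \<epsilon>\<^sup>2)) \<longlongrightarrow> K * s_par \<nu>) (at_right 0)"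
    by real_asymp
  ultimately have "((\<lambda>\<epsilon>. K * s_par \<nu> * (1 - M * \<epsilon>\<^sup>2) *
      (exp (- c * ((1 - M * \<epsilon>\<^sup>2) / (2 * \<epsilon> * b)) powr (2 / N)) / \<epsilon>\<^sup>2)) \<longlongrightarrow> K * s_par \<nu> * 0) (at_right 0)"
    by (rule tendsto_mult[rotated])
  then have "((\<lambda>\<epsilon>. K * s_par \<nu> * (1 - M * \<epsilon>\<^sup>2) *
      (exp (- c * x_minus n \<epsilon>) / \<epsilon>\<^sup>2)) \<longlongrightarrow> 0) (at_right 0)"
    by (simp add: x_minus_def e)
  moreover have "\<forall>\<^sub>F \<epsilon> in at_right 0. K * s_par \<nu> * (1 - M * \<epsilon>\<^sup>2) * (exp (- c * x_minus n \<epsilon>) / \<epsilon>\<^sup>2)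
      = delta n \<nu> K \<epsilon> / \<epsilon>\<^sup>2"
    using eventually_amplitude_pos[of n] eventually_at_right_less[of "0 :: real"]
    by eventually_elim (simp add: delta_eq[OF assms(1)] e)
  ultimately show ?thesis by (rule Lim_transform_eventually)
qed

lemma delta_tendsto_0:
  assumes "n \<ge> 1" "\<nu> > 0"
  shows "(delta n \<nu> K \<longlongrightarrow> 0) (at_right 0)"
proof -
  have "((\<lambda>\<epsilon> :: real. \<epsilon>\<^sup>2) \<longlongrightarrow> 0) (at_right 0)" by real_asymp
  from tendsto_mult[OF delta_over_square_tendsto_0[OF assms, of K] this]
  have "((\<lambda>\<epsilon>. delta n \<nu> K \<epsilon> / \<epsilon>\<^sup>2 * \<epsilon>\<^sup>2) \<longlongrightarrow> 0) (at_right 0)" by simp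
  moreover have "\<forall>\<^sub>F \<epsilon> in at_right 0. delta n \<nu> K \<epsilon> / \<epsilon>\<^sup>2 * \<epsilon>\<^sup>2 = delta n \<nu> K \<epsilon>"
    using eventually_at_right_less[of "0 :: real"] by eventually_elim simp
  ultimately show ?thesis by (rule Lim_transform_eventually)
qed

text \<open>The function decreases beyond its maximum at \<open>\<alpha> / c\<close>; the inequality
  \<open>ln v \<le> v - 1\<close> at \<open>v = y / x\<close> gives this directly. It carries the
  thermal domination from \<open>x_minus\<close> to all larger radii.\<close>

lemma powr_exp_antimono:
  fixes x y \<alpha> c :: real
  assumes "0 < x" "x \<le> y" "0 \<le> \<alpha>" "\<alpha> \<le> c * x"
  shows "y powr \<alpha> * exp (- c * y) \<le> x powr \<alpha> * exp (- c * x)"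
proof -
  have "ln (y / x) \<le> y / x - 1" using assms by (intro ln_le_minus_one) auto
  then have "\<alpha> * ln (y / x) \<le> \<alpha> * ((y - x) / x)"
    using assms by (intro mult_left_mono) (auto simp: diff_divide_distrib)
  also have "\<dots> \<le> (c * x) * ((y - x) / x)"
    using assms by (intro mult_right_mono) auto
  also have "\<dots> = c * y - c * x"
  proof -
    have "x * ((y - x) / x) = y - x" using assms by simp
    then show ?thesis by (simp only: mult.assoc right_diff_distrib)
  qed
  finally have "\<alpha> * ln y + - c * y \<le> \<alpha> * ln x + - c * x"
    using assms by (simp add: ln_div algebra_simps)
  then have "exp (\<alpha> * ln y + - c * y) \<le> exp (\<alpha> * ln x + - c * x)" by simp
  then show ?thesis using assms unfolding exp_add by (simp add: powr_def)
qed

lemma norm_power_eq_powr: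
  assumes "n \<ge> 1"
  shows "norm (r :: real \<times> real) ^ n = (norm r)\<^sup>2 powr (real n / 2)"
proof (cases "norm r = 0")
  case False
  then have "norm r > 0" by simp
  then have "(norm r)\<^sup>2 powr (real n / 2) = (norm r powr 2) powr (real n / 2)"
    by simp
  also have "\<dots> = norm r ^ n"
    using \<open>norm r > 0\<close> unfolding powr_powr by (simp add: powr_realpow)
  finally show ?thesis ..
qed (use assms in auto)

text \<open>\<open>A\<close> bounds the radial part from below through \<open>M_const\<close>, and
  \<open>g\<close> is the worst case of the interference. Inside \<open>x_minus\<close> one has
  \<open>g \<le> A\<close>; outside, \<open>A\<close> is discarded and the fraction
  \<open>1 / K\<close> of the thermal term pays for \<open>g\<close>.\<close>

lemma wigner_rho_lower_bounds:
  assumes n: "n \<ge> 1" and \<nu>: "\<nu> > 0" and K: "K > 1" and \<epsilon>: "0 < \<epsilon>" "\<epsilon> < 1"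
    and a: "0 < 1 - (1 + M_const n) * \<epsilon>\<^sup>2"
    and \<delta>: "0 \<le> delta n \<nu> K \<epsilon>" "delta n \<nu> K \<epsilon> \<le> 1"
    and x: "0 < x_minus n \<epsilon>" "real n / 2 \<le> c_par \<nu> * x_minus n \<epsilon>"
  shows "wigner (rho n \<nu> K \<epsilon>) r \<ge> 0"
    and "(norm r)\<^sup>2 \<ge> x_minus n \<epsilon> \<Longrightarrow>
      wigner (rho n \<nu> K \<epsilon>) r \<ge> (1 - 1 / K) * delta n \<nu> K \<epsilon> * thermal_fun \<nu> r"
proof -
  define A where "A = 1 - (1 + M_const n) * \<epsilon>\<^sup>2"
  define \<delta>' where "\<delta>' = delta n \<nu> K \<epsilon>"
  define g where "g = 2 * \<epsilon> * beta_coeff n * norm r ^ n"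
  define u where "u = sqrt (1 - \<epsilon>\<^sup>2)"
  have \<epsilon>2: "\<epsilon>\<^sup>2 \<le> 1" using \<epsilon> by (simp add: power_le_one)
  have u: "0 \<le> u" "u \<le> 1" using \<epsilon>2 by (auto simp: u_def)
  have g0: "g \<ge> 0" using \<epsilon> beta_coeff_pos[of n] by (simp add: g_def)
  have fock: "fock_fun n r \<ge> - M_const n * vac_fun r"
  proof -
    have "P_poly n ((norm r)\<^sup>2) \<ge> - M_const n" by (rule M_const_ge[OF _ n]) simp
    then have "- M_const n * vac_fun r \<le> P_poly n ((norm r)\<^sup>2) * vac_fun r"
      by (rule mult_right_mono) (rule vac_fun_bounds)
    then show ?thesis by (simp add: fock_fun_def vac_fun_def)
  qed
  have cross: "2 * \<epsilon> * u * cross_fun n r \<ge> - g * vac_fun r"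
  proof -
    have "- (2 * \<epsilon> * u * cross_fun n r) \<le> 2 * \<epsilon> * u * (beta_coeff n * norm r ^ n * vac_fun r)"
    proof -
      have "- Re (plane_complex r ^ n) \<le> norm r ^ n"
        using abs_Re_plane_complex_power[of r n] by linarith
      then have "beta_coeff n * (- Re (plane_complex r ^ n)) * vac_fun r \<le> beta_coeff n * norm r ^ n * vac_fun r"
        using beta_coeff_pos[of n] vac_fun_bounds(1)[of r] by (intro mult_right_mono mult_left_mono) auto
      then have "- cross_fun n r \<le> beta_coeff n * norm r ^ n * vac_fun r"
        by (simp add: cross_fun_def vac_fun_def)
      then have "2 * \<epsilon> * u * (- cross_fun n r) \<le> 2 * \<epsilon> * u * (beta_coeff n * norm r ^ n * vac_fun r)"
        using \<epsilon> u by (intro mult_left_mono) auto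
      then show ?thesis by simp
    qed
    also have "\<dots> = u * (g * vac_fun r)" by (simp add: g_def)
    also have "\<dots> \<le> 1 * (g * vac_fun r)"
      using u g0 vac_fun_bounds(1)[of r] by (intro mult_right_mono) auto
    finally show ?thesis by simp
  qed
  have pure: "(1 - \<epsilon>\<^sup>2) * vac_fun r + \<epsilon>\<^sup>2 * fock_fun n r + 2 * \<epsilon> * u * cross_fun n r \<ge> (A - g) * vac_fun r"
  proof -
    have "\<epsilon>\<^sup>2 * fock_fun n r \<ge> \<epsilon>\<^sup>2 * (- M_const n * vac_fun r)"
      using fock by (intro mult_left_mono) auto
    with cross show ?thesis by (simp add: A_def algebra_simps)
  qed
  have W: "wigner (rho n \<nu> K \<epsilon>) r \<ge> (1 - \<delta>') * ((A - g) * vac_fun r) + \<delta>' * thermal_fun \<nu> r"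
    unfolding wigner_rho_eq_funs[OF \<nu> less_imp_le[of "\<bar>\<epsilon>\<bar>" 1], unfolded abs_of_pos[OF \<epsilon>(1)], OF \<epsilon>(2)]
      \<delta>'_def[symmetric] u_def[symmetric]
    using mult_left_mono[OF pure, of "1 - \<delta>'"] \<delta> by (simp add: \<delta>'_def)
  have gx: "g = 2 * \<epsilon> * beta_coeff n * (norm r)\<^sup>2 powr (real n / 2)"
    by (simp add: g_def norm_power_eq_powr[OF n])
  have tail: "wigner (rho n \<nu> K \<epsilon>) r \<ge> (1 - 1 / K) * \<delta>' * thermal_fun \<nu> r" if "(norm r)\<^sup>2 \<ge> x_minus n \<epsilon>"
  proof -
    have s: "s_par \<nu> > 0" using s_par_gt_1[OF \<nu>] by simp
    \<comment> \<open>Relative to the thermal Gaussian the vacuum one decays with rate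
      \<open>c_par \<nu>\<close>, because \<open>c_par \<nu> + 1 / s_par \<nu> = 1\<close>. The
      right-hand side is the quantity from which \<open>delta\<close> was built.\<close>
    have "(norm r)\<^sup>2 powr (real n / 2) * exp (- c_par \<nu> * (norm r)\<^sup>2)
        \<le> x_minus n \<epsilon> powr (real n / 2) * exp (- c_par \<nu> * x_minus n \<epsilon>)"
      using x that by (intro powr_exp_antimono) auto
    then have "2 * \<epsilon> * beta_coeff n * ((norm r)\<^sup>2 powr (real n / 2) * exp (- c_par \<nu> * (norm r)\<^sup>2))
        \<le> 2 * \<epsilon> * beta_coeff n * (x_minus n \<epsilon> powr (real n / 2) * exp (- c_par \<nu> * x_minus n \<epsilon>))"
      using \<epsilon> beta_coeff_pos[of n] by (intro mult_left_mono) auto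
    also have "\<dots> = \<delta>' / (K * s_par \<nu>)"
      using K s by (simp add: \<delta>'_def delta_def)
    finally have "g * exp (- c_par \<nu> * (norm r)\<^sup>2) \<le> \<delta>' / (K * s_par \<nu>)"
      by (simp add: gx mult.assoc)
    then have "g * exp (- c_par \<nu> * (norm r)\<^sup>2) * (exp (- (norm r)\<^sup>2 / s_par \<nu>) / pi)
        \<le> \<delta>' / (K * s_par \<nu>) * (exp (- (norm r)\<^sup>2 / s_par \<nu>) / pi)"
      by (rule mult_right_mono) simp
    also have "g * exp (- c_par \<nu> * (norm r)\<^sup>2) * (exp (- (norm r)\<^sup>2 / s_par \<nu>) / pi) = g * vac_fun r"
    proof -
      have "- c_par \<nu> * (norm r)\<^sup>2 + - (norm r)\<^sup>2 / s_par \<nu> = - (norm r)\<^sup>2"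
        by (simp add: c_par_def algebra_simps)
      then have "exp (- c_par \<nu> * (norm r)\<^sup>2) * exp (- (norm r)\<^sup>2 / s_par \<nu>) = exp (- (norm r)\<^sup>2)"
        by (simp only: exp_add[symmetric])
      then show ?thesis by (simp add: vac_fun_def)
    qed
    also have "\<delta>' / (K * s_par \<nu>) * (exp (- (norm r)\<^sup>2 / s_par \<nu>) / pi) = 1 / K * \<delta>' * thermal_fun \<nu> r"
      by (simp add: thermal_fun_def)
    finally have gv: "g * vac_fun r \<le> 1 / K * \<delta>' * thermal_fun \<nu> r" .
    \<comment> \<open>The factor \<open>1 - \<delta>'\<close> only weakens the negative term, so it
      may be replaced by 1 there.\<close>
    have "(1 - \<delta>') * ((A - g) * vac_fun r) \<ge> - (g * vac_fun r)"
    proof -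
      have "(1 - \<delta>') * (A * vac_fun r) \<ge> 0" "\<delta>' * (g * vac_fun r) \<ge> 0"
        using \<delta> a g0 vac_fun_bounds(1)[of r] by (auto simp: \<delta>'_def A_def intro!: mult_nonneg_nonneg)
      then show ?thesis by (simp add: algebra_simps)
    qed
    with W gv show ?thesis by (simp add: algebra_simps)
  qed
  then show "(norm r)\<^sup>2 \<ge> x_minus n \<epsilon> \<Longrightarrow>
      wigner (rho n \<nu> K \<epsilon>) r \<ge> (1 - 1 / K) * delta n \<nu> K \<epsilon> * thermal_fun \<nu> r"
    by (simp add: \<delta>'_def)
  show "wigner (rho n \<nu> K \<epsilon>) r \<ge> 0"
  proof (cases "(norm r)\<^sup>2 \<ge> x_minus n \<epsilon>")
    case True
    have "(1 - 1 / K) * \<delta>' * thermal_fun \<nu> r \<ge> 0"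
      using K \<delta> thermal_fun_bounds(1)[OF \<nu>] by (auto simp: \<delta>'_def intro!: mult_nonneg_nonneg)
    with tail[OF True] show ?thesis by linarith
  next
    case False
    have "(norm r)\<^sup>2 powr (real n / 2) \<le> x_minus n \<epsilon> powr (real n / 2)"
      using False by (intro powr_mono2) auto
    then have "g \<le> 2 * \<epsilon> * beta_coeff n * x_minus n \<epsilon> powr (real n / 2)"
      unfolding gx using \<epsilon> beta_coeff_pos[of n] by (intro mult_left_mono) auto
    then have "g \<le> A" using x_minus_powr[OF n \<epsilon>(1) a] by (simp add: A_def)
    then have "(1 - \<delta>') * ((A - g) * vac_fun r) \<ge> 0" "\<delta>' * thermal_fun \<nu> r \<ge> 0"
      using \<delta> vac_fun_bounds(1)[of r] thermal_fun_bounds(1)[OF \<nu>] by (auto simp: \<delta>'_def intro!: mult_nonneg_nonneg)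
    with W show ?thesis by linarith
  qed
qed

text \<open>Both densities have mass 1, so comparing excesses reverses into comparing the integrals
  of \<open>min (U r) t\<close>, to which a heavy tail contributes visibly.\<close>

lemma integral_excess_eq:
  assumes "phase_space_density U" "t > 0" and [measurable]: "U \<in> borel_measurable borel"
  shows "integrable lborel (\<lambda>r. min (U r) t)"
    and "(LINT r|lebesgue. max 0 (U r - t)) = 1 - (LINT r|lborel. min (U r) t)"
proof -
  have U0: "\<And>r. 0 \<le> U r" and Ui: "integrable lborel U" and U1: "(LINT r|lborel. U r) = 1"
    using assms by (auto simp: phase_space_density_def integrable_completion integral_completion)
  show i: "integrable lborel (\<lambda>r. min (U r) t)"
    by (rule Bochner_Integration.integrable_bound[OF Ui])
       (use U0 assms(2) in \<open>auto intro!: AE_I2 simp: min_def\<close>)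
  have "(LINT r|lebesgue. max 0 (U r - t)) = (LINT r|lborel. U r - min (U r) t)"
    by (subst integral_completion) (auto intro!: Bochner_Integration.integral_cong simp: max_def min_def)
  also have "\<dots> = 1 - (LINT r|lborel. min (U r) t)"
    using Ui i U1 by simp
  finally show "(LINT r|lebesgue. max 0 (U r - t)) = 1 - (LINT r|lborel. min (U r) t)" .
qed

lemma integral_min_vac_fun_le:
  assumes "Y \<ge> 0"
  shows "(LINT r|lborel. min (vac_fun r) (exp (- Y) / pi)) \<le> exp (- Y) * (Y + 1)"
proof -
  let ?f = "\<lambda>x. min (exp (- x) / pi) (exp (- Y) / pi)"
  let ?h = "\<lambda>x. exp (- Y) / pi * indicator {0..Y} x + indicator {Y<..} x * exp (- x) / pi"
  have "(LINT r|lborel. min (vac_fun r) (exp (- Y) / pi)) = pi * (LINT x|lborel. indicator {0..} x * ?f x)"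
    using radial_integral_plane(2)[of ?f] by (simp add: vac_fun_def)
  also have "\<dots> \<le> pi * (LINT x|lborel. ?h x)"
  proof (intro mult_left_mono integral_mono)
    show 1: "integrable lborel ?h"
      using assms integral_exp_Ioi(1)[of Y]
      by (intro Bochner_Integration.integrable_add integrable_mult_right integrable_divide integrable_real_indicator) auto
    show le: "indicator {0..} x * ?f x \<le> ?h x" for x
      using assms by (auto split: split_indicator)
    show "integrable lborel (\<lambda>x. indicator {0..} x * ?f x)"
      by (rule Bochner_Integration.integrable_bound[OF 1])
         (use le in \<open>auto intro!: AE_I2 split: split_indicator\<close>)
  qed simp
  also have "(LINT x|lborel. ?h x) = exp (- Y) / pi * Y + exp (- Y) / pi"
    using assms integral_exp_Ioi[of Y] by (subst Bochner_Integration.integral_add) auto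
  also have "pi * (exp (- Y) / pi * Y + exp (- Y) / pi) = exp (- Y) * (Y + 1)"
    by (simp add: field_simps)
  finally show ?thesis .
qed

text \<open>At level \<open>t = exp (- Y) / pi\<close> the truncated vacuum has mass at most
  \<open>t * pi * (Y + 1)\<close>, whereas \<open>W\<close> exceeds \<open>t\<close> on an annulus
  of area \<open>pi * (U - X)\<close>, with \<open>U\<close> growing like \<open>s * Y\<close>.
  Since \<open>s > 1\<close>, the annulus wins for large \<open>Y\<close>.\<close>

lemma not_vacuum_majorized_by_heavy_tail:
  assumes W: "phase_space_density W" and [measurable]: "W \<in> borel_measurable borel"
    and s: "s > 1" and \<kappa>: "\<kappa> > 0" and X: "X \<ge> 0"
    and tail: "\<And>r. (norm r)\<^sup>2 \<ge> X \<Longrightarrow> W r \<ge> \<kappa> * exp (- (norm r)\<^sup>2 / s)"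
  shows "\<not> vac_fun \<prec>\<^sub>c W"
proof
  assume maj: "vac_fun \<prec>\<^sub>c W"
  define l where "l = ln (\<kappa> * pi)"
  \<comment> \<open>Solved from \<open>U - X > Y + 1\<close>, the inequality that is contradicted at
    the end. The shift \<open>l\<close> accounts for \<open>\<kappa>\<close>: the lower bound on
    \<open>W\<close> equals \<open>t\<close> exactly at squared radius \<open>U\<close>.\<close>
  define Y where "Y = max 0 ((X + 1 - s * l) / (s - 1)) + 1"
  define U where "U = s * (Y + l)"
  define t where "t = exp (- Y) / pi"
  have t: "t > 0" by (simp add: t_def)
  have Y0: "Y \<ge> 0" and "Y > (X + 1 - s * l) / (s - 1)" by (auto simp: Y_def)
  then have "(s - 1) * Y > X + 1 - s * l" using s by (simp add: field_simps)
  then have UX: "U - X > Y + 1" by (simp add: U_def algebra_simps)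
  have "exp (- U / s) = exp (- Y - l)" using s by (simp add: U_def)
  also have "\<dots> = exp (- Y) / (\<kappa> * pi)" unfolding exp_diff l_def using \<kappa> by simp
  finally have \<kappa>U: "\<kappa> * exp (- U / s) = t" using \<kappa> by (simp add: t_def)
  have below: "t * indicator {X..U} ((norm r)\<^sup>2) \<le> min (W r) t" for r
  proof (cases "(norm r)\<^sup>2 \<in> {X..U}")
    case True
    then have "\<kappa> * exp (- U / s) \<le> \<kappa> * exp (- (norm r)\<^sup>2 / s)"
      using s \<kappa> by (intro mult_left_mono) (auto simp: divide_right_mono)
    also have "\<dots> \<le> W r" using True by (intro tail) auto
    finally show ?thesis using True \<kappa>U by simp
  next
    case False
    moreover have "0 \<le> W r" using W unfolding phase_space_density_def by blast
    ultimately show ?thesis using t by simp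
  qed
  have ind_int: "integrable lborel (\<lambda>r :: real \<times> real. t * indicator {X..U} ((norm r)\<^sup>2))"
    and ind_eq: "(LINT r|lborel. t * indicator {X..U} ((norm (r :: real \<times> real))\<^sup>2)) = t * (pi * (U - X))"
  proof -
    have "has_bochner_integral lborel (indicat_real {X..U}) (measure lborel {X..U})"
      using UX Y0 by (intro has_bochner_integral_real_indicator) auto
    also have "indicat_real {X..U} = (\<lambda>x. indicator {0..} x * indicator {X..U} x)"
      using X by (auto simp: fun_eq_iff split: split_indicator)
    finally have "has_bochner_integral lborel (\<lambda>r :: real \<times> real. indicator {X..U} ((norm r)\<^sup>2)) (pi * (U - X))"
      using has_bochner_integral_radial_plane[of "indicator {X..U}" "U - X"] UX Y0 by simp
    from has_bochner_integral_mult_right[OF this, of t]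
    show "integrable lborel (\<lambda>r :: real \<times> real. t * indicator {X..U} ((norm r)\<^sup>2))"
      "(LINT r|lborel. t * indicator {X..U} ((norm (r :: real \<times> real))\<^sup>2)) = t * (pi * (U - X))"
      by (simp_all add: has_bochner_integral_iff)
  qed
  have "t * (pi * (U - X)) \<le> (LINT r|lborel. min (W r) t)"
    unfolding ind_eq[symmetric]
    by (rule integral_mono[OF ind_int integral_excess_eq(1)[OF W t]]) (use below in auto)
  moreover have "(LINT r|lborel. min (W r) t) \<le> (LINT r|lborel. min (vac_fun r) t)"
    using cont_majorized_by_imp_integral_excess_le[OF phase_space_density_vacuum W maj t]
    by (simp add: integral_excess_eq(2)[OF _ t] W phase_space_density_vacuum)
  moreover have "(LINT r|lborel. min (vac_fun r) t) \<le> t * (pi * (Y + 1))"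
    using integral_min_vac_fun_le[OF Y0] by (simp add: t_def)
  ultimately have "t * (pi * (U - X)) \<le> t * (pi * (Y + 1))" by linarith
  then show False using UX t by simp
qed

section \<open>The second-order gain\<close>

lemma eventually_not_majorized_by_vacuum:
  assumes n: "n \<ge> 3" and \<nu>: "\<nu> > 0"
    and nonneg: "\<forall>\<^sub>F \<epsilon> in at_right 0. 0 \<le> delta n \<nu> K \<epsilon> \<and> delta n \<nu> K \<epsilon> \<le> 1 \<and>
      phase_space_density (wigner (rho n \<nu> K \<epsilon>))"
  shows "\<forall>\<^sub>F \<epsilon> in at_right 0. \<not> wigner (rho n \<nu> K \<epsilon>) \<prec>\<^sub>c vac_fun"
proof -
  obtain Y where Y: "Y \<ge> 1" and J: "J_tail n Y + J_bulk n Y > 0"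
    using J_pos[OF n] by blast
  \<comment> \<open>Sized so that the shift to \<open>Z\<close> consumes exactly half of the
    positive coefficient.\<close>
  define \<eta> where "\<eta> = (J_tail n Y + J_bulk n Y) / 2 ^ Suc n"
  have \<eta>: "\<eta> > 0" using J by (simp add: \<eta>_def)
  define Z where "Z = Y + \<eta>"
  have "2 ^ n * \<eta> = (J_tail n Y + J_bulk n Y) / 2" by (simp add: \<eta>_def)
  then have JZ: "J_tail n Z + J_bulk n Y > 0"
    using J_tail_shift[of Y \<eta> n] Y \<eta> J by (simp add: Z_def)
  have Z0: "Z \<ge> 0" using Y \<eta> by (simp add: Z_def)
  define T where "T = exp (- Y) / pi"
  have T: "T > 0" by (simp add: T_def)
  \<comment> \<open>The margin by which the vacuum lies below \<open>T\<close> beyond squared radius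
    \<open>Z\<close>; it does not depend on \<epsilon>.\<close>
  define gap where "gap = T - exp (- Z) / pi"
  have gap: "gap > 0" using \<eta> by (simp add: gap_def T_def Z_def divide_strict_right_mono)
  define B where "B = beta_coeff n * (1 + fact n)"
  have B0: "B \<ge> 0" using beta_coeff_pos[of n] by (simp add: B_def add_nonneg_nonneg)
  have cross: "\<bar>cross_fun n r\<bar> \<le> B" for r unfolding B_def by (rule cross_fun_bound)
  obtain B1 where B1: "\<bar>fock_fun n r\<bar> \<le> B1" for r using fock_fun_bound by blast
  \<comment> \<open>An integrable envelope for the second-order part of the perturbation, divided by
    the square of \<epsilon>. The vacuum is counted twice: once against the Fock term, once against
    the thermal term.\<close>
  define E where "E r = \<bar>fock_fun n r\<bar> + 2 * vac_fun r + thermal_fun \<nu> r" for r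
  have E0: "E r \<ge> 0" for r
    using vac_fun_bounds(1)[of r] thermal_fun_bounds(1)[OF \<nu>, of r] by (simp add: E_def)
  have EB: "E r \<le> B1 + 3" for r
    using vac_fun_bounds(2)[of r] thermal_fun_bounds(2)[OF \<nu>, of r] B1[of r] by (simp add: E_def)
  note ivac = has_bochner_integral_vac_fun[THEN integrable.intros]
    and ifock = has_bochner_integral_fock_fun[THEN integrable.intros]
    and itherm = has_bochner_integral_thermal_fun[OF \<nu>, THEN integrable.intros]
  have iE: "integrable lborel E"
    unfolding E_def [abs_def]
    by (intro Bochner_Integration.integrable_add integrable_mult_right integrable_abs ivac ifock itherm)
  define L where "L = (LINT r|lborel. E r)"
  define m where "m r = min (vac_fun r) T" for r
  have [measurable]: "m \<in> borel_measurable borel" unfolding m_def [abs_def] by measurable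
  have mb: "\<bar>m r\<bar> \<le> 1" for r
    using vac_fun_bounds[of r] T by (auto simp: m_def min_def)
  define I2 where "I2 = (LINT r|lborel. m r * (thermal_fun \<nu> r - vac_fun r))"
  \<comment> \<open>The guaranteed gain divided by the square of \<epsilon>, with the interference
    amplitude written out. It converges to \<open>(J_tail n Z + J_bulk n Y) / pi\<close>; the last
    term is the error from mixing first and second order.\<close>
  define D where "D \<epsilon> = (1 - delta n \<nu> K \<epsilon>) * (J_bulk n Y / pi) + delta n \<nu> K \<epsilon> / \<epsilon>\<^sup>2 * I2
      + 2 * ((1 - delta n \<nu> K \<epsilon>)\<^sup>2 * (1 - \<epsilon>\<^sup>2)) * (J_tail n Z / (2 * pi)) - 2 * \<epsilon> * B * L" for \<epsilon>
  have lim\<epsilon>: "((\<lambda>\<epsilon> :: real. \<epsilon>) \<longlongrightarrow> 0) (at_right 0)" by (rule tendsto_ident_at)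
  have lim\<delta>: "(delta n \<nu> K \<longlongrightarrow> 0) (at_right 0)" and lim\<delta>2: "((\<lambda>\<epsilon>. delta n \<nu> K \<epsilon> / \<epsilon>\<^sup>2) \<longlongrightarrow> 0) (at_right 0)"
    using n \<nu> by (auto intro!: delta_tendsto_0 delta_over_square_tendsto_0)
  have "(D \<longlongrightarrow> (1 - 0) * (J_bulk n Y / pi) + 0 * I2
      + 2 * ((1 - 0)\<^sup>2 * (1 - 0\<^sup>2)) * (J_tail n Z / (2 * pi)) - 2 * 0 * B * L) (at_right 0)"
    unfolding D_def [abs_def] by (intro tendsto_intros lim\<epsilon> lim\<delta> lim\<delta>2)
  moreover have "(1 - 0) * (J_bulk n Y / pi) + 0 * I2
      + 2 * ((1 - 0)\<^sup>2 * (1 - 0\<^sup>2)) * (J_tail n Z / (2 * pi)) - 2 * 0 * B * L > 0"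
    using JZ by (simp add: add_divide_distrib[symmetric] add.commute)
  ultimately have evD: "\<forall>\<^sub>F \<epsilon> in at_right 0. D \<epsilon> > 0"
    by (rule order_tendstoD)
  have "((\<lambda>\<epsilon>. 2 * \<epsilon> * B + \<epsilon>\<^sup>2 * (B1 + 3)) \<longlongrightarrow> 2 * 0 * B + 0\<^sup>2 * (B1 + 3)) (at_right 0)"
    by (intro tendsto_intros lim\<epsilon>)
  then have evgap: "\<forall>\<^sub>F \<epsilon> in at_right 0. 2 * \<epsilon> * B + \<epsilon>\<^sup>2 * (B1 + 3) < gap"
    by (rule order_tendstoD) (use gap in simp)
  have ev\<delta>: "\<forall>\<^sub>F \<epsilon> in at_right 0. delta n \<nu> K \<epsilon> / \<epsilon>\<^sup>2 < 1"
    using lim\<delta>2 by (rule order_tendstoD) simp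
  have ev1: "\<forall>\<^sub>F \<epsilon> :: real in at_right 0. \<epsilon> < 1"
    using lim\<epsilon> by (rule order_tendstoD) simp
  show ?thesis
    using nonneg evD evgap ev\<delta> ev1 eventually_at_right_less[of "0 :: real"]
  proof eventually_elim
    case (elim \<epsilon>)
    define \<delta> where "\<delta> = delta n \<nu> K \<epsilon>"
    define W where "W = wigner (rho n \<nu> K \<epsilon>)"
    define u where "u = sqrt (1 - \<epsilon>\<^sup>2)"
    define h where "h = (1 - \<delta>) * (2 * \<epsilon> * u)"
    have \<epsilon>: "0 < \<epsilon>" "\<epsilon> < 1" and \<delta>: "0 \<le> \<delta>" "\<delta> \<le> 1" and pW: "phase_space_density W"
      using elim by (auto simp: \<delta>_def W_def)
    have \<epsilon>2: "\<epsilon>\<^sup>2 \<le> 1" using \<epsilon> by (simp add: power_le_one)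
    have \<delta>\<epsilon>: "\<delta> \<le> \<epsilon>\<^sup>2" using elim \<epsilon> by (simp add: \<delta>_def field_simps)
    have u: "0 \<le> u" "u \<le> 1" "u\<^sup>2 = 1 - \<epsilon>\<^sup>2" using \<epsilon>2 by (auto simp: u_def)
    have h: "0 \<le> h" "h \<le> 2 * \<epsilon>"
    proof -
      show "0 \<le> h" using \<delta> u \<epsilon> by (simp add: h_def)
      have "(1 - \<delta>) * (2 * \<epsilon> * u) \<le> 1 * (2 * \<epsilon> * 1)"
        using \<delta> u \<epsilon> by (intro mult_mono mult_left_mono) auto
      then show "h \<le> 2 * \<epsilon>" by (simp add: h_def)
    qed
    \<comment> \<open>Everything in the perturbation except the interference; it is of second order
      since \<open>\<delta> \<le> \<epsilon>^2\<close>.\<close>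
    define e where "e r = (1 - \<delta>) * \<epsilon>\<^sup>2 * (fock_fun n r - vac_fun r) + \<delta> * (thermal_fun \<nu> r - vac_fun r)" for r
    have W: "W r - vac_fun r = h * cross_fun n r + e r" for r
    proof -
      have "\<bar>\<epsilon>\<bar> \<le> 1" using \<epsilon> by simp
      from wigner_rho_eq_funs[OF \<nu> this] show ?thesis
        unfolding W_def h_def e_def \<delta>_def u_def by (simp add: algebra_simps)
    qed
    have eE: "\<bar>e r\<bar> \<le> \<epsilon>\<^sup>2 * E r" for r
    proof -
      note v = vac_fun_bounds(1)[of r] and th = thermal_fun_bounds(1)[OF \<nu>, of r]
      have "\<bar>e r\<bar> \<le> \<bar>(1 - \<delta>) * \<epsilon>\<^sup>2 * (fock_fun n r - vac_fun r)\<bar> + \<bar>\<delta> * (thermal_fun \<nu> r - vac_fun r)\<bar>"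
        unfolding e_def by (rule abs_triangle_ineq)
      also have "\<dots> = (1 - \<delta>) * \<epsilon>\<^sup>2 * \<bar>fock_fun n r - vac_fun r\<bar> + \<delta> * \<bar>thermal_fun \<nu> r - vac_fun r\<bar>"
        using \<delta> by (simp add: abs_mult)
      also have "\<dots> \<le> 1 * \<epsilon>\<^sup>2 * (\<bar>fock_fun n r\<bar> + vac_fun r) + \<epsilon>\<^sup>2 * (thermal_fun \<nu> r + vac_fun r)"
        using \<delta> \<delta>\<epsilon> v th by (intro add_mono mult_mono) (auto simp: abs_le_iff)
      also have "\<dots> = \<epsilon>\<^sup>2 * E r" by (simp add: E_def algebra_simps)
      finally show ?thesis .
    qed
    have [measurable]: "W \<in> borel_measurable borel"
    proof -
      have "W = (\<lambda>r. vac_fun r + (h * cross_fun n r + e r))"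
        using W by (auto simp: fun_eq_iff diff_eq_eq)
      then show ?thesis unfolding e_def by simp
    qed
    define chi where "chi r = indicat_real {Z<..} ((norm r)\<^sup>2)" for r :: "real \<times> real"
    \<comment> \<open>An integrable minorant: the tangent of the convex function at the vacuum, plus
      the interference curvature beyond \<open>Z\<close>, minus a cubic error. The error is
      subtracted everywhere so that one formula serves both regions.\<close>
    define R where "R r = trunc_square T (vac_fun r) + (1 - \<delta>) * \<epsilon>\<^sup>2 * (m r * (fock_fun n r - vac_fun r))
        + h * (m r * cross_fun n r) + \<delta> * (m r * (thermal_fun \<nu> r - vac_fun r))
        + h\<^sup>2 / 2 * (chi r * (cross_fun n r)\<^sup>2) - 2 * \<epsilon> ^ 3 * B * E r" for r
    have lower: "R r \<le> trunc_square T (W r)" for r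
    proof -
      define a where "a = W r - vac_fun r"
      have lin: "R r = trunc_square T (vac_fun r) + m r * a + h\<^sup>2 / 2 * (chi r * (cross_fun n r)\<^sup>2) - 2 * \<epsilon> ^ 3 * B * E r"
        unfolding R_def a_def W e_def by (simp add: algebra_simps)
      have E3: "2 * \<epsilon> ^ 3 * B * E r \<ge> 0" using \<epsilon> B0 E0 by simp
      \<comment> \<open>Inside \<open>Z\<close> the state may cross the kink, so only the tangent
        inequality is used; outside, state and vacuum are both at most \<open>T\<close> and the
        expansion is exact.\<close>
      show ?thesis
      proof (cases "(norm r)\<^sup>2 > Z")
        case False
        then have "chi r = 0" by (simp add: chi_def)
        then have "R r = trunc_square T (vac_fun r) + m r * a - 2 * \<epsilon> ^ 3 * B * E r" unfolding lin by simp
        moreover have "trunc_square T (W r) \<ge> trunc_square T (vac_fun r) + m r * a"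
          unfolding m_def a_def by (rule trunc_square_convex)
        ultimately show ?thesis using E3 by linarith
      next
        case True
        then have "vac_fun r \<le> exp (- Z) / pi" by (simp add: vac_fun_def divide_right_mono)
        then have v: "vac_fun r \<le> T - gap" by (simp add: gap_def)
        have hc: "\<bar>h * cross_fun n r\<bar> \<le> 2 * \<epsilon> * B"
          unfolding abs_mult using h cross \<epsilon> by (intro mult_mono) auto
        have "\<epsilon>\<^sup>2 * E r \<le> \<epsilon>\<^sup>2 * (B1 + 3)" using EB by (intro mult_left_mono) auto
        then have "W r \<le> T"
          using W[of r] hc eE[of r] v elim(3) by linarith
        moreover have "vac_fun r \<le> T" using v gap by simp
        ultimately have tW: "trunc_square T (W r) = trunc_square T (vac_fun r) + m r * a + a\<^sup>2 / 2"
          unfolding a_def m_def by (rule trunc_square_eq)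
        \<comment> \<open>The square of \<open>e\<close> is dropped, and the mixed product is
          bounded by first order times second order.\<close>
        have aQ: "a\<^sup>2 \<ge> h\<^sup>2 * (cross_fun n r)\<^sup>2 - 4 * \<epsilon> ^ 3 * B * E r"
        proof -
          have "\<bar>(h * cross_fun n r) * e r\<bar> \<le> (2 * \<epsilon> * B) * (\<epsilon>\<^sup>2 * E r)"
            unfolding abs_mult[of "h * cross_fun n r"] using hc eE[of r] \<epsilon> B0 by (intro mult_mono) auto
          then have "2 * ((h * cross_fun n r) * e r) \<ge> - (4 * \<epsilon> ^ 3 * B * E r)"
            by (simp add: abs_le_iff power2_eq_square power3_eq_cube mult_ac)
          moreover have "a\<^sup>2 = h\<^sup>2 * (cross_fun n r)\<^sup>2 + 2 * ((h * cross_fun n r) * e r) + (e r)\<^sup>2"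
            unfolding a_def W by (simp add: power2_sum power_mult_distrib)
          ultimately show ?thesis using zero_le_power2[of "e r"] by linarith
        qed
        have RQ: "R r = trunc_square T (vac_fun r) + m r * a
            + (h\<^sup>2 * (cross_fun n r)\<^sup>2 - 4 * \<epsilon> ^ 3 * B * E r) / 2"
          using True unfolding lin by (simp add: chi_def diff_divide_distrib)
        show ?thesis unfolding tW RQ by (intro add_left_mono divide_right_mono aQ) simp
      qed
    qed
    have its: "integrable lborel (\<lambda>r. trunc_square T (W r))"
    proof (rule integrable_trunc_square)
      show "integrable lborel W" using pW by (simp add: phase_space_density_def integrable_completion)
      show "0 \<le> W r" for r using pW unfolding phase_space_density_def by blast
    qed (use T in simp)
    have im: "integrable lborel (\<lambda>r. m r * f r)" if "integrable lborel f" for f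
      by (rule integrable_bounded_mult[OF that _ mb]) simp
    have i0: "integrable lborel (\<lambda>r. trunc_square T (vac_fun r))"
      using T vac_fun_bounds(1) by (intro integrable_trunc_square ivac) auto
    have i1: "integrable lborel (\<lambda>r. (1 - \<delta>) * \<epsilon>\<^sup>2 * (m r * (fock_fun n r - vac_fun r)))"
      and i2: "integrable lborel (\<lambda>r. h * (m r * cross_fun n r))"
      and i3: "integrable lborel (\<lambda>r. \<delta> * (m r * (thermal_fun \<nu> r - vac_fun r)))"
      and i4: "integrable lborel (\<lambda>r. h\<^sup>2 / 2 * (chi r * (cross_fun n r)\<^sup>2))"
      and i5: "integrable lborel (\<lambda>r. 2 * \<epsilon> ^ 3 * B * E r)"
      unfolding chi_def using n
      by (intro integrable_mult_right im Bochner_Integration.integrable_diff ivac ifock itherm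
          integrable_cross_fun iE integral_cross_fun_square(1)[OF Z0]; simp)+
    have v1: "(LINT r|lborel. m r * (fock_fun n r - vac_fun r)) = J_bulk n Y / pi"
      unfolding m_def T_def by (rule integral_min_vac_fun_fock_fun)
    \<comment> \<open>The slope \<open>m\<close> is radial, so the term of first order in \<epsilon>
      averages out over angles; without this it would dominate the gain.\<close>
    have v2: "(LINT r|lborel. m r * cross_fun n r) = 0"
      using integral_radial_cross_fun[of "\<lambda>x. min (exp (- x) / pi) T" n] n
      by (simp add: m_def vac_fun_def)
    have v4: "(LINT r|lborel. chi r * (cross_fun n r)\<^sup>2) = J_tail n Z / (2 * pi)"
      using integral_cross_fun_square(2)[OF Z0, of n] n by (simp add: chi_def)
    have iR: "integrable lborel R"
      unfolding R_def [abs_def]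
      by (intro Bochner_Integration.integrable_diff Bochner_Integration.integrable_add i0 i1 i2 i3 i4 i5)
    have "(LINT r|lborel. R r) = (LINT r|lborel. trunc_square T (vac_fun r))
        + (1 - \<delta>) * \<epsilon>\<^sup>2 * (J_bulk n Y / pi) + h * 0 + \<delta> * I2
        + h\<^sup>2 / 2 * (J_tail n Z / (2 * pi)) - 2 * \<epsilon> ^ 3 * B * L"
      unfolding R_def [abs_def] v1[symmetric] v2[symmetric] v4[symmetric] I2_def L_def
      using i0 i1 i2 i3 i4 i5
      by (simp only: Bochner_Integration.integral_add Bochner_Integration.integral_diff
          Bochner_Integration.integrable_add integral_mult_right_zero)
    also have "\<dots> = (LINT r|lborel. trunc_square T (vac_fun r)) + \<epsilon>\<^sup>2 * D \<epsilon>"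
    proof -
      have "h\<^sup>2 / 2 = \<epsilon>\<^sup>2 * (2 * ((1 - \<delta>)\<^sup>2 * (1 - \<epsilon>\<^sup>2)))"
        by (simp add: h_def power_mult_distrib u(3))
      moreover have "\<delta> * I2 = \<epsilon>\<^sup>2 * (\<delta> / \<epsilon>\<^sup>2 * I2)" using \<epsilon> by simp
      moreover have "2 * \<epsilon> ^ 3 * B * L = \<epsilon>\<^sup>2 * (2 * \<epsilon> * B * L)"
        by (simp add: power2_eq_square power3_eq_cube)
      ultimately show ?thesis
        unfolding D_def \<delta>_def[symmetric] by (simp only: distrib_left right_diff_distrib mult_ac)
    qed
    finally have "(LINT r|lborel. R r) > (LINT r|lborel. trunc_square T (vac_fun r))"
      using elim(2) \<epsilon> by simp
    moreover have "(LINT r|lborel. R r) \<le> (LINT r|lborel. trunc_square T (W r))"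
      by (rule integral_mono[OF iR its]) (auto intro: lower)
    ultimately have "\<not> W \<prec>\<^sub>c vac_fun"
      using cont_majorized_by_imp_integral_trunc_square_le[OF pW phase_space_density_vacuum _ T] by force
    then show ?case by (simp add: W_def)
  qed
qed

text \<open>Stating the density property of both functions places the two negations inside the
  domain of the majorization relation, so that neither holds merely because a function is not a
  density.\<close>

theorem mainTheorem5:
  fixes n :: nat and \<nu> K :: real
  assumes "n \<ge> 3" and "\<nu> > 0" and "K > 1"
  shows "phase_space_density vacuum_wigner \<and>
    (\<forall>\<^sub>F \<epsilon> in at_right 0.
       0 < delta n \<nu> K \<epsilon> \<and> delta n \<nu> K \<epsilon> < 1 \<and>
       phase_space_density (wigner (rho n \<nu> K \<epsilon>)) \<and>
       \<not> wigner (rho n \<nu> K \<epsilon>) \<prec>\<^sub>c vacuum_wigner \<and>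
       \<not> vacuum_wigner \<prec>\<^sub>c wigner (rho n \<nu> K \<epsilon>))"
proof -
  have s: "s_par \<nu> > 1" and c: "c_par \<nu> > 0" using assms by (auto intro: s_par_gt_1 c_par_pos)
  \<comment> \<open>The threshold is where \<open>x powr (n / 2) * exp (- c_par \<nu> * x)\<close>
    has its maximum; \<open>x_minus\<close> must lie beyond it for the thermal term to dominate
    outward.\<close>
  have evx: "\<forall>\<^sub>F \<epsilon> in at_right 0. x_minus n \<epsilon> > max 0 (real n / 2 / c_par \<nu>)"
  proof -
    have "filterlim (x_minus n) at_top (at_right 0)" using assms by (intro x_minus_at_top) simp
    then show ?thesis unfolding filterlim_at_top_dense by blast
  qed
  have ev\<delta>: "\<forall>\<^sub>F \<epsilon> in at_right 0. delta n \<nu> K \<epsilon> < 1"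
    using delta_tendsto_0[of n \<nu> K] assms by (intro order_tendstoD) auto
  have ev1: "\<forall>\<^sub>F \<epsilon> :: real in at_right 0. \<epsilon> < 1"
    using tendsto_ident_at[of "0 :: real" "{0<..}"] by (rule order_tendstoD) simp
  have main: "\<forall>\<^sub>F \<epsilon> in at_right 0. 0 < delta n \<nu> K \<epsilon> \<and> delta n \<nu> K \<epsilon> < 1 \<and>
      phase_space_density (wigner (rho n \<nu> K \<epsilon>)) \<and> \<not> vac_fun \<prec>\<^sub>c wigner (rho n \<nu> K \<epsilon>)"
    using evx ev\<delta> ev1 eventually_amplitude_pos[of n] eventually_at_right_less[of "0 :: real"]
  proof eventually_elim
    case (elim \<epsilon>)
    have n: "n \<ge> 1" using assms by simp
    have \<delta>: "0 < delta n \<nu> K \<epsilon>"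
      using elim assms s by (simp add: delta_eq)
    have x: "0 < x_minus n \<epsilon>" "real n / 2 \<le> c_par \<nu> * x_minus n \<epsilon>"
    proof -
      have "0 < x_minus n \<epsilon>" "real n / 2 / c_par \<nu> < x_minus n \<epsilon>"
        using elim(1) unfolding max_less_iff_conj by auto
      then show "0 < x_minus n \<epsilon>" "real n / 2 \<le> c_par \<nu> * x_minus n \<epsilon>"
        using c by (auto simp: field_simps)
    qed
    note bounds = wigner_rho_lower_bounds[OF n assms(2,3) elim(5,3,4) less_imp_le[OF \<delta>] less_imp_le[OF elim(2)] x]
    have "has_bochner_integral lborel (wigner (rho n \<nu> K \<epsilon>)) 1"
      using elim assms by (intro has_bochner_integral_wigner_rho) auto
    then have borel: "wigner (rho n \<nu> K \<epsilon>) \<in> borel_measurable borel"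
      and dens: "phase_space_density (wigner (rho n \<nu> K \<epsilon>))"
      using bounds(1) by (auto intro!: phase_space_densityI simp: has_bochner_integral_iff)
    define \<kappa> where "\<kappa> = (1 - 1 / K) * delta n \<nu> K \<epsilon> / (s_par \<nu> * pi)"
    have \<kappa>: "\<kappa> > 0" using \<delta> assms s by (simp add: \<kappa>_def)
    have tail: "wigner (rho n \<nu> K \<epsilon>) r \<ge> \<kappa> * exp (- (norm r)\<^sup>2 / s_par \<nu>)"
      if "(norm r)\<^sup>2 \<ge> x_minus n \<epsilon>" for r
      using bounds(2)[OF that] by (simp add: \<kappa>_def thermal_fun_def)
    have "\<not> vac_fun \<prec>\<^sub>c wigner (rho n \<nu> K \<epsilon>)"
      by (rule not_vacuum_majorized_by_heavy_tail[OF dens borel s \<kappa> less_imp_le[OF x(1)] tail])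
    with \<delta> elim(2) dens show ?case by blast
  qed
  have "\<forall>\<^sub>F \<epsilon> in at_right 0. \<not> wigner (rho n \<nu> K \<epsilon>) \<prec>\<^sub>c vac_fun"
    by (rule eventually_not_majorized_by_vacuum[OF assms(1,2)])
       (rule eventually_mono[OF main], auto)
  with main show ?thesis
    unfolding vacuum_wigner_eq_vac_fun
    by (intro conjI phase_space_density_vacuum) (auto elim: eventually_elim2)
qed

end
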